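(* Let $h$ be a formal parameter. The deformed Weyl algebra $\mathcal{U}_h(\mathfrak{an}^3)\rtimes\mathfrak{T}^4[[h]]^{\mathrm{DJ}}$ (the deformed phase space subalgebra of the DSR algebra) and the undeformed $h$-adic Weyl algebra $\mathfrak{W}^4[[h]]$ are isomorphic as $h$-adic ($\mathbb{C}[[h]]$-)algebras.
   Context: All algebras are unital and associative, over $\mathbb{C}[[h]]$, complete in the $h$-adic topology; tensor products are $h$-adically completed. Indices $\mu,\nu\in\{0,1,2,3\}$, $i,j,k,m\in\{1,2,3\}$; the metric $\eta_{\mu\nu}=\mathrm{diag}(-,+,+,+)$ raises and lowers indices; repeated indices are summed; $\imath=\sqrt{-1}$. Undeformed Weyl algebra: $\mathfrak{W}^4$ is generated over $\mathbb{C}$ by $x_\mu,p_\mu$ with relations $[p_\mu,x_\nu]=-\imath\eta_{\mu\nu}$, $[x_\mu,x_\nu]=[p_\mu,p_\nu]=0$; $\mathfrak{W}^4[[h]]$ is its algebra of formal power series in $h$. $\kappa$-Minkowski spacetime: $\mathcal{U}_h(\mathfrak{an}^3)$ is the universal $h$-adic unital algebra with generators $\mathcal{X}_\mu$ and relations $[\mathcal{X}_0,\mathcal{X}_i]=-\imath h\mathcal{X}_i$, $[\mathcal{X}_j,\mathcal{X}_k]=0$. Deformed momenta: $\mathfrak{T}^4[[h]]^{\mathrm{DJ}}$ is the commutative algebra $\mathbb{C}[P_0,P_1,P_2,P_3][[h]]$ with, for $P^2=\vec P^2-P_0^2$ and $\Xi=hP_0+\sqrt{1-h^2P^2}$ (a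 formal power series in $h$), the coproduct $\Delta(P_i)=P_i\otimes\Xi+1\otimes P_i$, $\Delta(P_0)=P_0\otimes\Xi+\Xi^{-1}\otimes P_0+hP_m\Xi^{-1}\otimes P^m$ and counit $\epsilon(P_\mu)=0$. It acts on $\mathcal{U}_h(\mathfrak{an}^3)$ by $P_\mu\triangleright\mathcal{X}^\nu=-\imath\delta_\mu^\nu$, making it a module algebra. The deformed Weyl algebra is the smash product, i.e. the vector space $\mathcal{U}_h(\mathfrak{an}^3)\otimes\mathfrak{T}^4[[h]]^{\mathrm{DJ}}$ with product $(f\otimes L)(g\otimes M)=f(L_{(1)}\triangleright g)\otimes L_{(2)}M$. Its cross relations are $[P_k,\mathcal{X}_0]=0$, $[P_k,\mathcal{X}_j]=-\imath\delta_{jk}\big(hP_0+\sqrt{1-h^2P^2}\big)$, $[P_0,\mathcal{X}_j]=-\imath hP_j$, $[P_0,\mathcal{X}_0]=\imath\sqrt{1-h^2P^2}$. *)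

theory Defs
  imports
    Complex_Main
    "HOL-Library.Poly_Mapping"
    "HOL-Library.Numeral_Type"
    "HOL-Computational_Algebra.Formal_Power_Series"
begin

unbundle fps_syntax

section \<open>Algebras over the complex numbers and h-adic algebras\<close>

class complex_algebra = ring_1 +
  fixes cscale :: "complex \<Rightarrow> 'a \<Rightarrow> 'a"  (infixr \<open>*\<^sub>C\<close> 75)
  assumes cscale_add_right: "c *\<^sub>C (x + y) = c *\<^sub>C x + c *\<^sub>C y"
    and cscale_add_left: "(c + d) *\<^sub>C x = c *\<^sub>C x + d *\<^sub>C x"
    and cscale_cscale: "c *\<^sub>C d *\<^sub>C x = (c * d) *\<^sub>C x"
    and cscale_one: "1 *\<^sub>C x = x"
    and cscale_mult_left: "(c *\<^sub>C x) * y = c *\<^sub>C (x * y)"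
    and cscale_mult_right: "x * (c *\<^sub>C y) = c *\<^sub>C (x * y)"

text \<open>
  The deformation parameter \<open>h\<close> is \<^const>\<open>fps_X\<close> in the ring \<open>complex fps\<close> of formal power
  series.  The last two axioms say that the h-adic topology is Hausdorff and complete; every
  h-adic Cauchy sequence has a subsequence of the form occurring in \<open>hadic_complete\<close>.
  \<open>ring_1\<close> is avoided because it demands \<open>0 \<noteq> 1\<close>.
\<close>

class hadic_algebra = ring + monoid_mult +
  fixes hscale :: "complex fps \<Rightarrow> 'a \<Rightarrow> 'a"  (infixr \<open>*\<^sub>h\<close> 75)
  assumes hscale_add_right: "c *\<^sub>h (x + y) = c *\<^sub>h x + c *\<^sub>h y"
    and hscale_add_left: "(c + d) *\<^sub>h x = c *\<^sub>h x + d *\<^sub>h x"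
    and hscale_hscale: "c *\<^sub>h d *\<^sub>h x = (c * d) *\<^sub>h x"
    and hscale_one: "1 *\<^sub>h x = x"
    and hscale_mult_left: "(c *\<^sub>h x) * y = c *\<^sub>h (x * y)"
    and hscale_mult_right: "x * (c *\<^sub>h y) = c *\<^sub>h (x * y)"
    and hadic_separated: "(\<forall>n. \<exists>y. x = fps_X ^ n *\<^sub>h y) \<Longrightarrow> x = 0"
    and hadic_complete: "(\<forall>n. \<exists>y. s (Suc n) - s n = fps_X ^ n *\<^sub>h y) \<Longrightarrow>
      \<exists>l. \<forall>n. \<exists>y. l - s n = fps_X ^ n *\<^sub>h y"

lemma hscale_zero_right: "c *\<^sub>h (0::'a::hadic_algebra) = 0"
  using hscale_add_right[of c "0::'a" 0] by simp

lemma hscale_minus_right: "c *\<^sub>h (- x) = - (c *\<^sub>h (x::'a::hadic_algebra))"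
  using hscale_add_right[of c x "- x"] by (simp add: hscale_zero_right eq_neg_iff_add_eq_0 add.commute)

lemma hscale_diff_right: "c *\<^sub>h (x - y) = c *\<^sub>h x - c *\<^sub>h (y::'a::hadic_algebra)"
  using hscale_add_right[of c x "- y"] by (simp add: hscale_minus_right)

lemma hscale_conv_mult: "c *\<^sub>h x = (c *\<^sub>h 1) * (x::'a::hadic_algebra)"
  by (simp add: hscale_mult_left)

lemma cscale_conv_mult: "c *\<^sub>C x = (c *\<^sub>C 1) * (x::'a::complex_algebra)"
  by (simp add: cscale_mult_left)

lemma cscale_zero_left: "0 *\<^sub>C x = (0::'a::complex_algebra)"
  using cscale_add_left[of 0 0 x] by simp

lemma cscale_zero_right: "c *\<^sub>C 0 = (0::'a::complex_algebra)"
  using cscale_add_right[of c "0::'a" 0] by simp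

definition hlinear :: "('a::hadic_algebra \<Rightarrow> 'b::hadic_algebra) \<Rightarrow> bool"
  where "hlinear F \<longleftrightarrow> (\<forall>x y. F (x + y) = F x + F y) \<and> (\<forall>c x. F (c *\<^sub>h x) = c *\<^sub>h F x)"

definition hbilinear :: "('a::hadic_algebra \<Rightarrow> 'b::hadic_algebra \<Rightarrow> 'c::hadic_algebra) \<Rightarrow> bool"
  where "hbilinear B \<longleftrightarrow> (\<forall>y. hlinear (\<lambda>x. B x y)) \<and> (\<forall>x. hlinear (B x))"

definition hadic_hom :: "('a::hadic_algebra \<Rightarrow> 'b::hadic_algebra) \<Rightarrow> bool"
  where "hadic_hom F \<longleftrightarrow> hlinear F \<and> (\<forall>x y. F (x * y) = F x * F y) \<and> F 1 = 1"

section \<open>Instances\<close>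

instantiation complex :: complex_algebra
begin
definition cscale_complex :: "complex \<Rightarrow> complex \<Rightarrow> complex"
  where "cscale_complex c x = c * x"
instance by standard (auto simp: cscale_complex_def algebra_simps)
end

lemma poly_mapping_induct_add:
  fixes f :: "'k \<Rightarrow>\<^sub>0 'a::comm_monoid_add"
  assumes single: "\<And>k v. Q (Poly_Mapping.single k v)"
    and add: "\<And>f g. Q f \<Longrightarrow> Q g \<Longrightarrow> Q (f + g)"
  shows "Q f"
proof -
  have zero: "Q 0" using single[of undefined 0] by simp
  have "Q (\<Sum>k\<in>A. Poly_Mapping.single k (Poly_Mapping.lookup f k))" for A
    by (induction A rule: infinite_finite_induct) (auto simp: zero single add)
  moreover have "(\<Sum>k\<in>Poly_Mapping.keys f. Poly_Mapping.single k (Poly_Mapping.lookup f k)) = f"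
    by (rule poly_mapping_eqI) (simp add: lookup_sum lookup_single when_def in_keys_iff)
  ultimately show ?thesis by metis
qed

lemma single_zero_central:
  fixes f :: "'k::monoid_add \<Rightarrow>\<^sub>0 'a::semiring_1"
  assumes "\<And>x. a * x = x * a"
  shows "f * Poly_Mapping.single 0 a = Poly_Mapping.single 0 a * f"
  by (induction f rule: poly_mapping_induct_add) (simp_all add: mult_single assms algebra_simps)

instantiation poly_mapping :: (monoid_add, complex_algebra) complex_algebra
begin
definition cscale_poly_mapping :: "complex \<Rightarrow> ('a \<Rightarrow>\<^sub>0 'b) \<Rightarrow> 'a \<Rightarrow>\<^sub>0 'b"
  where "cscale_poly_mapping c f = Poly_Mapping.single 0 (c *\<^sub>C 1) * f"
instance
proof
  fix c d :: complex and x y :: "'a \<Rightarrow>\<^sub>0 'b"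
  have central: "(c *\<^sub>C (1::'b)) * z = z * (c *\<^sub>C 1)" for z
    by (simp add: cscale_mult_left cscale_mult_right)
  show "c *\<^sub>C (x + y) = c *\<^sub>C x + c *\<^sub>C y"
    by (simp add: cscale_poly_mapping_def algebra_simps)
  show "(c + d) *\<^sub>C x = c *\<^sub>C x + d *\<^sub>C x"
    by (simp add: cscale_poly_mapping_def algebra_simps cscale_add_left single_add)
  show "c *\<^sub>C d *\<^sub>C x = (c * d) *\<^sub>C x"
    by (simp add: cscale_poly_mapping_def mult.assoc[symmetric] mult_single
        cscale_mult_left cscale_cscale)
  show "1 *\<^sub>C x = x"
    by (simp add: cscale_poly_mapping_def cscale_one)
  show "(c *\<^sub>C x) * y = c *\<^sub>C (x * y)"
    by (simp add: cscale_poly_mapping_def mult.assoc)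
  show "x * (c *\<^sub>C y) = c *\<^sub>C (x * y)"
    using single_zero_central[of "c *\<^sub>C 1" x, OF central]
    by (simp add: cscale_poly_mapping_def mult.assoc[symmetric])
qed
end

lemma fps_central_mult:
  fixes f g :: "'a::ring_1 fps"
  assumes "\<And>n x. f $ n * x = x * f $ n"
  shows "f * g = g * f"
proof (rule fps_ext)
  fix n
  have "(f * g) $ n = (\<Sum>i=0..n. g $ (n - i) * f $ i)"
    by (simp add: fps_mult_nth assms)
  also have "\<dots> = (\<Sum>i=0..n. g $ i * f $ (n - i))"
    by (subst sum.atLeastAtMost_rev) (auto intro!: sum.cong)
  finally show "(f * g) $ n = (g * f) $ n" by (simp add: fps_mult_nth)
qed

instantiation fps :: (complex_algebra) hadic_algebra
begin

definition hscale_fps :: "complex fps \<Rightarrow> 'a fps \<Rightarrow> 'a fps"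
  where "hscale_fps c f = Abs_fps (\<lambda>n. (c $ n) *\<^sub>C 1) * f"

lemma hscale_fps_X_power: "fps_X ^ n *\<^sub>h f = fps_X ^ n * (f :: 'a fps)"
proof -
  have "Abs_fps (\<lambda>k. ((fps_X ^ n :: complex fps) $ k) *\<^sub>C (1::'a)) = fps_X ^ n"
    by (rule fps_ext) (simp add: fps_X_power_nth cscale_one cscale_zero_left)
  then show ?thesis by (simp add: hscale_fps_def)
qed

instance
proof
  fix c d :: "complex fps" and x y :: "'a fps" and s :: "nat \<Rightarrow> 'a fps"
  show "c *\<^sub>h (x + y) = c *\<^sub>h x + c *\<^sub>h y"
    by (simp add: hscale_fps_def algebra_simps)
  have "Abs_fps (\<lambda>n. ((c + d) $ n) *\<^sub>C (1::'a)) =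
      Abs_fps (\<lambda>n. (c $ n) *\<^sub>C 1) + Abs_fps (\<lambda>n. (d $ n) *\<^sub>C 1)"
    by (rule fps_ext) (simp add: cscale_add_left)
  then show "(c + d) *\<^sub>h x = c *\<^sub>h x + d *\<^sub>h x"
    by (simp add: hscale_fps_def algebra_simps)
  have sum: "(\<Sum>i\<in>A. u i) *\<^sub>C (1::'a) = (\<Sum>i\<in>A. u i *\<^sub>C 1)" for u :: "nat \<Rightarrow> complex" and A
    by (induction A rule: infinite_finite_induct) (auto simp: cscale_zero_left cscale_add_left)
  have "Abs_fps (\<lambda>n. ((c * d) $ n) *\<^sub>C (1::'a)) =
      Abs_fps (\<lambda>n. (c $ n) *\<^sub>C 1) * Abs_fps (\<lambda>n. (d $ n) *\<^sub>C 1)"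
    by (rule fps_ext) (simp add: fps_mult_nth sum cscale_mult_left cscale_cscale)
  then show "c *\<^sub>h d *\<^sub>h x = (c * d) *\<^sub>h x"
    by (simp add: hscale_fps_def mult.assoc)
  show "1 *\<^sub>h x = x"
    using hscale_fps_X_power[of 0 x] by simp
  show "(c *\<^sub>h x) * y = c *\<^sub>h (x * y)"
    by (simp add: hscale_fps_def mult.assoc)
  have "Abs_fps (\<lambda>n. (c $ n) *\<^sub>C 1) * x = x * Abs_fps (\<lambda>n. (c $ n) *\<^sub>C 1)"
    by (rule fps_central_mult) (simp add: cscale_mult_left cscale_mult_right)
  then show "x * (c *\<^sub>h y) = c *\<^sub>h (x * y)"
    by (simp add: hscale_fps_def mult.assoc[symmetric])
  show "x = 0" if "\<forall>n. \<exists>y. x = fps_X ^ n *\<^sub>h y"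
  proof (rule fps_ext)
    fix n
    from that obtain z where "x = fps_X ^ Suc n *\<^sub>h z" by blast
    then show "x $ n = 0 $ n" by (simp only: hscale_fps_X_power fps_X_power_mult_nth) simp
  qed
  show "\<exists>l. \<forall>n. \<exists>y. l - s n = fps_X ^ n *\<^sub>h y"
    if *: "\<forall>n. \<exists>y. s (Suc n) - s n = fps_X ^ n *\<^sub>h y"
  proof -
    have step: "s (Suc n) $ k = s n $ k" if "k < n" for n k
    proof -
      from * obtain z where "s (Suc n) - s n = fps_X ^ n *\<^sub>h z" by blast
      then have "(s (Suc n) - s n) $ k = 0"
        using that by (simp only: hscale_fps_X_power fps_X_power_mult_nth) simp
      then show ?thesis by simp
    qed
    have stable: "s (Suc k + m) $ k = s (Suc k) $ k" for k m
      by (induction m) (use step in auto)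
    define l where "l = Abs_fps (\<lambda>k. s (Suc k) $ k)"
    have "l - s n = fps_X ^ n *\<^sub>h fps_shift n (l - s n)" for n
    proof (rule fps_ext)
      fix k
      have "l $ k = s n $ k" if "k < n"
      proof -
        from that obtain m where "n = Suc k + m" using less_iff_Suc_add by auto
        then show ?thesis using stable[of k m] by (simp add: l_def)
      qed
      then show "(l - s n) $ k = (fps_X ^ n *\<^sub>h fps_shift n (l - s n)) $ k"
        by (simp add: hscale_fps_X_power fps_X_power_mult_nth)
    qed
    then show ?thesis by blast
  qed
qed

end

section \<open>Quotients by two-sided ideals\<close>

inductive_set two_sided_ideal :: "'a::{ring, monoid_mult} set \<Rightarrow> 'a set" for R
  where
    zero: "0 \<in> two_sided_ideal R"
  | step: "r \<in> R \<Longrightarrow> x \<in> two_sided_ideal R \<Longrightarrow> a * r * b + x \<in> two_sided_ideal R"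

definition hadic_closure :: "'a::hadic_algebra set \<Rightarrow> 'a set"
  where "hadic_closure I = {x. \<forall>n. \<exists>y\<in>I. \<exists>z. x - y = fps_X ^ n *\<^sub>h z}"

lemma two_sided_ideal_add:
  "x \<in> two_sided_ideal R \<Longrightarrow> y \<in> two_sided_ideal R \<Longrightarrow> x + y \<in> two_sided_ideal R"
  by (induction rule: two_sided_ideal.induct) (auto simp: add.assoc intro: two_sided_ideal.intros)

lemma two_sided_ideal_mult_left:
  "x \<in> two_sided_ideal R \<Longrightarrow> c * x \<in> two_sided_ideal R"
  by (induction rule: two_sided_ideal.induct)
    (auto simp: distrib_left mult.assoc[symmetric] intro: two_sided_ideal.intros)

lemma two_sided_ideal_mult_right:
  "x \<in> two_sided_ideal R \<Longrightarrow> x * c \<in> two_sided_ideal R"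
proof (induction rule: two_sided_ideal.induct)
  case (step r x a b)
  then show ?case using two_sided_ideal.step[of r R "x * c" a "b * c"]
    by (simp add: distrib_right mult.assoc)
qed (auto intro: two_sided_ideal.intros)

lemma two_sided_ideal_minus:
  fixes x :: "'a::{ring, monoid_mult}"
  assumes "x \<in> two_sided_ideal R"
  shows "- x \<in> two_sided_ideal R"
  using two_sided_ideal_mult_left[OF assms, of "- 1"] by simp

lemma two_sided_ideal_base: "r \<in> R \<Longrightarrow> r \<in> two_sided_ideal R"
  using two_sided_ideal.step[of r R 0 1 1] by (simp add: two_sided_ideal.zero)

definition is_ideal :: "'a::{ring, monoid_mult} set \<Rightarrow> bool"
  where "is_ideal I \<longleftrightarrow> 0 \<in> I \<and> (\<forall>x\<in>I. \<forall>y\<in>I. x + y \<in> I) \<and> (\<forall>x\<in>I. \<forall>c. c * x \<in> I \<and> x * c \<in> I)"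

lemma is_ideal_two_sided_ideal: "is_ideal (two_sided_ideal R)"
  by (auto simp: is_ideal_def two_sided_ideal.zero two_sided_ideal_add
      two_sided_ideal_mult_left two_sided_ideal_mult_right)

lemma is_ideal_hadic_closure:
  fixes I :: "'a::hadic_algebra set"
  assumes I: "is_ideal I"
  shows "is_ideal (hadic_closure I)"
  unfolding is_ideal_def
proof (intro conjI ballI allI)
  show "0 \<in> hadic_closure I"
    using I by (auto simp: hadic_closure_def is_ideal_def hscale_zero_right intro!: bexI[of _ 0] exI[of _ 0])
next
  fix x y assume x: "x \<in> hadic_closure I" and y: "y \<in> hadic_closure I"
  show "x + y \<in> hadic_closure I" unfolding hadic_closure_def
  proof safe
    fix n
    from x obtain x' u where x': "x' \<in> I" "x - x' = fps_X ^ n *\<^sub>h u"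
      unfolding hadic_closure_def by blast
    from y obtain y' v where y': "y' \<in> I" "y - y' = fps_X ^ n *\<^sub>h v"
      unfolding hadic_closure_def by blast
    have "x + y - (x' + y') = fps_X ^ n *\<^sub>h (u + v)"
      using x' y' by (simp add: hscale_add_right algebra_simps)
    moreover have "x' + y' \<in> I" using I x' y' by (auto simp: is_ideal_def)
    ultimately show "\<exists>w\<in>I. \<exists>z. x + y - w = fps_X ^ n *\<^sub>h z" by blast
  qed
next
  fix x c assume x: "x \<in> hadic_closure I"
  show "c * x \<in> hadic_closure I" unfolding hadic_closure_def
  proof safe
    fix n
    from x obtain x' u where x': "x' \<in> I" "x - x' = fps_X ^ n *\<^sub>h u"
      unfolding hadic_closure_def by blast
    have "c * x - c * x' = fps_X ^ n *\<^sub>h (c * u)"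
      using x' by (simp add: right_diff_distrib[symmetric] hscale_mult_right)
    moreover have "c * x' \<in> I" using I x' by (auto simp: is_ideal_def)
    ultimately show "\<exists>w\<in>I. \<exists>z. c * x - w = fps_X ^ n *\<^sub>h z" by blast
  qed
  show "x * c \<in> hadic_closure I" unfolding hadic_closure_def
  proof safe
    fix n
    from x obtain x' u where x': "x' \<in> I" "x - x' = fps_X ^ n *\<^sub>h u"
      unfolding hadic_closure_def by blast
    have "x * c - x' * c = fps_X ^ n *\<^sub>h (u * c)"
      using x' by (simp add: left_diff_distrib[symmetric] hscale_mult_left)
    moreover have "x' * c \<in> I" using I x' by (auto simp: is_ideal_def)
    ultimately show "\<exists>w\<in>I. \<exists>z. x * c - w = fps_X ^ n *\<^sub>h z" by blast
  qed
qed

lemma hadic_closure_closed: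
  fixes I :: "'a::hadic_algebra set"
  assumes "\<And>n. \<exists>y\<in>hadic_closure I. \<exists>z. x - y = fps_X ^ n *\<^sub>h z"
  shows "x \<in> hadic_closure I"
  unfolding hadic_closure_def
proof safe
  fix n
  from assms obtain y z where y: "y \<in> hadic_closure I" "x - y = fps_X ^ n *\<^sub>h z" by blast
  from y(1) obtain w u where w: "w \<in> I" "y - w = fps_X ^ n *\<^sub>h u"
    unfolding hadic_closure_def by blast
  have "x - w = fps_X ^ n *\<^sub>h (z + u)"
    using y w by (simp add: hscale_add_right algebra_simps)
  with w show "\<exists>y\<in>I. \<exists>z. x - y = fps_X ^ n *\<^sub>h z" by blast
qed

lemma is_ideal_minus: "is_ideal I \<Longrightarrow> x \<in> I \<Longrightarrow> - x \<in> I"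
  unfolding is_ideal_def by (metis mult_1 mult_minus_left)

definition ideal_rel :: "'a::{ring, monoid_mult} set \<Rightarrow> 'a \<Rightarrow> 'a \<Rightarrow> bool"
  where "ideal_rel I x y \<longleftrightarrow> x - y \<in> I"

lemma ideal_rel_equivp:
  assumes "is_ideal I"
  shows "equivp (ideal_rel I)"
proof (rule equivpI)
  show "reflp (ideal_rel I)" using assms by (auto simp: reflp_def ideal_rel_def is_ideal_def)
  show "symp (ideal_rel I)"
    unfolding symp_def ideal_rel_def by (metis assms is_ideal_minus minus_diff_eq)
  show "transp (ideal_rel I)"
  proof (rule transpI)
    fix x y z assume "ideal_rel I x y" "ideal_rel I y z"
    then have "(x - y) + (y - z) \<in> I" using assms unfolding ideal_rel_def is_ideal_def by blast
    then show "ideal_rel I x z" by (simp add: ideal_rel_def)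
  qed
qed

lemma ideal_rel_add:
  assumes "is_ideal I" "ideal_rel I x x'" "ideal_rel I y y'"
  shows "ideal_rel I (x + y) (x' + y')"
proof -
  have "(x - x') + (y - y') \<in> I" using assms unfolding ideal_rel_def is_ideal_def by blast
  then show ?thesis by (simp add: ideal_rel_def algebra_simps)
qed

lemma ideal_rel_minus:
  assumes "is_ideal I" "ideal_rel I x x'"
  shows "ideal_rel I (- x) (- x')"
  using is_ideal_minus[OF assms(1), of "x - x'"] assms(2) by (simp add: ideal_rel_def)

lemma ideal_rel_diff:
  assumes "is_ideal I" "ideal_rel I x x'" "ideal_rel I y y'"
  shows "ideal_rel I (x - y) (x' - y')"
  using ideal_rel_add[OF assms(1,2) ideal_rel_minus[OF assms(1,3)]] by simp

lemma ideal_rel_mult: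
  assumes "is_ideal I" "ideal_rel I x x'" "ideal_rel I y y'"
  shows "ideal_rel I (x * y) (x' * y')"
proof -
  have "(x - x') * y + x' * (y - y') \<in> I" using assms unfolding ideal_rel_def is_ideal_def by blast
  then show ?thesis by (simp add: ideal_rel_def algebra_simps)
qed

lemma ideal_rel_hscale:
  fixes x x' :: "'a::hadic_algebra"
  assumes "is_ideal I" "ideal_rel I x x'"
  shows "ideal_rel I (c *\<^sub>h x) (c *\<^sub>h x')"
proof -
  have "(c *\<^sub>h 1) * (x - x') \<in> I" using assms unfolding ideal_rel_def is_ideal_def by blast
  then show ?thesis
    by (simp add: ideal_rel_def hscale_conv_mult[of c x] hscale_conv_mult[of c x'] right_diff_distrib)
qed

lemma ideal_rel_cscale:
  fixes x x' :: "'a::complex_algebra"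
  assumes "is_ideal I" "ideal_rel I x x'"
  shows "ideal_rel I (c *\<^sub>C x) (c *\<^sub>C x')"
proof -
  have "(c *\<^sub>C 1) * (x - x') \<in> I" using assms unfolding ideal_rel_def is_ideal_def by blast
  then show ?thesis
    by (simp add: ideal_rel_def cscale_conv_mult[of c x] cscale_conv_mult[of c x'] right_diff_distrib)
qed

lemma ideal_rel_closed:
  fixes x :: "'a::hadic_algebra"
  assumes "\<And>n. \<exists>y. ideal_rel (hadic_closure I) x (fps_X ^ n *\<^sub>h y)"
  shows "ideal_rel (hadic_closure I) x 0"
proof -
  have "x \<in> hadic_closure I"
  proof (rule hadic_closure_closed)
    fix n
    from assms obtain y where "ideal_rel (hadic_closure I) x (fps_X ^ n *\<^sub>h y)" by blast
    then show "\<exists>y\<in>hadic_closure I. \<exists>z. x - y = fps_X ^ n *\<^sub>h z"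
      by (intro bexI[of _ "x - fps_X ^ n *\<^sub>h y"] exI[of _ y]) (auto simp: ideal_rel_def)
  qed
  then show ?thesis by (simp add: ideal_rel_def)
qed

lemma ideal_rel_complete:
  fixes s :: "nat \<Rightarrow> 'a::hadic_algebra"
  assumes I: "is_ideal I" and "\<And>n. \<exists>y. ideal_rel I (s (Suc n) - s n) (fps_X ^ n *\<^sub>h y)"
  shows "\<exists>l. \<forall>n. \<exists>y. ideal_rel I (l - s n) (fps_X ^ n *\<^sub>h y)"
proof -
  obtain y where y: "\<And>n. ideal_rel I (s (Suc n) - s n) (fps_X ^ n *\<^sub>h y n)"
    using assms(2) by metis
  define t where "t = (\<lambda>n. s 0 + (\<Sum>k<n. fps_X ^ k *\<^sub>h y k))"
  have "\<forall>n. \<exists>y. t (Suc n) - t n = fps_X ^ n *\<^sub>h y" by (auto simp: t_def)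
  then obtain l where l: "\<And>n. \<exists>y. l - t n = fps_X ^ n *\<^sub>h y"
    using hadic_complete by blast
  have ts: "ideal_rel I (t n) (s n)" for n
  proof (induction n)
    case 0
    show ?case using I by (simp add: t_def ideal_rel_def is_ideal_def)
  next
    case (Suc n)
    have "(t n - s n) + - (s (Suc n) - s n - fps_X ^ n *\<^sub>h y n) \<in> I"
      using Suc y[of n] I is_ideal_minus[OF I] unfolding ideal_rel_def is_ideal_def by blast
    then show ?case by (simp add: ideal_rel_def t_def algebra_simps)
  qed
  have "\<exists>y. ideal_rel I (l - s n) (fps_X ^ n *\<^sub>h y)" for n
  proof -
    from l obtain z where "l - t n = fps_X ^ n *\<^sub>h z" by blast
    then have "ideal_rel I (l - s n) (fps_X ^ n *\<^sub>h z)"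
      using ts[of n] by (simp add: ideal_rel_def algebra_simps)
    then show ?thesis by blast
  qed
  then show ?thesis by blast
qed

section \<open>Free algebras\<close>

text \<open>Finitely supported complex functions on the free monoid form the free algebra
  under the convolution product of \<^type>\<open>poly_mapping\<close>.\<close>

datatype 'g free_monoid = Word "'g list"

instantiation free_monoid :: (type) monoid_add
begin
definition zero_free_monoid :: "'a free_monoid" where "zero_free_monoid = Word []"
fun plus_free_monoid :: "'a free_monoid \<Rightarrow> 'a free_monoid \<Rightarrow> 'a free_monoid"
  where "plus_free_monoid (Word u) (Word v) = Word (u @ v)"
instance
proof
  fix a b c :: "'a free_monoid"
  show "a + b + c = a + (b + c)" by (cases a; cases b; cases c) simp
  show "0 + a = a" by (cases a) (simp add: zero_free_monoid_def)
  show "a + 0 = a" by (cases a) (simp add: zero_free_monoid_def)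
qed
end

type_synonym 'g free_algebra = "'g free_monoid \<Rightarrow>\<^sub>0 complex"

definition gen :: "'g \<Rightarrow> 'g free_algebra"
  where "gen g = Poly_Mapping.single (Word [g]) 1"

definition commutator :: "'a::ring \<Rightarrow> 'a \<Rightarrow> 'a"
  where "commutator a b = a * b - b * a"

section \<open>The undeformed Weyl algebra\<close>

text \<open>Spacetime indices range over the four-element type \<open>4\<close>, with elements \<open>0, 1, 2, 3\<close>;
  the spatial indices are the nonzero ones.\<close>

definition eta :: "4 \<Rightarrow> 4 \<Rightarrow> complex"
  where "eta \<mu> \<nu> = (if \<mu> \<noteq> \<nu> then 0 else if \<mu> = 0 then - 1 else 1)"

datatype weyl_gen = Pos 4 | Mom 4

definition weyl_relations :: "weyl_gen free_algebra set"
  where "weyl_relations =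
    {commutator (gen (Mom \<mu>)) (gen (Pos \<nu>)) - (- \<i> * eta \<mu> \<nu>) *\<^sub>C 1 | \<mu> \<nu>. True} \<union>
    {commutator (gen (Pos \<mu>)) (gen (Pos \<nu>)) | \<mu> \<nu>. True} \<union>
    {commutator (gen (Mom \<mu>)) (gen (Mom \<nu>)) | \<mu> \<nu>. True}"

definition weyl_ideal :: "weyl_gen free_algebra set"
  where "weyl_ideal = two_sided_ideal weyl_relations"

text \<open>The representation on functions on multi-indices (coefficient families of power series in
  \<open>x\<close>) shows that the Weyl algebra is not zero.\<close>

fun weyl_gen_rep :: "weyl_gen \<Rightarrow> ((4 \<Rightarrow> nat) \<Rightarrow> complex) \<Rightarrow> (4 \<Rightarrow> nat) \<Rightarrow> complex"
  where
    "weyl_gen_rep (Pos \<nu>) f \<alpha> = (if \<alpha> \<nu> = 0 then 0 else f (\<alpha>(\<nu> := \<alpha> \<nu> - 1)))"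
  | "weyl_gen_rep (Mom \<nu>) f \<alpha> = - \<i> * eta \<nu> \<nu> * of_nat (\<alpha> \<nu> + 1) * f (\<alpha>(\<nu> := \<alpha> \<nu> + 1))"

fun weyl_word_rep :: "weyl_gen free_monoid \<Rightarrow> ((4 \<Rightarrow> nat) \<Rightarrow> complex) \<Rightarrow> (4 \<Rightarrow> nat) \<Rightarrow> complex"
  where "weyl_word_rep (Word w) f = foldr weyl_gen_rep w f"

definition weyl_free_rep ::
    "weyl_gen free_algebra \<Rightarrow> ((4 \<Rightarrow> nat) \<Rightarrow> complex) \<Rightarrow> (4 \<Rightarrow> nat) \<Rightarrow> complex"
  where "weyl_free_rep a f \<alpha> = (\<Sum>k\<in>Poly_Mapping.keys a. Poly_Mapping.lookup a k * weyl_word_rep k f \<alpha>)"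

lemma weyl_gen_rep_add:
  "weyl_gen_rep g (\<lambda>\<alpha>. u \<alpha> + v \<alpha>) = (\<lambda>\<alpha>. weyl_gen_rep g u \<alpha> + weyl_gen_rep g v \<alpha>)"
  by (cases g) (auto simp: fun_eq_iff algebra_simps)

lemma weyl_gen_rep_scale:
  "weyl_gen_rep g (\<lambda>\<alpha>. c * u \<alpha>) = (\<lambda>\<alpha>. c * weyl_gen_rep g u \<alpha>)"
  by (cases g) (auto simp: fun_eq_iff algebra_simps)

lemma weyl_word_rep_add:
  "weyl_word_rep k (\<lambda>\<alpha>. u \<alpha> + v \<alpha>) = (\<lambda>\<alpha>. weyl_word_rep k u \<alpha> + weyl_word_rep k v \<alpha>)"
proof (cases k)
  case (Word w)
  then show ?thesis by (induction w arbitrary: k) (auto simp: weyl_gen_rep_add)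
qed

lemma weyl_word_rep_scale:
  "weyl_word_rep k (\<lambda>\<alpha>. c * u \<alpha>) = (\<lambda>\<alpha>. c * weyl_word_rep k u \<alpha>)"
proof (cases k)
  case (Word w)
  then show ?thesis by (induction w arbitrary: k) (auto simp: weyl_gen_rep_scale)
qed

lemma weyl_word_rep_plus: "weyl_word_rep (k + l) f = weyl_word_rep k (weyl_word_rep l f)"
  by (cases k; cases l) simp

lemma weyl_free_rep_superset:
  "finite A \<Longrightarrow> Poly_Mapping.keys a \<subseteq> A \<Longrightarrow>
    weyl_free_rep a f \<alpha> = (\<Sum>k\<in>A. Poly_Mapping.lookup a k * weyl_word_rep k f \<alpha>)"
  unfolding weyl_free_rep_def by (rule sum.mono_neutral_left) (auto simp: in_keys_iff)

lemma weyl_free_rep_add: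
  "weyl_free_rep (a + b) f = (\<lambda>\<alpha>. weyl_free_rep a f \<alpha> + weyl_free_rep b f \<alpha>)"
proof
  fix \<alpha>
  let ?A = "Poly_Mapping.keys a \<union> Poly_Mapping.keys b"
  have "Poly_Mapping.keys (a + b) \<subseteq> ?A" by (rule Poly_Mapping.keys_add)
  then show "weyl_free_rep (a + b) f \<alpha> = weyl_free_rep a f \<alpha> + weyl_free_rep b f \<alpha>"
    by (subst (1 2 3) weyl_free_rep_superset[of ?A])
      (auto simp: lookup_add algebra_simps sum.distrib)
qed

lemma weyl_free_rep_single:
  "weyl_free_rep (Poly_Mapping.single k c) f = (\<lambda>\<alpha>. c * weyl_word_rep k f \<alpha>)"
  by (rule ext, subst weyl_free_rep_superset[of "{k}"]) auto

lemma weyl_free_rep_mult: "weyl_free_rep (a * b) f = weyl_free_rep a (weyl_free_rep b f)"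
proof (induction a rule: poly_mapping_induct_add)
  case (1 k c)
  show ?case
  proof (induction b rule: poly_mapping_induct_add)
    case (1 l d)
    show ?case
      by (simp add: mult_single weyl_free_rep_single weyl_word_rep_plus weyl_word_rep_scale mult.assoc)
  next
    case (2 u v)
    then show ?case
      by (simp add: distrib_left weyl_free_rep_add weyl_free_rep_single weyl_word_rep_add)
  qed
next
  case (2 u v)
  then show ?case by (simp add: distrib_right weyl_free_rep_add)
qed

lemma weyl_free_rep_minus: "weyl_free_rep (a - b) f \<alpha> = weyl_free_rep a f \<alpha> - weyl_free_rep b f \<alpha>"
  using fun_cong[OF weyl_free_rep_add[of "a - b" b f], of \<alpha>] by simp

lemma weyl_free_rep_gen: "weyl_free_rep (gen g) f = weyl_gen_rep g f"
  by (simp add: gen_def weyl_free_rep_single)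

lemma weyl_free_rep_const: "weyl_free_rep (c *\<^sub>C 1) f \<alpha> = c * f \<alpha>"
  by (simp add: cscale_poly_mapping_def weyl_free_rep_single zero_free_monoid_def cscale_complex_def)

lemma weyl_free_rep_relation:
  assumes "r \<in> weyl_relations"
  shows "weyl_free_rep r f = (\<lambda>\<alpha>. 0)"
proof
  fix \<alpha>
  note rep = commutator_def weyl_free_rep_minus weyl_free_rep_mult weyl_free_rep_gen weyl_free_rep_const
  from assms consider
      \<mu> \<nu> where "r = commutator (gen (Mom \<mu>)) (gen (Pos \<nu>)) - (- \<i> * eta \<mu> \<nu>) *\<^sub>C 1"
    | \<mu> \<nu> where "r = commutator (gen (Pos \<mu>)) (gen (Pos \<nu>))"
    | \<mu> \<nu> where "r = commutator (gen (Mom \<mu>)) (gen (Mom \<nu>))"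
    unfolding weyl_relations_def by blast
  then show "weyl_free_rep r f \<alpha> = 0"
  proof cases
    case 1
    show ?thesis unfolding 1 rep
      by (cases "\<mu> = \<nu>") (auto simp: eta_def fun_upd_twist algebra_simps)
  next
    case 2
    show ?thesis unfolding 2 rep
      by (cases "\<mu> = \<nu>") (auto simp: fun_upd_twist)
  next
    case 3
    show ?thesis unfolding 3 rep
      by (cases "\<mu> = \<nu>") (auto simp: fun_upd_twist)
  qed
qed

lemma weyl_free_rep_zero_right: "weyl_free_rep a (\<lambda>\<alpha>. 0) = (\<lambda>\<alpha>. 0)"
  using weyl_word_rep_scale[of _ 0] by (simp add: weyl_free_rep_def fun_eq_iff)

lemma one_notin_weyl_ideal: "1 \<notin> weyl_ideal"
proof
  have "weyl_free_rep a f = (\<lambda>\<alpha>. 0)" if "a \<in> weyl_ideal" for a f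
    using that unfolding weyl_ideal_def
  proof (induction rule: two_sided_ideal.induct)
    case zero
    show ?case by (simp add: weyl_free_rep_def)
  next
    case (step r x a b)
    then show ?case
      by (simp add: weyl_free_rep_add weyl_free_rep_mult weyl_free_rep_relation weyl_free_rep_zero_right)
  qed
  moreover assume "1 \<in> weyl_ideal"
  ultimately have "weyl_free_rep 1 (\<lambda>\<alpha>. 1) (\<lambda>_. 0) = 0" by simp
  moreover have "weyl_free_rep 1 (\<lambda>\<alpha>. 1) (\<lambda>_. 0) = 1"
    using weyl_free_rep_const[of 1] by (simp add: cscale_one)
  ultimately show False by simp
qed

lemma is_ideal_weyl_ideal: "is_ideal weyl_ideal"
  by (simp add: weyl_ideal_def is_ideal_two_sided_ideal)

quotient_type weyl = "weyl_gen free_algebra" / "ideal_rel weyl_ideal"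
  by (rule ideal_rel_equivp[OF is_ideal_weyl_ideal])


instantiation weyl :: complex_algebra
begin

lift_definition zero_weyl :: weyl is 0 .
lift_definition one_weyl :: weyl is 1 .
lift_definition plus_weyl :: "weyl \<Rightarrow> weyl \<Rightarrow> weyl" is "(+)"
  by (rule ideal_rel_add[OF is_ideal_weyl_ideal])
lift_definition minus_weyl :: "weyl \<Rightarrow> weyl \<Rightarrow> weyl" is "(-)"
  by (rule ideal_rel_diff[OF is_ideal_weyl_ideal])
lift_definition uminus_weyl :: "weyl \<Rightarrow> weyl" is uminus
  by (rule ideal_rel_minus[OF is_ideal_weyl_ideal])
lift_definition times_weyl :: "weyl \<Rightarrow> weyl \<Rightarrow> weyl" is "(*)"
  by (rule ideal_rel_mult[OF is_ideal_weyl_ideal])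
lift_definition cscale_weyl :: "complex \<Rightarrow> weyl \<Rightarrow> weyl" is cscale
  by (rule ideal_rel_cscale[OF is_ideal_weyl_ideal])

lemma ideal_rel_weyl_refl: "x = y \<Longrightarrow> ideal_rel weyl_ideal x y"
  by (simp add: equivp_reflp[OF ideal_rel_equivp[OF is_ideal_weyl_ideal]])

instance
proof
  have "\<not> ideal_rel weyl_ideal 0 1"
    using one_notin_weyl_ideal is_ideal_minus[OF is_ideal_weyl_ideal, of "- 1"]
    by (auto simp: ideal_rel_def)
  then show "(0::weyl) \<noteq> 1" by transfer
qed (transfer, rule ideal_rel_weyl_refl, simp add: algebra_simps cscale_add_left cscale_add_right
    cscale_cscale cscale_one cscale_mult_left cscale_mult_right)+

end

section \<open>kappa-Minkowski spacetime\<close>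

text \<open>
  The type \<open>uh\<close> is \<open>U\<^sub>h(an\<^sup>3)\<close>.  The universal h-adic algebra on generators and
  relations is the algebra of power series over the free algebra modulo the h-adically closed
  ideal generated by the relations.
\<close>

definition uh_relations :: "4 free_algebra fps set"
  where "uh_relations =
    {commutator (fps_const (gen 0)) (fps_const (gen i)) -
      (- (fps_const \<i> * fps_X)) *\<^sub>h fps_const (gen i) | i. i \<noteq> 0} \<union>
    {commutator (fps_const (gen j)) (fps_const (gen k)) | j k. j \<noteq> 0 \<and> k \<noteq> 0}"

definition uh_ideal :: "4 free_algebra fps set"
  where "uh_ideal = hadic_closure (two_sided_ideal uh_relations)"

lemma is_ideal_uh_ideal: "is_ideal uh_ideal"
  by (simp add: uh_ideal_def is_ideal_two_sided_ideal is_ideal_hadic_closure)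

quotient_type uh = "4 free_algebra fps" / "ideal_rel uh_ideal"
  by (rule ideal_rel_equivp[OF is_ideal_uh_ideal])

instantiation uh :: hadic_algebra
begin

lift_definition zero_uh :: uh is 0 .
lift_definition one_uh :: uh is 1 .
lift_definition plus_uh :: "uh \<Rightarrow> uh \<Rightarrow> uh" is "(+)"
  by (rule ideal_rel_add[OF is_ideal_uh_ideal])
lift_definition minus_uh :: "uh \<Rightarrow> uh \<Rightarrow> uh" is "(-)"
  by (rule ideal_rel_diff[OF is_ideal_uh_ideal])
lift_definition uminus_uh :: "uh \<Rightarrow> uh" is uminus
  by (rule ideal_rel_minus[OF is_ideal_uh_ideal])
lift_definition times_uh :: "uh \<Rightarrow> uh \<Rightarrow> uh" is "(*)"
  by (rule ideal_rel_mult[OF is_ideal_uh_ideal])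
lift_definition hscale_uh :: "complex fps \<Rightarrow> uh \<Rightarrow> uh" is hscale
  by (rule ideal_rel_hscale[OF is_ideal_uh_ideal])

lemma ideal_rel_uh_refl: "x = y \<Longrightarrow> ideal_rel uh_ideal x y"
  by (simp add: equivp_reflp[OF ideal_rel_equivp[OF is_ideal_uh_ideal]])

instance
proof
  fix x :: uh
  assume "\<forall>n. \<exists>y. x = fps_X ^ n *\<^sub>h y"
  then show "x = 0"
    by transfer (simp add: uh_ideal_def ideal_rel_closed)
next
  fix s :: "nat \<Rightarrow> uh"
  assume "\<forall>n. \<exists>y. s (Suc n) - s n = fps_X ^ n *\<^sub>h y"
  then show "\<exists>l. \<forall>n. \<exists>y. l - s n = fps_X ^ n *\<^sub>h y"
    by transfer (rule ideal_rel_complete[OF is_ideal_uh_ideal], blast)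
qed (transfer, rule ideal_rel_uh_refl, simp add: algebra_simps hscale_add_left hscale_add_right
    hscale_hscale hscale_one hscale_mult_left hscale_mult_right)+

end

lift_definition X_low :: "4 \<Rightarrow> uh" is "\<lambda>\<mu>. fps_const (gen \<mu>)" .

section \<open>Linear maps on power series\<close>

lemma hlinear_add: "hlinear F \<Longrightarrow> F (x + y) = F x + F y"
  and hlinear_hscale: "hlinear F \<Longrightarrow> F (c *\<^sub>h x) = c *\<^sub>h F x"
  by (simp_all add: hlinear_def)

lemma hlinear_zero: "hlinear F \<Longrightarrow> F 0 = 0"
  using hlinear_add[of F 0 0] by simp

lemma hlinear_minus: "hlinear F \<Longrightarrow> F (- x) = - F x"
  using hlinear_add[of F x "- x"] hlinear_zero[of F] by (simp add: eq_neg_iff_add_eq_0 add.commute)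

lemma hlinear_diff: "hlinear F \<Longrightarrow> F (x - y) = F x - F y"
  using hlinear_add[of F x "- y"] hlinear_minus[of F y] by simp

lemma hlinear_sum: "hlinear F \<Longrightarrow> F (\<Sum>k\<in>A. u k) = (\<Sum>k\<in>A. F (u k))"
  by (induction A rule: infinite_finite_induct) (auto simp: hlinear_zero hlinear_add)

lemma hscale_zero_left: "0 *\<^sub>h (x::'a::hadic_algebra) = 0"
  using hscale_add_left[of 0 0 x] by simp

lemma hscale_sum_right: "c *\<^sub>h (\<Sum>k\<in>A. u k) = (\<Sum>k\<in>A. c *\<^sub>h (u k :: 'a::hadic_algebra))"
  by (induction A rule: infinite_finite_induct) (auto simp: hscale_zero_right hscale_add_right)

lemma hscale_sum_left: "(\<Sum>k\<in>A. c k) *\<^sub>h x = (\<Sum>k\<in>A. c k *\<^sub>h (x :: 'a::hadic_algebra))"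
  by (induction A rule: infinite_finite_induct) (auto simp: hscale_zero_left hscale_add_left)

lemma hadic_eqI:
  fixes x y :: "'a::hadic_algebra"
  assumes "\<And>n. \<exists>z. x - y = fps_X ^ n *\<^sub>h z"
  shows "x = y"
  using hadic_separated[of "x - y"] assms by simp

lemma fps_truncate: "f = (\<Sum>m<n. fps_X ^ m *\<^sub>h fps_const (f $ m)) + fps_X ^ n *\<^sub>h fps_shift n (f :: 'a::complex_algebra fps)"
  by (rule fps_ext)
    (simp add: fps_sum_nth hscale_fps_X_power fps_X_power_mult_nth if_distrib if_distribR cong: if_cong)

lemma fps_const_cscale: "fps_const (c *\<^sub>C x) = fps_const c *\<^sub>h fps_const (x :: 'a::complex_algebra)"
  by (rule fps_ext)
   (auto simp add: hscale_fps_def fps_mult_nth cscale_mult_left cscale_zero_left fps_const_def if_distrib if_distribR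
     sum.delta cong: if_cong)

lemma hlinear_unique:
  fixes F G :: "('k::monoid_add \<Rightarrow>\<^sub>0 complex) fps \<Rightarrow> 'c::hadic_algebra"
  assumes F: "hlinear F" and G: "hlinear G"
    and eq: "\<And>k. F (fps_const (Poly_Mapping.single k 1)) = G (fps_const (Poly_Mapping.single k 1))"
  shows "F = G"
proof
  fix f
  have const: "F (fps_const v) = G (fps_const v)" for v
  proof (induction v rule: poly_mapping_induct_add)
    case (1 k c)
    have "Poly_Mapping.single k c = c *\<^sub>C Poly_Mapping.single k 1"
      by (simp add: cscale_poly_mapping_def mult_single cscale_complex_def)
    then show ?case
      by (simp add: fps_const_cscale hlinear_hscale[OF F] hlinear_hscale[OF G] eq)
  next
    case (2 u v)
    then show ?case
      by (simp add: hlinear_add[OF F] hlinear_add[OF G] flip: fps_const_add)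
  qed
  show "F f = G f"
  proof (rule hadic_eqI)
    fix n
    have "H f = (\<Sum>m<n. fps_X ^ m *\<^sub>h H (fps_const (f $ m))) + fps_X ^ n *\<^sub>h H (fps_shift n f)"
      if "hlinear H" for H :: "('k \<Rightarrow>\<^sub>0 complex) fps \<Rightarrow> 'c"
      by (subst fps_truncate[of f n]) (simp add: that hlinear_add hlinear_hscale hlinear_sum)
    from this[OF F] this[OF G]
    have "F f - G f = fps_X ^ n *\<^sub>h (F (fps_shift n f) - G (fps_shift n f))"
      by (simp add: const hscale_diff_right)
    then show "\<exists>z. F f - G f = fps_X ^ n *\<^sub>h z" by blast
  qed
qed

lemma hsum_exists:
  fixes u :: "nat \<Rightarrow> 'c::hadic_algebra"
  shows "\<exists>l. \<forall>n. \<exists>z. l - (\<Sum>m<n. fps_X ^ m *\<^sub>h u m) = fps_X ^ n *\<^sub>h z"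
  by (rule hadic_complete) auto

definition hsum :: "(nat \<Rightarrow> 'c::hadic_algebra) \<Rightarrow> 'c"
  where "hsum u = (SOME l. \<forall>n. \<exists>z. l - (\<Sum>m<n. fps_X ^ m *\<^sub>h u m) = fps_X ^ n *\<^sub>h z)"

lemma hsum: "\<exists>z. hsum u - (\<Sum>m<n. fps_X ^ m *\<^sub>h u m) = fps_X ^ n *\<^sub>h z"
  unfolding hsum_def using someI_ex[OF hsum_exists[of u]] by blast

lemma hsum_eqI:
  assumes "\<And>n. \<exists>z. l - (\<Sum>m<n. fps_X ^ m *\<^sub>h u m) = fps_X ^ n *\<^sub>h z"
  shows "hsum u = l"
proof (rule hadic_eqI)
  fix n
  from hsum[of u n] obtain y where y: "hsum u - (\<Sum>m<n. fps_X ^ m *\<^sub>h u m) = fps_X ^ n *\<^sub>h y" by blast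
  from assms[of n] obtain z where z: "l - (\<Sum>m<n. fps_X ^ m *\<^sub>h u m) = fps_X ^ n *\<^sub>h z" by blast
  have "hsum u - l = fps_X ^ n *\<^sub>h (y - z)"
    unfolding hscale_diff_right y[symmetric] z[symmetric] by simp
  then show "\<exists>z. hsum u - l = fps_X ^ n *\<^sub>h z" by blast
qed

lemma hsum_add: "hsum (\<lambda>m. u m + v m) = hsum u + hsum v"
proof (rule hsum_eqI)
  fix n
  from hsum[of u n] obtain y where y: "hsum u - (\<Sum>m<n. fps_X ^ m *\<^sub>h u m) = fps_X ^ n *\<^sub>h y" by blast
  from hsum[of v n] obtain z where z: "hsum v - (\<Sum>m<n. fps_X ^ m *\<^sub>h v m) = fps_X ^ n *\<^sub>h z" by blast
  have "hsum u + hsum v - (\<Sum>m<n. fps_X ^ m *\<^sub>h (u m + v m)) = fps_X ^ n *\<^sub>h (y + z)"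
    unfolding hscale_add_right y[symmetric] z[symmetric] by (simp add: sum.distrib)
  then show "\<exists>z. hsum u + hsum v - (\<Sum>m<n. fps_X ^ m *\<^sub>h (u m + v m)) = fps_X ^ n *\<^sub>h z" by blast
qed

lemma hsum_hscale: "hsum (\<lambda>m. c *\<^sub>h u m) = c *\<^sub>h hsum u"
proof (rule hsum_eqI)
  fix n
  from hsum[of u n] obtain y where y: "hsum u - (\<Sum>m<n. fps_X ^ m *\<^sub>h u m) = fps_X ^ n *\<^sub>h y" by blast
  have "c *\<^sub>h hsum u - (\<Sum>m<n. fps_X ^ m *\<^sub>h c *\<^sub>h u m) = c *\<^sub>h (hsum u - (\<Sum>m<n. fps_X ^ m *\<^sub>h u m))"
    by (simp add: hscale_diff_right hscale_sum_right hscale_hscale mult.commute)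
  also have "\<dots> = fps_X ^ n *\<^sub>h (c *\<^sub>h y)"
    by (simp add: y hscale_hscale mult.commute)
  finally show "\<exists>z. c *\<^sub>h hsum u - (\<Sum>m<n. fps_X ^ m *\<^sub>h c *\<^sub>h u m) = fps_X ^ n *\<^sub>h z" by blast
qed

lemma hsum_const: "hsum (\<lambda>m. if m = 0 then x else 0) = x"
proof (rule hsum_eqI)
  fix n :: nat
  show "\<exists>z. x - (\<Sum>m<n. fps_X ^ m *\<^sub>h (if m = 0 then x else 0)) = fps_X ^ n *\<^sub>h z"
  proof (cases n)
    case 0
    then show ?thesis by (auto simp: hscale_one)
  next
    case (Suc k)
    then show ?thesis
      by (intro exI[of _ 0]) (simp add: hscale_zero_right hscale_one sum.lessThan_Suc_shift del: sum.lessThan_Suc)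
  qed
qed

lemma hsum_shift: "hsum (\<lambda>m. if m = 0 then 0 else u (m - 1)) = fps_X *\<^sub>h hsum u"
proof (rule hsum_eqI)
  fix n :: nat
  show "\<exists>z. fps_X *\<^sub>h hsum u - (\<Sum>m<n. fps_X ^ m *\<^sub>h (if m = 0 then 0 else u (m - 1))) = fps_X ^ n *\<^sub>h z"
  proof (cases n)
    case 0
    then show ?thesis by (auto simp: hscale_one)
  next
    case (Suc k)
    from hsum[of u k] obtain y where y: "hsum u - (\<Sum>m<k. fps_X ^ m *\<^sub>h u m) = fps_X ^ k *\<^sub>h y" by blast
    have "fps_X *\<^sub>h hsum u - (\<Sum>m<n. fps_X ^ m *\<^sub>h (if m = 0 then 0 else u (m - 1))) =
      fps_X *\<^sub>h (hsum u - (\<Sum>m<k. fps_X ^ m *\<^sub>h u m))"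
      unfolding Suc sum.lessThan_Suc_shift
      by (simp add: hscale_diff_right hscale_sum_right hscale_hscale hscale_zero_right)
    also have "\<dots> = fps_X ^ n *\<^sub>h y" by (simp add: y hscale_hscale Suc)
    finally show ?thesis by blast
  qed
qed

lemma hlinear_extension:
  fixes b :: "'k::monoid_add \<Rightarrow> 'c::hadic_algebra"
  shows "\<exists>F :: ('k \<Rightarrow>\<^sub>0 complex) fps \<Rightarrow> 'c. hlinear F \<and> (\<forall>k. F (fps_const (Poly_Mapping.single k 1)) = b k)"
proof -
  define E where "E v = (\<Sum>k\<in>Poly_Mapping.keys v. fps_const (Poly_Mapping.lookup v k) *\<^sub>h b k)" for v :: "'k \<Rightarrow>\<^sub>0 complex"
  have E_super: "E v = (\<Sum>k\<in>A. fps_const (Poly_Mapping.lookup v k) *\<^sub>h b k)"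
    if "finite A" "Poly_Mapping.keys v \<subseteq> A" for v A
    unfolding E_def using that
    by (intro sum.mono_neutral_left) (auto simp: in_keys_iff hscale_zero_left)
  have E_add: "E (u + v) = E u + E v" for u v
    using Poly_Mapping.keys_add[of u v]
    by (subst (1 2 3) E_super[of "Poly_Mapping.keys u \<union> Poly_Mapping.keys v"])
      (auto simp: lookup_add hscale_add_left sum.distrib simp flip: fps_const_add)
  have E_single: "E (Poly_Mapping.single k c) = fps_const c *\<^sub>h b k" for k c
    by (subst E_super[of "{k}"]) auto
  have E_scale: "E (c *\<^sub>C v) = fps_const c *\<^sub>h E v" for c v
  proof (induction v rule: poly_mapping_induct_add)
    case (1 k d)
    have "c *\<^sub>C Poly_Mapping.single k d = Poly_Mapping.single k (c * d)"
      by (simp add: cscale_poly_mapping_def mult_single cscale_complex_def)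
    then show ?case by (simp add: E_single hscale_hscale)
  next
    case (2 u v)
    then show ?case by (simp add: cscale_add_right E_add hscale_add_right)
  qed
  have E_zero: "E 0 = 0" by (simp add: E_def)
  define F where "F f = hsum (\<lambda>m. E (f $ m))" for f
  have F_add: "F (f + g) = F f + F g" for f g
    by (simp add: F_def E_add hsum_add)
  have F_zero: "F 0 = 0" using F_add[of 0 0] by simp
  have F_sum: "F (\<Sum>k\<in>A. u k) = (\<Sum>k\<in>A. F (u k))" for u :: "nat \<Rightarrow> _" and A
    by (induction A rule: infinite_finite_induct) (auto simp: F_zero F_add)
  have const_nth: "(fps_const c *\<^sub>h f) $ m = c *\<^sub>C (f $ m)" for c and f :: "('k \<Rightarrow>\<^sub>0 complex) fps" and m
  proof -
    have "Abs_fps (\<lambda>n. (fps_const c $ n) *\<^sub>C (1 :: 'k \<Rightarrow>\<^sub>0 complex)) = fps_const (c *\<^sub>C 1)"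
      by (rule fps_ext) (simp add: cscale_zero_left)
    then show ?thesis by (simp add: hscale_fps_def cscale_mult_left)
  qed
  have F_const: "F (fps_const c *\<^sub>h f) = fps_const c *\<^sub>h F f" for c f
    by (simp add: F_def const_nth E_scale hsum_hscale)
  have X_nth: "(fps_X *\<^sub>h f) $ m = (if m = 0 then 0 else f $ (m - 1))" for f :: "('k \<Rightarrow>\<^sub>0 complex) fps" and m
    using hscale_fps_X_power[of 1 f] by simp
  have F_X: "F (fps_X *\<^sub>h f) = fps_X *\<^sub>h F f" for f
  proof -
    have "(\<lambda>m. E ((fps_X *\<^sub>h f) $ m)) = (\<lambda>m. if m = 0 then 0 else E (f $ (m - 1)))"
      by (auto simp: X_nth E_zero)
    then show ?thesis using hsum_shift[of "\<lambda>m. E (f $ m)"] by (simp add: F_def)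
  qed
  have F_X_power: "F (fps_X ^ n *\<^sub>h f) = fps_X ^ n *\<^sub>h F f" for n f
    by (induction n) (simp_all add: hscale_one F_X flip: hscale_hscale)
  have F_scale: "F (c *\<^sub>h f) = c *\<^sub>h F f" for c f
  proof (rule hadic_eqI)
    fix n
    have c: "c = (\<Sum>m<n. fps_X ^ m * fps_const (c $ m)) + fps_X ^ n * fps_shift n c"
      by (rule fps_ext)
        (simp add: fps_sum_nth fps_X_power_mult_nth if_distrib if_distribR cong: if_cong)
    have "F (c *\<^sub>h f) = (\<Sum>m<n. fps_X ^ m *\<^sub>h fps_const (c $ m) *\<^sub>h F f) + fps_X ^ n *\<^sub>h F (fps_shift n c *\<^sub>h f)"
      by (subst c) (simp add: hscale_add_left hscale_sum_left F_add F_sum F_X_power F_const flip: hscale_hscale)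
    moreover have "c *\<^sub>h F f = (\<Sum>m<n. fps_X ^ m *\<^sub>h fps_const (c $ m) *\<^sub>h F f) + fps_X ^ n *\<^sub>h (fps_shift n c *\<^sub>h F f)"
      by (subst c) (simp add: hscale_add_left hscale_sum_left flip: hscale_hscale)
    ultimately have "F (c *\<^sub>h f) - c *\<^sub>h F f = fps_X ^ n *\<^sub>h (F (fps_shift n c *\<^sub>h f) - fps_shift n c *\<^sub>h F f)"
      by (simp add: hscale_diff_right)
    then show "\<exists>z. F (c *\<^sub>h f) - c *\<^sub>h F f = fps_X ^ n *\<^sub>h z" by blast
  qed
  have "F (fps_const (Poly_Mapping.single k 1)) = b k" for k
  proof -
    have "(\<lambda>m. E (fps_const (Poly_Mapping.single k 1) $ m)) = (\<lambda>m. if m = 0 then b k else 0)"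
      by (auto simp: E_single E_zero hscale_one)
    then show ?thesis by (simp add: F_def hsum_const)
  qed
  with F_add F_scale show ?thesis unfolding hlinear_def by (intro exI[of _ F]) simp
qed

lemma hlinear_mult: "hlinear F \<Longrightarrow> hlinear (\<lambda>u. F (u * r * v))"
  by (simp add: hlinear_def distrib_right hscale_mult_left)

lemma hlinear_mult': "hlinear F \<Longrightarrow> hlinear (\<lambda>v. F (u * r * v))"
  by (simp add: hlinear_def distrib_left hscale_mult_right)

lemma hlinear_zero_map: "hlinear (\<lambda>_. 0)"
  by (simp add: hlinear_def hscale_zero_right)

lemma hlinear_comp_left: "hlinear F \<Longrightarrow> hlinear (\<lambda>x. F (x * y))"
  by (simp add: hlinear_def distrib_right hscale_mult_left)
lemma hlinear_comp_right: "hlinear F \<Longrightarrow> hlinear (\<lambda>x. F (y * x))"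
  by (simp add: hlinear_def distrib_left hscale_mult_right)
lemma hlinear_left: "hlinear F \<Longrightarrow> hlinear (\<lambda>x. F x * y)"
  by (simp add: hlinear_def distrib_right hscale_mult_left)
lemma hlinear_right: "hlinear F \<Longrightarrow> hlinear (\<lambda>x. y * F x)"
  by (simp add: hlinear_def distrib_left hscale_mult_right)

section \<open>Completed tensor products\<close>

text \<open>
  Power series in \<open>h\<close> whose coefficients are finite complex combinations of symbols \<open>Tens a b\<close>
  form the h-adic completion of the free module on these symbols; the completed tensor product is
  its quotient by the h-adic closure of the bilinearity relations.  Symbols multiply
  componentwise, so the submodule spanned by the bilinearity relations is already an ideal, and
  the quotient carries the product of the tensor product algebra.
\<close>

datatype ('a, 'b) tensor_symbol = Tens 'a 'b

instantiation tensor_symbol :: (monoid_mult, monoid_mult) monoid_add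
begin
definition zero_tensor_symbol :: "('a, 'b) tensor_symbol" where "zero_tensor_symbol = Tens 1 1"
fun plus_tensor_symbol ::
    "('a, 'b) tensor_symbol \<Rightarrow> ('a, 'b) tensor_symbol \<Rightarrow> ('a, 'b) tensor_symbol"
  where "plus_tensor_symbol (Tens a b) (Tens a' b') = Tens (a * a') (b * b')"
instance
proof
  fix a b c :: "('a, 'b) tensor_symbol"
  show "a + b + c = a + (b + c)" by (cases a; cases b; cases c) (simp add: mult.assoc)
  show "0 + a = a" by (cases a) (simp add: zero_tensor_symbol_def)
  show "a + 0 = a" by (cases a) (simp add: zero_tensor_symbol_def)
qed
end

type_synonym ('a, 'b) pre_tensor = "(('a, 'b) tensor_symbol \<Rightarrow>\<^sub>0 complex) fps"

definition pre_tens :: "'a \<Rightarrow> 'b \<Rightarrow> ('a, 'b) pre_tensor"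
  where "pre_tens a b = fps_const (Poly_Mapping.single (Tens a b) 1)"

definition tensor_relations :: "('a::hadic_algebra, 'b::hadic_algebra) pre_tensor set"
  where "tensor_relations =
    {pre_tens (a + a') b - (pre_tens a b + pre_tens a' b) | a a' b. True} \<union>
    {pre_tens a (b + b') - (pre_tens a b + pre_tens a b') | a b b'. True} \<union>
    {pre_tens (c *\<^sub>h a) b - c *\<^sub>h pre_tens a b | c a b. True} \<union>
    {pre_tens a (c *\<^sub>h b) - c *\<^sub>h pre_tens a b | c a b. True}"

definition tensor_ideal :: "('a::hadic_algebra, 'b::hadic_algebra) pre_tensor set"
  where "tensor_ideal = hadic_closure (two_sided_ideal tensor_relations)"

lemma is_ideal_tensor_ideal: "is_ideal tensor_ideal"
  by (simp add: tensor_ideal_def is_ideal_two_sided_ideal is_ideal_hadic_closure)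

quotient_type (overloaded) ('a, 'b) ctensor =
    "('a::hadic_algebra, 'b::hadic_algebra) pre_tensor" / "ideal_rel tensor_ideal"
  by (rule ideal_rel_equivp[OF is_ideal_tensor_ideal])

instantiation ctensor :: (hadic_algebra, hadic_algebra) hadic_algebra
begin

lift_definition zero_ctensor :: "('a, 'b) ctensor" is 0 .
lift_definition one_ctensor :: "('a, 'b) ctensor" is 1 .
lift_definition plus_ctensor :: "('a, 'b) ctensor \<Rightarrow> ('a, 'b) ctensor \<Rightarrow> ('a, 'b) ctensor" is "(+)"
  by (rule ideal_rel_add[OF is_ideal_tensor_ideal])
lift_definition minus_ctensor :: "('a, 'b) ctensor \<Rightarrow> ('a, 'b) ctensor \<Rightarrow> ('a, 'b) ctensor" is "(-)"
  by (rule ideal_rel_diff[OF is_ideal_tensor_ideal])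
lift_definition uminus_ctensor :: "('a, 'b) ctensor \<Rightarrow> ('a, 'b) ctensor" is uminus
  by (rule ideal_rel_minus[OF is_ideal_tensor_ideal])
lift_definition times_ctensor :: "('a, 'b) ctensor \<Rightarrow> ('a, 'b) ctensor \<Rightarrow> ('a, 'b) ctensor" is "(*)"
  by (rule ideal_rel_mult[OF is_ideal_tensor_ideal])
lift_definition hscale_ctensor :: "complex fps \<Rightarrow> ('a, 'b) ctensor \<Rightarrow> ('a, 'b) ctensor" is hscale
  by (rule ideal_rel_hscale[OF is_ideal_tensor_ideal])

lemma ideal_rel_tensor_refl: "x = y \<Longrightarrow> ideal_rel tensor_ideal x y"
  by (simp add: equivp_reflp[OF ideal_rel_equivp[OF is_ideal_tensor_ideal]])

instance
proof
  fix x :: "('a, 'b) ctensor"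
  assume "\<forall>n. \<exists>y. x = fps_X ^ n *\<^sub>h y"
  then show "x = 0"
    by transfer (simp add: tensor_ideal_def ideal_rel_closed)
next
  fix s :: "nat \<Rightarrow> ('a, 'b) ctensor"
  assume "\<forall>n. \<exists>y. s (Suc n) - s n = fps_X ^ n *\<^sub>h y"
  then show "\<exists>l. \<forall>n. \<exists>y. l - s n = fps_X ^ n *\<^sub>h y"
    by transfer (rule ideal_rel_complete[OF is_ideal_tensor_ideal], blast)
qed (transfer, rule ideal_rel_tensor_refl, simp add: algebra_simps hscale_add_left hscale_add_right
    hscale_hscale hscale_one hscale_mult_left hscale_mult_right)+

end

lift_definition tens ::
    "'a::hadic_algebra \<Rightarrow> 'b::hadic_algebra \<Rightarrow> ('a, 'b) ctensor"  (infixr \<open>\<otimes>\<^sub>h\<close> 72)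
  is pre_tens .

text \<open>The linear map on the completed tensor product induced by a bilinear map, see
  \<open>ctensor_lift\<close> below.  It expresses Sweedler notation: a term bilinear in
  \<open>L\<^sub>1\<close> and \<open>L\<^sub>2\<close> is evaluated on the coproduct of \<open>L\<close>.\<close>

definition ctensor_lift ::
    "('a::hadic_algebra \<Rightarrow> 'b::hadic_algebra \<Rightarrow> 'c::hadic_algebra) \<Rightarrow> ('a, 'b) ctensor \<Rightarrow> 'c"
  where "ctensor_lift B = (THE F. hlinear F \<and> (\<forall>a b. F (a \<otimes>\<^sub>h b) = B a b))"

lemma pre_tens_mult: "pre_tens a b * pre_tens a' b' = pre_tens (a * a') (b * b')"
  by (simp add: pre_tens_def mult_single)

lemma ctensor_lift_exists:
  fixes B :: "'a::hadic_algebra \<Rightarrow> 'b::hadic_algebra \<Rightarrow> 'c::hadic_algebra"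
  assumes B: "hbilinear B"
  shows "\<exists>F. hlinear F \<and> (\<forall>a b. F (a \<otimes>\<^sub>h b) = B a b)"
proof -
  from hlinear_extension[of "case_tensor_symbol B"]
  obtain F :: "('a, 'b) pre_tensor \<Rightarrow> 'c" where F: "hlinear F"
    and F_tens: "\<And>a b. F (pre_tens a b) = B a b"
    unfolding pre_tens_def by (metis tensor_symbol.case)
  note Fsimps = hlinear_add[OF F] hlinear_diff[OF F] hlinear_hscale[OF F]
  have B1: "B (x + y) b = B x b + B y b" "B (c *\<^sub>h x) b = c *\<^sub>h B x b" for x y b c
    using B by (auto simp: hbilinear_def hlinear_def)
  have B2: "B a (x + y) = B a x + B a y" "B a (c *\<^sub>h x) = c *\<^sub>h B a x" for x y a c
    using B by (auto simp: hbilinear_def hlinear_def)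
  have basis: "F (pre_tens p q * r * pre_tens p' q') = 0" if "r \<in> tensor_relations" for p q r p' q'
  proof -
    from that consider
        a a' b where "r = pre_tens (a + a') b - (pre_tens a b + pre_tens a' b)"
      | a b b' where "r = pre_tens a (b + b') - (pre_tens a b + pre_tens a b')"
      | c a b where "r = pre_tens (c *\<^sub>h a) b - c *\<^sub>h pre_tens a b"
      | c a b where "r = pre_tens a (c *\<^sub>h b) - c *\<^sub>h pre_tens a b"
      unfolding tensor_relations_def by blast
    then show ?thesis
      by cases
        (simp_all add: distrib_left distrib_right left_diff_distrib right_diff_distrib pre_tens_mult
          hscale_mult_left hscale_mult_right Fsimps F_tens B1 B2)
  qed
  have rel: "F (u * r * v) = 0" if r: "r \<in> tensor_relations" for u r v
  proof -
    have 1: "(\<lambda>u. F (u * r * pre_tens p' q')) = (\<lambda>_. 0)" for p' q'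
    proof (rule hlinear_unique[OF hlinear_mult[OF F] hlinear_zero_map])
      fix k show "F (fps_const (Poly_Mapping.single k 1) * r * pre_tens p' q') = 0"
        by (cases k) (use basis[OF r] in \<open>simp add: pre_tens_def\<close>)
    qed
    have "(\<lambda>v. F (u * r * v)) = (\<lambda>_. 0)"
    proof (rule hlinear_unique[OF hlinear_mult'[OF F] hlinear_zero_map])
      fix k show "F (u * r * fps_const (Poly_Mapping.single k 1)) = 0"
        by (cases k) (use fun_cong[OF 1] in \<open>simp add: pre_tens_def\<close>)
    qed
    then show ?thesis by (rule fun_cong)
  qed
  have ideal: "F x = 0" if "x \<in> two_sided_ideal tensor_relations" for x
    using that by (induction rule: two_sided_ideal.induct) (auto simp: hlinear_zero[OF F] Fsimps rel)
  have closure: "F x = 0" if "x \<in> tensor_ideal" for x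
  proof (rule hadic_eqI)
    fix n
    from that obtain y z where "y \<in> two_sided_ideal tensor_relations" "x - y = fps_X ^ n *\<^sub>h z"
      unfolding tensor_ideal_def hadic_closure_def by blast
    then have "F x - 0 = fps_X ^ n *\<^sub>h F z"
      using ideal[of y] hlinear_diff[OF F, of x y] by (simp add: Fsimps)
    then show "\<exists>z. F x - 0 = fps_X ^ n *\<^sub>h z" by blast
  qed
  have resp: "F x = F y" if "ideal_rel tensor_ideal x y" for x y
    using closure[of "x - y"] that by (simp add: ideal_rel_def Fsimps)
  define G where "G z = F (rep_ctensor z)" for z
  have G_abs: "G (abs_ctensor x) = F x" for x
    unfolding G_def by (rule resp) (simp add: Quotient3_ctensor Quotient3_rep_abs Quotient3_rel_rep ideal_rel_tensor_refl rep_abs_rsp)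
  have abs: "\<exists>x. z = abs_ctensor x" for z :: "('a, 'b) ctensor"
    by (metis Quotient3_abs_rep Quotient3_ctensor)
  have "hlinear G" unfolding hlinear_def
  proof (intro conjI allI)
    fix x y :: "('a, 'b) ctensor" and c
    obtain u v where "x = abs_ctensor u" "y = abs_ctensor v" using abs[of x] abs[of y] by blast
    then show "G (x + y) = G x + G y" "G (c *\<^sub>h x) = c *\<^sub>h G x"
      by (simp_all add: plus_ctensor.abs_eq hscale_ctensor.abs_eq G_abs Fsimps)
  qed
  moreover have "G (a \<otimes>\<^sub>h b) = B a b" for a b
    by (simp add: tens.abs_eq G_abs F_tens)
  ultimately show ?thesis by blast
qed

lemma ctensor_hlinear_unique:
  fixes F G :: "('a::hadic_algebra, 'b::hadic_algebra) ctensor \<Rightarrow> 'c::hadic_algebra"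
  assumes F: "hlinear F" and G: "hlinear G" and eq: "\<And>a b. F (a \<otimes>\<^sub>h b) = G (a \<otimes>\<^sub>h b)"
  shows "F = G"
proof -
  have lin: "hlinear (\<lambda>x. H (abs_ctensor x))" if "hlinear H" for H :: "('a, 'b) ctensor \<Rightarrow> 'c"
    using that by (simp add: hlinear_def flip: plus_ctensor.abs_eq hscale_ctensor.abs_eq)
  have "(\<lambda>x. F (abs_ctensor x)) = (\<lambda>x. G (abs_ctensor x))"
  proof (rule hlinear_unique[OF lin[OF F] lin[OF G]])
    fix k :: "('a, 'b) tensor_symbol"
    show "F (abs_ctensor (fps_const (Poly_Mapping.single k 1))) = G (abs_ctensor (fps_const (Poly_Mapping.single k 1)))"
      by (cases k) (use eq in \<open>simp add: tens.abs_eq pre_tens_def\<close>)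
  qed
  then show ?thesis
    by (metis ext Quotient3_abs_rep Quotient3_ctensor)
qed

lemma ctensor_lift:
  assumes "hbilinear B"
  shows hlinear_ctensor_lift: "hlinear (ctensor_lift B)"
    and ctensor_lift_tens: "ctensor_lift B (a \<otimes>\<^sub>h b) = B a b"
proof -
  have "\<exists>!F. hlinear F \<and> (\<forall>a b. F (a \<otimes>\<^sub>h b) = B a b)"
    using ctensor_lift_exists[OF assms] ctensor_hlinear_unique by (metis (no_types, lifting))
  from theI'[OF this] show "hlinear (ctensor_lift B)" "ctensor_lift B (a \<otimes>\<^sub>h b) = B a b"
    unfolding ctensor_lift_def by blast+
qed


lemma tens_mult: "(a \<otimes>\<^sub>h b) * (a' \<otimes>\<^sub>h b') = (a * a') \<otimes>\<^sub>h (b * b')"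
  by (simp add: tens.abs_eq times_ctensor.abs_eq pre_tens_mult)

lemma hbilinear_tens: "hbilinear (\<otimes>\<^sub>h)"
proof -
  have in_ideal: "r \<in> tensor_relations \<Longrightarrow> r \<in> tensor_ideal" for r :: "('a, 'b) pre_tensor"
    unfolding tensor_ideal_def hadic_closure_def
    by (auto intro!: bexI[of _ r] exI[of _ 0] simp: hscale_zero_right two_sided_ideal_base)
  have eq: "x - y \<in> tensor_relations \<Longrightarrow> abs_ctensor x = abs_ctensor y" for x y :: "('a, 'b) pre_tensor"
    using in_ideal by (simp add: ctensor.abs_eq_iff ideal_rel_def)
  show ?thesis unfolding hbilinear_def hlinear_def tens.abs_eq plus_ctensor.abs_eq hscale_ctensor.abs_eq
    by (intro conjI allI eq; unfold tensor_relations_def; blast)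
qed

lemma ctensor_lift_param:
  assumes "\<And>x. hbilinear (B x)" "\<And>a b. hlinear (\<lambda>x. B x a b)"
  shows "hlinear (\<lambda>x. ctensor_lift (B x) z)"
proof -
  note lin = hlinear_ctensor_lift[OF assms(1)]
  note l = lin[unfolded hlinear_def, THEN conjunct1, rule_format] lin[unfolded hlinear_def, THEN conjunct2, rule_format]
  have "ctensor_lift (B (x + y)) = (\<lambda>z. ctensor_lift (B x) z + ctensor_lift (B y) z)" for x y
    by (rule ctensor_hlinear_unique[OF lin])
      (use assms(2) in \<open>auto simp: hlinear_def l hscale_add_right ctensor_lift_tens[OF assms(1)]\<close>)
  moreover have "ctensor_lift (B (c *\<^sub>h x)) = (\<lambda>z. c *\<^sub>h ctensor_lift (B x) z)" for x c
    by (rule ctensor_hlinear_unique[OF lin])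
      (use assms(2) in \<open>auto simp: hlinear_def l hscale_add_right hscale_hscale mult.commute ctensor_lift_tens[OF assms(1)]\<close>)
  ultimately show ?thesis by (simp add: hlinear_def)
qed

section \<open>Deformed momenta\<close>

text \<open>A monomial in the commuting momenta is its exponent vector, a finitely supported function
  from indices to \<open>nat\<close>.\<close>

type_synonym momentum_poly = "(4 \<Rightarrow>\<^sub>0 nat) \<Rightarrow>\<^sub>0 complex"
type_synonym momenta = "momentum_poly fps"

definition P_var :: "4 \<Rightarrow> momentum_poly"
  where "P_var \<mu> = Poly_Mapping.single (Poly_Mapping.single \<mu> 1) 1"

definition P_low :: "4 \<Rightarrow> momenta"
  where "P_low \<mu> = fps_const (P_var \<mu>)"

definition P_squared :: momentum_poly
  where "P_squared = (\<Sum>i\<in>{1, 2, 3}. P_var i ^ 2) - P_var 0 ^ 2"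

text \<open>The square root of \<open>1 - h\<^sup>2 P\<^sup>2\<close>, by its binomial series.\<close>

definition P_root :: momenta
  where "P_root = Abs_fps (\<lambda>n. if even n
    then (((1 / 2) gchoose (n div 2)) * (- 1) ^ (n div 2)) *\<^sub>C P_squared ^ (n div 2) else 0)"

definition Xi :: momenta
  where "Xi = fps_X *\<^sub>h P_low 0 + P_root"

definition Xi_inv :: momenta
  where "Xi_inv = fps_right_inverse Xi 1"

lemma cscale_mult_cscale: "c *\<^sub>C x * (d *\<^sub>C y) = (c * d) *\<^sub>C (x * (y::'a::complex_algebra))"
  by (simp add: cscale_mult_left cscale_mult_right cscale_cscale mult.commute)

lemma cscale_sum_left: "(\<Sum>k\<in>A. c k) *\<^sub>C x = (\<Sum>k\<in>A. c k *\<^sub>C (x :: 'a::complex_algebra))"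
  by (induction A rule: infinite_finite_induct) (auto simp: cscale_zero_left cscale_add_left)

lemma P_root_square: "P_root * P_root = 1 - fps_X ^ 2 *\<^sub>h fps_const P_squared"
proof (rule fps_ext)
  fix n
  define a :: "nat \<Rightarrow> complex" where "a k = ((1 / 2) gchoose k) * (- 1) ^ k" for k
  have root: "P_root $ i = (if even i then a (i div 2) *\<^sub>C P_squared ^ (i div 2) else 0)" for i
    by (simp add: P_root_def a_def)
  have rhs: "(1 - fps_X ^ 2 *\<^sub>h fps_const P_squared) $ n = (if n = 0 then 1 else if n = 2 then - P_squared else 0)"
    by (auto simp: hscale_fps_X_power fps_X_power_mult_nth)
  show "(P_root * P_root) $ n = (1 - fps_X ^ 2 *\<^sub>h fps_const P_squared) $ n"
  proof (cases "even n")
    case True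
    then obtain k where n: "n = 2 * k" by auto
    have "(P_root * P_root) $ n = (\<Sum>i=0..n. P_root $ i * P_root $ (n - i))"
      by (rule fps_mult_nth)
    also have "\<dots> = (\<Sum>i\<in>(*) 2 ` {0..k}. P_root $ i * P_root $ (n - i))"
      by (rule sum.mono_neutral_right) (auto simp: n root elim!: evenE)
    also have "\<dots> = (\<Sum>j=0..k. P_root $ (2 * j) * P_root $ (n - 2 * j))"
      by (subst sum.reindex) (auto simp: inj_on_def)
    also have "\<dots> = (\<Sum>j=0..k. (a j * a (k - j)) *\<^sub>C P_squared ^ k)"
    proof (rule sum.cong)
      fix j assume "j \<in> {0..k}"
      then have "j \<le> k" by simp
      moreover from this have "n - 2 * j = 2 * (k - j)" by (simp add: n)
      ultimately show "P_root $ (2 * j) * P_root $ (n - 2 * j) = (a j * a (k - j)) *\<^sub>C P_squared ^ k"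
        by (simp add: root cscale_mult_cscale flip: power_add)
    qed simp
    also have "\<dots> = (\<Sum>j=0..k. a j * a (k - j)) *\<^sub>C P_squared ^ k"
      by (simp add: cscale_sum_left)
    also have "(\<Sum>j=0..k. a j * a (k - j)) = (\<Sum>j=0..k. ((1 / 2) gchoose j) * ((1 / 2) gchoose (k - j))) * (- 1) ^ k"
      unfolding sum_distrib_right
    proof (rule sum.cong)
      fix j assume "j \<in> {0..k}"
      then have "(- 1 :: complex) ^ k = (- 1) ^ j * (- 1) ^ (k - j)" by (simp flip: power_add)
      then show "a j * a (k - j) = ((1 / 2) gchoose j) * ((1 / 2) gchoose (k - j)) * (- 1) ^ k"
        by (simp add: a_def)
    qed simp
    also have "(\<Sum>j=0..k. ((1 / 2) gchoose j) * ((1 / 2) gchoose (k - j))) = ((1 :: complex) gchoose k)"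
      using gbinomial_Vandermonde[of "1/2 :: complex" "1/2" k] by (simp add: atLeast0AtMost)
    also have "(1 :: complex) gchoose k = of_nat (1 choose k)"
      by (simp add: binomial_gbinomial)
    finally have prod: "(P_root * P_root) $ n = (of_nat (1 choose k) * (- 1) ^ k) *\<^sub>C P_squared ^ k" .
    have neg: "(- 1) *\<^sub>C P_squared = - P_squared"
      using cscale_add_left[of "- 1" 1 P_squared]
      by (simp add: cscale_zero_left cscale_one eq_neg_iff_add_eq_0)
    consider "k = 0" | "k = 1" | "k > 1" by linarith
    then show ?thesis unfolding prod rhs
      by cases (simp_all add: n neg cscale_one cscale_zero_left binomial_eq_0)
  next
    case False
    then have "(P_root * P_root) $ n = 0"
      by (auto simp: fps_mult_nth root intro!: sum.neutral)
    with False odd_pos[of n] show ?thesis unfolding rhs by auto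
  qed
qed

lemma Xi_inverse: "Xi * Xi_inv = 1"
  unfolding Xi_inv_def
proof (rule fps_right_inverse)
  have "fps_X *\<^sub>h P_low 0 = fps_X * P_low 0" using hscale_fps_X_power[of 1 "P_low 0"] by simp
  then show "Xi $ 0 * 1 = 1"
    by (simp add: Xi_def P_root_def cscale_one)
qed
text \<open>The h-adic algebra homomorphism with prescribed values on the generators.  It exists and is
  unique if these values commute, see \<open>momenta_hom_ex1\<close>; continuity in the h-adic
  topology is implied by linearity over power series.\<close>

definition momenta_hom :: "(4 \<Rightarrow> 'a::hadic_algebra) \<Rightarrow> momenta \<Rightarrow> 'a"
  where "momenta_hom v = (THE F. hadic_hom F \<and> (\<forall>\<mu>. F (P_low \<mu>) = v \<mu>))"

definition mono_val :: "(4 \<Rightarrow> 'a::hadic_algebra) \<Rightarrow> (4 \<Rightarrow>\<^sub>0 nat) \<Rightarrow> 'a"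
  where "mono_val v \<alpha> = v 0 ^ Poly_Mapping.lookup \<alpha> 0 * v 1 ^ Poly_Mapping.lookup \<alpha> 1 * 
    v 2 ^ Poly_Mapping.lookup \<alpha> 2 * v 3 ^ Poly_Mapping.lookup \<alpha> 3"

lemma power_commute: 
  assumes "x * y = y * (x::'a::monoid_mult)" shows "x ^ n * y = y * x ^ n"
  by (induction n) (simp_all add: mult.assoc assms, simp add: mult.assoc[symmetric] assms)

lemma power_commutes2:
  assumes "x * y = y * (x::'a::monoid_mult)" shows "x ^ n * y ^ m = y ^ m * x ^ n"
  using power_commute[OF power_commute[OF assms, of n, symmetric], of m] by simp

lemma mono_val_add:
  assumes "\<And>\<mu> \<nu>. v \<mu> * v \<nu> = v \<nu> * v \<mu>"
  shows "mono_val v (\<alpha> + \<beta>) = mono_val v \<alpha> * mono_val v \<beta>"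
proof -
  have c: "v \<mu> ^ m * v \<nu> ^ n = v \<nu> ^ n * v \<mu> ^ m" for \<mu> \<nu> m n
    using power_commutes2[OF assms] .
  have c': "v \<mu> ^ m * (v \<nu> ^ n * z) = v \<nu> ^ n * (v \<mu> ^ m * z)" for \<mu> \<nu> m n z
    unfolding mult.assoc[symmetric] c ..
  show ?thesis
    unfolding mono_val_def lookup_add power_add mult.assoc
    by (simp only: c'[of 1 _ 0] c'[of 2 _ 0] c'[of 3 _ 0] c'[of 2 _ 1] c'[of 3 _ 1] c'[of 3 _ 2]
       c[of 1 _ 0] c[of 2 _ 0] c[of 3 _ 0] c[of 2 _ 1] c[of 3 _ 1] c[of 3 _ 2] mult.assoc)
qed

lemma index_cases: "(\<mu>::4) = 0 \<or> \<mu> = 1 \<or> \<mu> = 2 \<or> \<mu> = 3"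
proof (induct \<mu>)
  case (of_int z)
  then have "0 \<le> z" "z < 4" by simp_all
  then have "z = 0 \<or> z = 1 \<or> z = 2 \<or> z = 3" by arith
  then show ?case by auto
qed

lemma momenta_mono: "fps_const (Poly_Mapping.single \<alpha> 1) = mono_val P_low \<alpha>"
proof -
  have pw: "P_low \<mu> ^ n = fps_const (Poly_Mapping.single (Poly_Mapping.single \<mu> n) 1)" for \<mu> n
  proof (induction n)
    case (Suc n) then show ?case
      by (simp add: P_low_def P_var_def mult_single flip: single_add)
  qed simp
  have "\<alpha> = Poly_Mapping.single 0 (Poly_Mapping.lookup \<alpha> 0) + Poly_Mapping.single 1 (Poly_Mapping.lookup \<alpha> 1) +
    Poly_Mapping.single 2 (Poly_Mapping.lookup \<alpha> 2) + Poly_Mapping.single 3 (Poly_Mapping.lookup \<alpha> 3)"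
  proof (rule poly_mapping_eqI)
    fix k :: 4
    have "k = 0 \<or> k = 1 \<or> k = 2 \<or> k = 3" by (rule index_cases)
    then show "Poly_Mapping.lookup \<alpha> k = Poly_Mapping.lookup (Poly_Mapping.single 0 (Poly_Mapping.lookup \<alpha> 0) + Poly_Mapping.single 1 (Poly_Mapping.lookup \<alpha> 1) +
    Poly_Mapping.single 2 (Poly_Mapping.lookup \<alpha> 2) + Poly_Mapping.single 3 (Poly_Mapping.lookup \<alpha> 3)) k"
      by (auto simp: lookup_add lookup_single)
  qed
  then show ?thesis
    unfolding mono_val_def pw by (simp add: mult_single)
qed

lemma hom_power: "hadic_hom F \<Longrightarrow> F (x ^ n) = F x ^ n"
  by (induction n) (auto simp: hadic_hom_def)

lemma momenta_hom_ex1: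
  fixes v :: "4 \<Rightarrow> 'a::hadic_algebra"
  assumes "\<And>\<mu> \<nu>. v \<mu> * v \<nu> = v \<nu> * v \<mu>"
  shows "\<exists>!F. hadic_hom F \<and> (\<forall>\<mu>. F (P_low \<mu>) = v \<mu>)"
proof -
  obtain F :: "momenta \<Rightarrow> 'a" where F: "hlinear F"
     and Fm: "\<And>\<alpha>. F (fps_const (Poly_Mapping.single \<alpha> 1)) = mono_val v \<alpha>"
    using hlinear_extension[of "mono_val v"] by blast
  have 1: "F (fps_const (Poly_Mapping.single \<alpha> 1) * y) = F (fps_const (Poly_Mapping.single \<alpha> 1)) * F y" for \<alpha> y
    by (rule fun_cong[where x = y], rule hlinear_unique, rule hlinear_comp_right[OF F], rule hlinear_right[OF F])
      (simp add: mult_single Fm mono_val_add[OF assms])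
  have mult: "F (x * y) = F x * F y" for x y
    by (rule fun_cong[where x = x], rule hlinear_unique, rule hlinear_comp_left[OF F], rule hlinear_left[OF F])
      (rule 1)
  have "F 1 = 1" using Fm[of 0] by (simp add: mono_val_def)
  with F mult have hom: "hadic_hom F" by (auto simp: hadic_hom_def)
  have val: "F (P_low \<mu>) = v \<mu>" for \<mu>
  proof -
    have "\<mu> = 0 \<or> \<mu> = 1 \<or> \<mu> = 2 \<or> \<mu> = 3" by (rule index_cases)
    then show ?thesis unfolding P_low_def P_var_def Fm mono_val_def by (auto simp: lookup_single)
  qed
  have uniq: "G = F" if G: "hadic_hom G" "\<And>\<mu>. G (P_low \<mu>) = v \<mu>" for G
  proof (rule hlinear_unique)
    show "hlinear G" "hlinear F" using G F by (auto simp: hadic_hom_def)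
    have hm: "H (a * b) = H a * H b" if "hadic_hom H" for a b and H :: "momenta \<Rightarrow> 'a"
      using that by (simp add: hadic_hom_def)
    show "G (fps_const (Poly_Mapping.single \<alpha> 1)) = F (fps_const (Poly_Mapping.single \<alpha> 1))" for \<alpha>
      unfolding momenta_mono by (simp add: mono_val_def hm G hom hom_power val)
  qed
  show ?thesis using hom val uniq by blast
qed


definition coproduct_gen :: "4 \<Rightarrow> (momenta, momenta) ctensor"
  where "coproduct_gen \<mu> =
    (if \<mu> = 0
     then P_low 0 \<otimes>\<^sub>h Xi + Xi_inv \<otimes>\<^sub>h P_low 0 + (\<Sum>m\<in>{1, 2, 3}. fps_X *\<^sub>h ((P_low m * Xi_inv) \<otimes>\<^sub>h P_low m))
     else P_low \<mu> \<otimes>\<^sub>h Xi + 1 \<otimes>\<^sub>h P_low \<mu>)"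

definition coproduct :: "momenta \<Rightarrow> (momenta, momenta) ctensor"
  where "coproduct = momenta_hom coproduct_gen"

definition counit :: "momenta \<Rightarrow> complex fps"
  where "counit = momenta_hom (\<lambda>_. 0)"

lemma momenta_tensor_commute: "x * y = y * (x :: (momenta, momenta) ctensor)"
proof -
  have id: "hlinear (\<lambda>x :: (momenta, momenta) ctensor. x)" by (simp add: hlinear_def)
  have "(\<lambda>y. (a \<otimes>\<^sub>h b) * y) = (\<lambda>y. y * (a \<otimes>\<^sub>h b))" for a b :: momenta
    by (rule ctensor_hlinear_unique[OF hlinear_right[OF id] hlinear_left[OF id]])
      (simp add: tens_mult mult.commute)
  then have "(\<lambda>x. x * y) = (\<lambda>x. y * x)"
    by (intro ctensor_hlinear_unique hlinear_left[OF id] hlinear_right[OF id]) (rule fun_cong)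
  then show ?thesis by (rule fun_cong)
qed

lemma coproduct: "hadic_hom coproduct" "coproduct (P_low \<mu>) = coproduct_gen \<mu>"
  using theI'[OF momenta_hom_ex1[of coproduct_gen, OF momenta_tensor_commute]]
  unfolding coproduct_def momenta_hom_def by blast+

lemma counit: "hadic_hom counit" "counit (P_low \<mu>) = 0"
  using theI'[OF momenta_hom_ex1[of "\<lambda>_. 0 :: complex fps"]]
  unfolding counit_def momenta_hom_def by auto

section \<open>The deformed Weyl algebra\<close>

definition module_algebra :: "(momenta \<Rightarrow> 'a::hadic_algebra \<Rightarrow> 'a) \<Rightarrow> bool"
  where "module_algebra act \<longleftrightarrow>
    hbilinear act \<and>
    (\<forall>f. act 1 f = f) \<and>
    (\<forall>L M f. act (L * M) f = act L (act M f)) \<and>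
    (\<forall>L. act L 1 = counit L *\<^sub>h 1) \<and>
    (\<forall>L f g. act L (f * g) = ctensor_lift (\<lambda>L1 L2. act L1 f * act L2 g) (coproduct L))"

definition X_up :: "4 \<Rightarrow> uh"
  where "X_up \<nu> = (\<Sum>\<rho>\<in>UNIV. fps_const (eta \<nu> \<rho>) *\<^sub>h X_low \<rho>)"

text \<open>The module algebra structure of kappa-Minkowski spacetime.  It is unique, since polynomials in
  the momenta and words in the coordinates span dense subspaces; on words it is determined by the
  coproduct.\<close>

definition momentum_action :: "momenta \<Rightarrow> uh \<Rightarrow> uh"  (infixr \<open>\<rhd>\<close> 73)
  where "momentum_action = (THE act. module_algebra act \<and>
    (\<forall>\<mu> \<nu>. act (P_low \<mu>) (X_up \<nu>) = (if \<mu> = \<nu> then fps_const (- \<i>) else 0) *\<^sub>h 1))"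

type_synonym deformed_weyl = "(uh, momenta) ctensor"

text \<open>The underlying module of the smash product is the completed tensor product; its multiplication
  is \<open>smash_mult\<close>, not the product of the tensor product algebra.  Existence and
  uniqueness of the bilinear extension hold for every bilinear action, see
  \<open>smash_mult_ex1\<close>.\<close>

definition smash_mult :: "deformed_weyl \<Rightarrow> deformed_weyl \<Rightarrow> deformed_weyl"
  where "smash_mult = (THE m. hbilinear m \<and>
    (\<forall>f L g M. m (f \<otimes>\<^sub>h L) (g \<otimes>\<^sub>h M) =
      ctensor_lift (\<lambda>L1 L2. (f * (L1 \<rhd> g)) \<otimes>\<^sub>h (L2 * M)) (coproduct L)))"

lemma smash_mult_ex1:
  fixes act :: "momenta \<Rightarrow> uh \<Rightarrow> uh"
  assumes act: "hbilinear act"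
  shows "\<exists>!m. hbilinear m \<and> (\<forall>f L g M. m (f \<otimes>\<^sub>h L) (g \<otimes>\<^sub>h M) =
    ctensor_lift (\<lambda>L1 L2. (f * act L1 g) \<otimes>\<^sub>h (L2 * M)) (coproduct L))"
proof -
  have A: "act (x + y) g = act x g + act y g" "act (c *\<^sub>h x) g = c *\<^sub>h act x g"
    "act x (g + g') = act x g + act x g'" "act x (c *\<^sub>h g) = c *\<^sub>h act x g" for x y g g' c
    using act by (auto simp: hbilinear_def hlinear_def)
  have T: "(x + y) \<otimes>\<^sub>h b = x \<otimes>\<^sub>h b + y \<otimes>\<^sub>h b" "(c *\<^sub>h x) \<otimes>\<^sub>h b = c *\<^sub>h (x \<otimes>\<^sub>h b)"
     "a \<otimes>\<^sub>h (b + b') = a \<otimes>\<^sub>h b + a \<otimes>\<^sub>h b'" "a \<otimes>\<^sub>h (c *\<^sub>h b) = c *\<^sub>h (a \<otimes>\<^sub>h b)"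
    for x y a :: uh and b b' :: momenta and c
    using hbilinear_tens[where 'a = uh and 'b = momenta] by (simp_all add: hbilinear_def hlinear_def)
  note alg = A T distrib_left distrib_right hscale_mult_left hscale_mult_right
  define B where "B f g M L1 L2 = (f * act L1 g) \<otimes>\<^sub>h (L2 * M)" for f g and M L1 L2 :: momenta
  have B: "hbilinear (B f g M)" for f g M
    unfolding hbilinear_def hlinear_def B_def by (auto simp: alg)
  have D: "hlinear coproduct" using coproduct(1) by (simp add: hadic_hom_def)
  define R where "R g M f L = ctensor_lift (B f g M) (coproduct L)" for f g M L
  have R_f: "hlinear (\<lambda>f. R g M f L)" for g M L
    unfolding R_def by (rule ctensor_lift_param[OF B]) (auto simp: hlinear_def B_def alg)
  have R_g: "hlinear (\<lambda>g. R g M f L)" for f M L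
    unfolding R_def by (rule ctensor_lift_param[OF B]) (auto simp: hlinear_def B_def alg)
  have R_M: "hlinear (\<lambda>M. R g M f L)" for f g L
    unfolding R_def by (rule ctensor_lift_param[OF B]) (auto simp: hlinear_def B_def alg)
  have R_L: "hlinear (R g M f)" for f g M
    using D hlinear_ctensor_lift[OF B[of f g M]] by (simp add: hlinear_def R_def)
  have R: "hbilinear (R g M)" for g M
    using R_f R_L by (simp add: hbilinear_def)
  define K where "K s g M = ctensor_lift (R g M) s" for s g M
  have K_g: "hlinear (\<lambda>g. K s g M)" for s M
    unfolding K_def by (rule ctensor_lift_param[OF R R_g])
  have K_M: "hlinear (K s g)" for s g
    unfolding K_def by (rule ctensor_lift_param[OF R R_M])
  have K: "hbilinear (K s)" for s
    using K_g K_M by (simp add: hbilinear_def)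
  define m where "m s t = ctensor_lift (K s) t" for s t
  have m_s: "hlinear (\<lambda>s. m s t)" for t
    unfolding m_def by (rule ctensor_lift_param[OF K]) (simp add: K_def hlinear_ctensor_lift[OF R])
  have m_t: "hlinear (m s)" for s
    unfolding m_def by (rule hlinear_ctensor_lift[OF K])
  have "hbilinear m" using m_s m_t by (simp add: hbilinear_def)
  moreover have m: "m (f \<otimes>\<^sub>h L) (g \<otimes>\<^sub>h M) = ctensor_lift (\<lambda>L1 L2. (f * act L1 g) \<otimes>\<^sub>h (L2 * M)) (coproduct L)" for f L g M
    by (simp add: m_def ctensor_lift_tens[OF K] K_def ctensor_lift_tens[OF R] R_def B_def[abs_def])
  moreover have "m' = m" if m': "hbilinear m'"
    "\<And>f L g M. m' (f \<otimes>\<^sub>h L) (g \<otimes>\<^sub>h M) = ctensor_lift (\<lambda>L1 L2. (f * act L1 g) \<otimes>\<^sub>h (L2 * M)) (coproduct L)" for m'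
  proof -
    have "m' (f \<otimes>\<^sub>h L) = m (f \<otimes>\<^sub>h L)" for f L
      by (rule ctensor_hlinear_unique) (use m' m_t m in \<open>auto simp: hbilinear_def\<close>)
    then have "(\<lambda>s. m' s t) = (\<lambda>s. m s t)" for t
      using m' m_s by (intro ctensor_hlinear_unique) (auto simp: hbilinear_def)
    then show ?thesis by (intro ext) (rule fun_cong)
  qed
  ultimately show ?thesis by (intro ex1I[of _ m]) blast+
qed

end

theory Submission
  imports Defs "HOL-Library.Product_Plus"
begin

text \<open>
  The deformed coordinates are realized inside \<open>W[[h]]\<close> by \<open>X\<^sub>0 \<mapsto> x\<^sub>0 S\<close> and
  \<open>X\<^sub>j \<mapsto> x\<^sub>j \<Xi> - h x\<^sub>0 p\<^sub>j\<close>, the momenta by \<open>P\<^sub>\<mu> \<mapsto> p\<^sub>\<mu>\<close>, where \<open>S\<close> is the square root of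
  \<open>1 - h\<^sup>2 p\<^sup>2\<close>.  The linear map \<open>f \<otimes> L \<mapsto> f L\<close> sends \<open>X\<^sup>\<alpha> \<otimes> P\<^sup>\<beta>\<close> to \<open>x\<^sup>\<alpha> p\<^sup>\<beta>\<close> modulo \<open>h\<close>; the former
  span, and the latter form a basis of the Weyl algebra, so the map is bijective by completeness.
  The action of the momenta is then recovered from the Weyl algebra as
  \<open>L \<rhd> g = vac (L g)\<close>, where \<open>vac (f M) = \<epsilon>(M) f\<close>.  The cross relation
  \<open>L g = (L\<^sub>1 \<rhd> g) L\<^sub>2\<close> reduces to the generators and says both that this is the module algebra
  structure in question and that the map is multiplicative.
\<close>

section \<open>Power series and linear maps\<close>

text \<open>Two obstacles fix the order of the argument. First, \<open>momentum_action\<close> and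
  \<open>smash_mult\<close> are definite descriptions, so nothing can be said about the product
  until a module algebra structure with the prescribed values is known to exist and to be unique. A
  construction directly on \<open>uh\<close> would have to check twisted Leibniz rules against the
  relations; here these rules become consequences of associativity in the Weyl algebra. This
  requires the realization to be bijective as a mere linear map, before any product on its source is
  available; multiplicativity comes last. Second, \<open>uh\<close> and the completed tensor product
  are quotients by closed ideals, for which neither a basis nor the absence of h-torsion is given.
  Therefore power series over pairs of exponent vectors are mapped onto the tensor product, which
  takes only spanning modulo h, and from there into the Weyl series. Independence is tested in the
  Weyl series alone, where constant coefficients are visible and h can be cancelled.\<close>

lemma fps_X_hscale_nth_0 [simp]: "(fps_X *\<^sub>h f) $ 0 = (0 :: 'a::complex_algebra)"
  using hscale_fps_X_power[of 1 f] by simp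

lemma fps_split_const: "f = fps_const (f $ 0) + fps_X *\<^sub>h fps_shift 1 (f :: 'a::complex_algebra fps)"
  using fps_truncate[of f 1] by (simp add: hscale_one)

lemma fps_X_power_hscale_cancel:
  "fps_X ^ n *\<^sub>h f = fps_X ^ n *\<^sub>h g \<Longrightarrow> f = (g :: 'a::complex_algebra fps)"
proof (rule fps_ext)
  fix k
  assume "fps_X ^ n *\<^sub>h f = fps_X ^ n *\<^sub>h g"
  then have "(fps_X ^ n *\<^sub>h f) $ (k + n) = (fps_X ^ n *\<^sub>h g) $ (k + n)" by simp
  then show "f $ k = g $ k" by (simp add: hscale_fps_X_power fps_X_power_mult_nth)
qed

text \<open>Successive approximation: each remainder is again a value of \<open>F\<close> modulo h,
  completeness of the source sums the corrections h^m \<open>v (r m)\<close>, and separatedness of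
  the target shows that nothing is left over.\<close>

lemma hadic_surjI:
  fixes F :: "'a::hadic_algebra \<Rightarrow> 'b::hadic_algebra"
  assumes F: "hlinear F" and step: "\<And>c. \<exists>v d. c = F v + fps_X *\<^sub>h d"
  shows "surj F"
proof -
  obtain v g where vg: "\<And>c. c = F (v c) + fps_X *\<^sub>h g c" using step by metis
  have "\<exists>u. F u = c" for c
  proof
    define r where "r n = (g ^^ n) c" for n
    have trunc: "c = (\<Sum>m<n. fps_X ^ m *\<^sub>h F (v (r m))) + fps_X ^ n *\<^sub>h r n" for n
    proof (induction n)
      case (Suc n)
      have "fps_X ^ n *\<^sub>h r n = fps_X ^ n *\<^sub>h F (v (r n)) + fps_X ^ Suc n *\<^sub>h r (Suc n)"
        by (subst vg[of "r n"]) (simp add: hscale_add_right hscale_hscale r_def mult.commute)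
      then show ?case using Suc by (simp add: add.assoc)
    qed (simp add: r_def hscale_one)
    show "F (hsum (\<lambda>m. v (r m))) = c"
    proof (rule hadic_eqI)
      fix n
      obtain z where z: "hsum (\<lambda>m. v (r m)) - (\<Sum>m<n. fps_X ^ m *\<^sub>h v (r m)) = fps_X ^ n *\<^sub>h z"
        using hsum[of "\<lambda>m. v (r m)" n] by blast
      have "F (hsum (\<lambda>m. v (r m))) - (\<Sum>m<n. fps_X ^ m *\<^sub>h F (v (r m))) = fps_X ^ n *\<^sub>h F z"
        using arg_cong[OF z, of F] by (simp add: F hlinear_diff hlinear_sum hlinear_hscale)
      then have "F (hsum (\<lambda>m. v (r m))) - c = fps_X ^ n *\<^sub>h (F z - r n)"
        by (subst trunc[of n]) (simp add: hscale_diff_right algebra_simps)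
      then show "\<exists>z. F (hsum (\<lambda>m. v (r m))) - c = fps_X ^ n *\<^sub>h z" by blast
    qed
  qed
  then show ?thesis by (metis surj_def)
qed

text \<open>An element of the kernel has constant coefficient zero by \<open>lead\<close>. Dividing
  it by h gives another element of the kernel, since the target has no h-torsion, and the argument
  repeats for the next coefficient.\<close>

lemma hadic_fps_injI:
  fixes F :: "'a::complex_algebra fps \<Rightarrow> 'b::complex_algebra fps"
  assumes F: "hlinear F" and lead: "\<And>v. F (fps_const v) $ 0 = 0 \<Longrightarrow> v = 0"
  shows "inj F"
proof (rule injI)
  have ker: "f $ n = 0" if "F f = 0" for f n
    using that
  proof (induction n arbitrary: f)
    case (0 f)
    have "F f $ 0 = F (fps_const (f $ 0)) $ 0"
      by (subst fps_split_const[of f]) (simp add: F hlinear_add hlinear_hscale)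
    with 0 lead show ?case by simp
  next
    case (Suc n f)
    have "F f $ 0 = F (fps_const (f $ 0)) $ 0"
      by (subst fps_split_const[of f]) (simp add: F hlinear_add hlinear_hscale)
    then have f0: "f $ 0 = 0" using Suc.prems lead by simp
    have "f = fps_X *\<^sub>h fps_shift 1 f"
      using fps_split_const[of f] by (simp add: f0)
    then have "F f = fps_X *\<^sub>h F (fps_shift 1 f)"
      by (metis F hlinear_hscale)
    then have "fps_X ^ 1 *\<^sub>h F (fps_shift 1 f) = fps_X ^ 1 *\<^sub>h 0"
      using Suc.prems by (simp add: hscale_zero_right)
    then have "F (fps_shift 1 f) = 0" by (rule fps_X_power_hscale_cancel)
    from Suc.IH[OF this] show ?case by simp
  qed
  fix f g assume "F f = F g"
  then have "F (f - g) = 0" by (simp add: hlinear_diff[OF F])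
  from ker[OF this] show "f = g" by (intro fps_ext) simp
qed

section \<open>Maps out of kappa-Minkowski spacetime\<close>

lemma abs_uh_surj: "\<exists>x. z = abs_uh x"
  by (metis Quotient3_abs_rep Quotient3_uh)

lemma uh_word:
  "abs_uh (fps_const (Poly_Mapping.single (Word w) 1)) = prod_list (map X_low w)"
proof (induction w)
  case Nil
  show ?case
    by (simp add: one_uh.abs_eq flip: zero_free_monoid_def)
next
  case (Cons \<mu> w)
  have "fps_const (Poly_Mapping.single (Word (\<mu> # w)) 1) =
      fps_const (gen \<mu>) * fps_const (Poly_Mapping.single (Word w) 1)"
    by (simp add: gen_def mult_single)
  also have "abs_uh \<dots> = X_low \<mu> * prod_list (map X_low w)"
    unfolding Cons[symmetric] X_low.abs_eq times_uh.abs_eq ..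
  finally show ?case by simp
qed

lemma uh_hlinear_unique:
  fixes F G :: "uh \<Rightarrow> 'c::hadic_algebra"
  assumes F: "hlinear F" and G: "hlinear G"
    and eq: "\<And>w. F (prod_list (map X_low w)) = G (prod_list (map X_low w))"
  shows "F = G"
proof -
  have lin: "hlinear (\<lambda>x. H (abs_uh x))" if "hlinear H" for H :: "uh \<Rightarrow> 'c"
    using that by (simp add: hlinear_def flip: plus_uh.abs_eq hscale_uh.abs_eq)
  have "(\<lambda>x. F (abs_uh x)) = (\<lambda>x. G (abs_uh x))"
  proof (rule hlinear_unique[OF lin[OF F] lin[OF G]])
    fix k :: "4 free_monoid"
    show "F (abs_uh (fps_const (Poly_Mapping.single k 1))) = G (abs_uh (fps_const (Poly_Mapping.single k 1)))"
      by (cases k) (use eq in \<open>simp add: uh_word\<close>)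
  qed
  then show ?thesis by (metis ext abs_uh_surj)
qed

lemma uh_relation_zero: "r \<in> uh_relations \<Longrightarrow> abs_uh r = 0"
  unfolding zero_uh.abs_eq uh.abs_eq_iff ideal_rel_def uh_ideal_def hadic_closure_def
  by (auto intro!: bexI[of _ r] exI[of _ 0] simp: hscale_zero_right two_sided_ideal_base)

lemma X_low_commutator:
  shows "i \<noteq> 0 \<Longrightarrow> X_low 0 * X_low i - X_low i * X_low 0 = (- (fps_const \<i> * fps_X)) *\<^sub>h X_low i"
    and "j \<noteq> 0 \<Longrightarrow> k \<noteq> 0 \<Longrightarrow> X_low j * X_low k = X_low k * X_low j"
proof -
  assume "i \<noteq> 0"
  then have "commutator (fps_const (gen 0)) (fps_const (gen i)) -
      (- (fps_const \<i> * fps_X)) *\<^sub>h fps_const (gen i) \<in> uh_relations"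
    unfolding uh_relations_def by blast
  from uh_relation_zero[OF this]
  show "X_low 0 * X_low i - X_low i * X_low 0 = (- (fps_const \<i> * fps_X)) *\<^sub>h X_low i"
    by (simp only: commutator_def right_minus_eq
        flip: X_low.abs_eq times_uh.abs_eq minus_uh.abs_eq hscale_uh.abs_eq)
next
  assume "j \<noteq> 0" "k \<noteq> 0"
  then have "commutator (fps_const (gen j)) (fps_const (gen k)) \<in> uh_relations"
    unfolding uh_relations_def by blast
  from uh_relation_zero[OF this]
  show "X_low j * X_low k = X_low k * X_low j"
    by (simp only: commutator_def right_minus_eq
        flip: X_low.abs_eq times_uh.abs_eq minus_uh.abs_eq)
qed

text \<open>The universal property of the presentation. A linear map sends multiples of h^n to
  multiples of h^n, so once the relations go to zero, separatedness of the target also kills the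
  h-adic closure of the ideal.\<close>

lemma uh_hom_exists:
  fixes v :: "4 \<Rightarrow> 'a::hadic_algebra"
  assumes v0: "\<And>i. i \<noteq> 0 \<Longrightarrow> v 0 * v i - v i * v 0 = (- (fps_const \<i> * fps_X)) *\<^sub>h v i"
    and v: "\<And>j k. j \<noteq> 0 \<Longrightarrow> k \<noteq> 0 \<Longrightarrow> v j * v k = v k * v j"
  shows "\<exists>F. hadic_hom F \<and> (\<forall>\<mu>. F (X_low \<mu>) = v \<mu>)"
proof -
  define ev where "ev k = (case k of Word w \<Rightarrow> prod_list (map v w))" for k
  obtain F :: "4 free_algebra fps \<Rightarrow> 'a" where F: "hlinear F"
    and F_word: "\<And>k. F (fps_const (Poly_Mapping.single k 1)) = ev k"
    using hlinear_extension[of ev] by blast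
  note Fsimps = hlinear_add[OF F] hlinear_diff[OF F] hlinear_hscale[OF F]
  have ev_add: "ev (k + l) = ev k * ev l" for k l
    by (cases k; cases l) (simp add: ev_def)
  have 1: "F (fps_const (Poly_Mapping.single k 1) * y) = F (fps_const (Poly_Mapping.single k 1)) * F y" for k y
    by (rule fun_cong[where x = y], rule hlinear_unique, rule hlinear_comp_right[OF F], rule hlinear_right[OF F])
      (simp add: mult_single F_word ev_add)
  have mult: "F (x * y) = F x * F y" for x y
    by (rule fun_cong[where x = x], rule hlinear_unique, rule hlinear_comp_left[OF F], rule hlinear_left[OF F])
      (rule 1)
  have F_gen: "F (fps_const (gen \<mu>)) = v \<mu>" for \<mu>
    by (simp add: gen_def F_word ev_def)
  have "ev 0 = 1" by (simp add: ev_def zero_free_monoid_def)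
  then have F_one: "F 1 = 1" using F_word[of 0] by simp
  have rel: "F r = 0" if "r \<in> uh_relations" for r
    using that unfolding uh_relations_def
    by (auto simp: commutator_def Fsimps mult F_gen v0 v simp del: fps_const_mult)
  have ideal: "F x = 0" if "x \<in> two_sided_ideal uh_relations" for x
    using that by (induction rule: two_sided_ideal.induct) (auto simp: hlinear_zero[OF F] Fsimps mult rel)
  have closure: "F x = 0" if "x \<in> uh_ideal" for x
  proof (rule hadic_eqI)
    fix n
    from that obtain y z where "y \<in> two_sided_ideal uh_relations" "x - y = fps_X ^ n *\<^sub>h z"
      unfolding uh_ideal_def hadic_closure_def by blast
    then have "F x - 0 = fps_X ^ n *\<^sub>h F z"
      using ideal[of y] hlinear_diff[OF F, of x y] by (simp add: Fsimps)
    then show "\<exists>z. F x - 0 = fps_X ^ n *\<^sub>h z" by blast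
  qed
  define G where "G z = F (rep_uh z)" for z
  have G_abs: "G (abs_uh x) = F x" for x
  proof -
    have "ideal_rel uh_ideal (rep_uh (abs_uh x)) x"
      by (simp add: Quotient3_uh Quotient3_rep_abs ideal_rel_uh_refl)
    then show ?thesis using closure[of "rep_uh (abs_uh x) - x"]
      by (simp add: G_def ideal_rel_def Fsimps)
  qed
  have G_add: "G (x + y) = G x + G y" and G_mult: "G (x * y) = G x * G y"
    and G_scale: "G (c *\<^sub>h x) = c *\<^sub>h G x" for x y c
  proof -
    obtain u v where "x = abs_uh u" "y = abs_uh v" using abs_uh_surj by blast
    then show "G (x + y) = G x + G y" "G (x * y) = G x * G y" "G (c *\<^sub>h x) = c *\<^sub>h G x"
      by (simp_all add: plus_uh.abs_eq times_uh.abs_eq hscale_uh.abs_eq G_abs Fsimps mult)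
  qed
  have "hadic_hom G"
    by (simp add: hadic_hom_def hlinear_def G_add G_mult G_scale one_uh.abs_eq G_abs F_one)
  moreover have "G (X_low \<mu>) = v \<mu>" for \<mu>
    by (simp add: X_low.abs_eq G_abs F_gen)
  ultimately show ?thesis by blast
qed

section \<open>Normal ordering in the Weyl algebra\<close>

lift_definition weyl_gen_of :: "weyl_gen \<Rightarrow> weyl" is gen .

lemma abs_weyl_surj: "\<exists>x. z = abs_weyl x"
  by (metis Quotient3_abs_rep Quotient3_weyl)

lemma weyl_relation_zero: "r \<in> weyl_relations \<Longrightarrow> abs_weyl r = 0"
  unfolding zero_weyl.abs_eq weyl.abs_eq_iff ideal_rel_def weyl_ideal_def
  by (simp add: two_sided_ideal_base)

lemma weyl_commutators:
  shows "weyl_gen_of (Mom \<mu>) * weyl_gen_of (Pos \<nu>) =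
      weyl_gen_of (Pos \<nu>) * weyl_gen_of (Mom \<mu>) + (- \<i> * eta \<mu> \<nu>) *\<^sub>C 1"
    and "weyl_gen_of (Pos \<mu>) * weyl_gen_of (Pos \<nu>) = weyl_gen_of (Pos \<nu>) * weyl_gen_of (Pos \<mu>)"
    and "weyl_gen_of (Mom \<mu>) * weyl_gen_of (Mom \<nu>) = weyl_gen_of (Mom \<nu>) * weyl_gen_of (Mom \<mu>)"
proof -
  have "commutator (gen (Mom \<mu>)) (gen (Pos \<nu>)) - (- \<i> * eta \<mu> \<nu>) *\<^sub>C 1 \<in> weyl_relations"
    unfolding weyl_relations_def by blast
  from weyl_relation_zero[OF this]
  have "weyl_gen_of (Mom \<mu>) * weyl_gen_of (Pos \<nu>) - weyl_gen_of (Pos \<nu>) * weyl_gen_of (Mom \<mu>) = (- \<i> * eta \<mu> \<nu>) *\<^sub>C 1"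
    by (simp only: commutator_def right_minus_eq
        flip: weyl_gen_of.abs_eq times_weyl.abs_eq minus_weyl.abs_eq cscale_weyl.abs_eq one_weyl.abs_eq)
  then show "weyl_gen_of (Mom \<mu>) * weyl_gen_of (Pos \<nu>) =
      weyl_gen_of (Pos \<nu>) * weyl_gen_of (Mom \<mu>) + (- \<i> * eta \<mu> \<nu>) *\<^sub>C 1"
    by (simp add: algebra_simps)
  have "commutator (gen (Pos \<mu>)) (gen (Pos \<nu>)) \<in> weyl_relations"
    unfolding weyl_relations_def by blast
  from weyl_relation_zero[OF this]
  show "weyl_gen_of (Pos \<mu>) * weyl_gen_of (Pos \<nu>) = weyl_gen_of (Pos \<nu>) * weyl_gen_of (Pos \<mu>)"
    by (simp only: commutator_def right_minus_eq
        flip: weyl_gen_of.abs_eq times_weyl.abs_eq minus_weyl.abs_eq)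
  have "commutator (gen (Mom \<mu>)) (gen (Mom \<nu>)) \<in> weyl_relations"
    unfolding weyl_relations_def by blast
  from weyl_relation_zero[OF this]
  show "weyl_gen_of (Mom \<mu>) * weyl_gen_of (Mom \<nu>) = weyl_gen_of (Mom \<nu>) * weyl_gen_of (Mom \<mu>)"
    by (simp only: commutator_def right_minus_eq
        flip: weyl_gen_of.abs_eq times_weyl.abs_eq minus_weyl.abs_eq)
qed

lemma weyl_induct:
  assumes one: "Q 1"
    and add: "\<And>a b. Q a \<Longrightarrow> Q b \<Longrightarrow> Q (a + b)"
    and scale: "\<And>c a. Q a \<Longrightarrow> Q (c *\<^sub>C a)"
    and gen: "\<And>g a. Q a \<Longrightarrow> Q (weyl_gen_of g * a)"
  shows "Q z"
proof -
  have word: "Q (abs_weyl (Poly_Mapping.single (Word w) 1))" for w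
  proof (induction w)
    case Nil
    show ?case using one by (simp add: one_weyl.abs_eq flip: zero_free_monoid_def)
  next
    case (Cons g w)
    have "Poly_Mapping.single (Word (g # w)) 1 = gen g * Poly_Mapping.single (Word w) 1"
      by (simp add: gen_def mult_single)
    then show ?case
      using gen[OF Cons, of g] by (simp add: weyl_gen_of.abs_eq times_weyl.abs_eq)
  qed
  have "Q (abs_weyl v)" for v
  proof (induction v rule: poly_mapping_induct_add)
    case (1 k c)
    obtain w where k: "k = Word w" by (cases k)
    have "Poly_Mapping.single k c = c *\<^sub>C Poly_Mapping.single (Word w) 1"
      by (simp add: k cscale_poly_mapping_def mult_single cscale_complex_def)
    then show ?case using scale[OF word] by (simp add: cscale_weyl.abs_eq)
  next
    case (2 u v)
    then show ?case using add by (simp flip: plus_weyl.abs_eq)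
  qed
  then show ?thesis using abs_weyl_surj by metis
qed

text \<open>The argument \<open>v\<close> is meant to be \<open>Pos\<close> or \<open>Mom\<close>,
  so that one lemma serves both commuting families.\<close>

definition weyl_power :: "(4 \<Rightarrow> weyl_gen) \<Rightarrow> (4 \<Rightarrow>\<^sub>0 nat) \<Rightarrow> weyl"
  where "weyl_power v \<alpha> = weyl_gen_of (v 0) ^ Poly_Mapping.lookup \<alpha> 0 *
    weyl_gen_of (v 1) ^ Poly_Mapping.lookup \<alpha> 1 *
    weyl_gen_of (v 2) ^ Poly_Mapping.lookup \<alpha> 2 *
    weyl_gen_of (v 3) ^ Poly_Mapping.lookup \<alpha> 3"

lemma commute_power_left:
  assumes "x * y = y * (x::'a::monoid_mult)"
  shows "x * y ^ n = y ^ n * x"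
  using power_commute[of y x n] assms by simp

lemma weyl_power_mult_gen:
  assumes c: "\<And>\<mu> \<nu>. weyl_gen_of (v \<mu>) * weyl_gen_of (v \<nu>) = weyl_gen_of (v \<nu>) * weyl_gen_of (v \<mu>)"
  shows "weyl_gen_of (v \<mu>) * weyl_power v \<alpha> = weyl_power v (Poly_Mapping.single \<mu> 1 + \<alpha>)"
proof -
  note c1 = commute_power_left[OF c]
  have c2: "weyl_gen_of (v \<mu>) * (weyl_gen_of (v \<nu>) ^ n * z) = weyl_gen_of (v \<nu>) ^ n * (weyl_gen_of (v \<mu>) * z)"
    for \<mu> \<nu> n z
    unfolding mult.assoc[symmetric] c1 ..
  have "\<mu> = 0 \<or> \<mu> = 1 \<or> \<mu> = 2 \<or> \<mu> = 3" by (rule index_cases)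
  then show ?thesis
    unfolding weyl_power_def lookup_add
    by (elim disjE) (simp_all add: lookup_single mult.assoc c2[of 1 0] c2[of 2 0] c2[of 2 1]
      c2[of 3 0] c2[of 3 1] c2[of 3 2])
qed

lemma weyl_power_zero: "weyl_power v 0 = 1"
  by (simp add: weyl_power_def)

inductive_set weyl_span :: "weyl set \<Rightarrow> weyl set" for B
  where
    zero: "0 \<in> weyl_span B"
  | step: "b \<in> B \<Longrightarrow> x \<in> weyl_span B \<Longrightarrow> c *\<^sub>C b + x \<in> weyl_span B"

lemma weyl_span_add: "x \<in> weyl_span B \<Longrightarrow> y \<in> weyl_span B \<Longrightarrow> x + y \<in> weyl_span B"
  by (induction rule: weyl_span.induct) (auto simp: add.assoc intro: weyl_span.intros)

lemma weyl_span_base: "b \<in> B \<Longrightarrow> b \<in> weyl_span B"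
  using weyl_span.step[of b B 0 1] by (simp add: cscale_one weyl_span.zero)

lemma weyl_span_scale: "x \<in> weyl_span B \<Longrightarrow> c *\<^sub>C x \<in> weyl_span B"
  by (induction rule: weyl_span.induct)
    (auto simp: cscale_zero_right cscale_add_right cscale_cscale intro: weyl_span.intros)

lemma weyl_span_linear_image:
  assumes "\<And>b. b \<in> B \<Longrightarrow> F b \<in> weyl_span C" and "F 0 = 0"
    and "\<And>c b x. F (c *\<^sub>C b + x) = c *\<^sub>C F b + F x" and "x \<in> weyl_span B"
  shows "F x \<in> weyl_span C"
  using assms(4) by (induction rule: weyl_span.induct)
    (use assms(1-3) in \<open>auto simp: weyl_span.zero intro: weyl_span_add weyl_span_scale\<close>)

abbreviation "pos_monomials \<equiv> range (weyl_power Pos)"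
abbreviation "ordered_monomials \<equiv> range (\<lambda>(\<alpha>, \<beta>). weyl_power Pos \<alpha> * weyl_power Mom \<beta>)"

lemma poly_mapping_nat_induct:
  fixes \<alpha> :: "4 \<Rightarrow>\<^sub>0 nat"
  assumes zero: "Q 0" and add: "\<And>\<mu> \<beta>. Q \<beta> \<Longrightarrow> Q (Poly_Mapping.single \<mu> 1 + \<beta>)"
  shows "Q \<alpha>"
proof -
  have sum: "Q (Poly_Mapping.single \<mu> n + \<beta>)" if "Q \<beta>" for \<mu> n \<beta>
  proof (induction n)
    case (Suc n)
    have "Poly_Mapping.single \<mu> (Suc n) = Poly_Mapping.single \<mu> 1 + Poly_Mapping.single \<mu> n"
      by (simp flip: single_add)
    then show ?case using add[OF Suc, of \<mu>] by (simp add: add.assoc)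
  qed (use that in simp)
  have "Q (\<alpha> + \<beta>)" if "Q \<beta>" for \<beta>
    using that by (induction \<alpha> arbitrary: \<beta> rule: poly_mapping_induct_add) (auto simp: sum add.assoc)
  from this[OF zero] show ?thesis by simp
qed

text \<open>Commutation with a momentum is a derivation that turns coordinates into scalars, so it
  never creates a momentum.\<close>

lemma weyl_mom_commutator_pos:
  "weyl_gen_of (Mom \<mu>) * weyl_power Pos \<alpha> - weyl_power Pos \<alpha> * weyl_gen_of (Mom \<mu>) \<in> weyl_span pos_monomials"
proof (induction \<alpha> rule: poly_mapping_nat_induct)
  case 1
  show ?case by (simp add: weyl_power_zero weyl_span.zero)
next
  case (2 \<nu> \<alpha>)
  let ?p = "weyl_gen_of (Mom \<mu>)" and ?x = "weyl_gen_of (Pos \<nu>)" and ?m = "weyl_power Pos \<alpha>"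
  have m: "weyl_power Pos (Poly_Mapping.single \<nu> 1 + \<alpha>) = ?x * ?m"
    by (rule weyl_power_mult_gen[symmetric]) (rule weyl_commutators)
  have "?p * (?x * ?m) - ?x * ?m * ?p = (- \<i> * eta \<mu> \<nu>) *\<^sub>C ?m + ?x * (?p * ?m - ?m * ?p)"
    unfolding mult.assoc[symmetric] weyl_commutators(1)
    by (simp add: algebra_simps cscale_mult_left)
  moreover have "?x * (?p * ?m - ?m * ?p) \<in> weyl_span pos_monomials"
  proof (rule weyl_span_linear_image[OF _ _ _ 2])
    fix b assume "b \<in> pos_monomials"
    then show "?x * b \<in> weyl_span pos_monomials"
      by (auto simp: weyl_power_mult_gen[of Pos, OF weyl_commutators(2)] intro: weyl_span_base)
  qed (auto simp: algebra_simps cscale_mult_right)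
  ultimately show ?case
    unfolding m by (simp add: weyl_span.step)
qed

text \<open>A coordinate multiplied from the left is absorbed by the coordinate part. A momentum is
  moved past that part, and the commutator that appears contains coordinates only.\<close>

lemma ordered_monomials_span: "z \<in> weyl_span ordered_monomials"
proof (induction z rule: weyl_induct)
  case 1
  have "1 = (\<lambda>(\<alpha>, \<beta>). weyl_power Pos \<alpha> * weyl_power Mom \<beta>) (0, 0)"
    by (simp add: weyl_power_zero)
  then show ?case by (metis rangeI weyl_span_base)
next
  case (4 g a)
  show ?case
  proof (rule weyl_span_linear_image[OF _ _ _ 4])
    fix b assume "b \<in> ordered_monomials"
    then obtain \<alpha> \<beta> where b: "b = weyl_power Pos \<alpha> * weyl_power Mom \<beta>" by auto
    have base: "weyl_power Pos \<alpha> * weyl_power Mom \<beta> \<in> weyl_span ordered_monomials" for \<alpha> \<beta>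
      by (rule weyl_span_base) (auto intro: image_eqI[of _ _ "(\<alpha>, \<beta>)"])
    show "weyl_gen_of g * b \<in> weyl_span ordered_monomials"
    proof (cases g)
      case (Pos \<mu>)
      then show ?thesis
        by (simp add: b base weyl_power_mult_gen[of Pos, OF weyl_commutators(2)] flip: mult.assoc)
    next
      case (Mom \<mu>)
      let ?m = "weyl_power Pos \<alpha>" and ?p = "weyl_gen_of (Mom \<mu>)" and ?n = "weyl_power Mom \<beta>"
      have "weyl_gen_of g * b = (?p * ?m - ?m * ?p) * ?n + ?m * (?p * ?n)"
        by (simp add: Mom b algebra_simps)
      moreover have "(?p * ?m - ?m * ?p) * ?n \<in> weyl_span ordered_monomials"
        by (rule weyl_span_linear_image[OF _ _ _ weyl_mom_commutator_pos])
          (auto simp: base algebra_simps cscale_mult_left)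
      moreover have "?m * (?p * ?n) \<in> weyl_span ordered_monomials"
        by (simp add: base weyl_power_mult_gen[of Mom, OF weyl_commutators(3)])
      ultimately show ?thesis by (simp add: weyl_span_add)
    qed
  qed (auto simp: algebra_simps cscale_mult_right)
qed (auto intro: weyl_span_add weyl_span_scale)

section \<open>Independence of the ordered monomials\<close>

lemma weyl_free_rep_ideal: "a \<in> weyl_ideal \<Longrightarrow> weyl_free_rep a f = (\<lambda>\<alpha>. 0)"
  unfolding weyl_ideal_def
proof (induction arbitrary: f rule: two_sided_ideal.induct)
  case zero
  show ?case by (simp add: weyl_free_rep_def)
next
  case (step r x a b)
  then show ?case
    by (simp add: weyl_free_rep_add weyl_free_rep_mult weyl_free_rep_relation weyl_free_rep_zero_right)
qed

lift_definition weyl_rep :: "weyl \<Rightarrow> ((4 \<Rightarrow> nat) \<Rightarrow> complex) \<Rightarrow> (4 \<Rightarrow> nat) \<Rightarrow> complex"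
  is weyl_free_rep
proof -
  fix a b assume "ideal_rel weyl_ideal a b"
  then have "weyl_free_rep (a - b) f \<gamma> = 0" for f \<gamma>
    by (simp add: ideal_rel_def weyl_free_rep_ideal)
  then show "weyl_free_rep a = weyl_free_rep b"
    by (simp add: fun_eq_iff weyl_free_rep_minus)
qed

lemma weyl_rep_add: "weyl_rep (a + b) f \<gamma> = weyl_rep a f \<gamma> + weyl_rep b f \<gamma>"
  by transfer (simp add: weyl_free_rep_add)

lemma weyl_rep_mult: "weyl_rep (a * b) f = weyl_rep a (weyl_rep b f)"
  by transfer (rule weyl_free_rep_mult)

lemma weyl_rep_one: "weyl_rep 1 f = f"
  by transfer (use weyl_free_rep_const[of 1] in \<open>simp add: fun_eq_iff cscale_one\<close>)

lemma weyl_rep_scale: "weyl_rep (c *\<^sub>C a) f \<gamma> = c * weyl_rep a f \<gamma>"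
proof transfer
  fix c a f \<gamma>
  have "c *\<^sub>C a = (c *\<^sub>C 1) * (a :: weyl_gen free_algebra)" by (rule cscale_conv_mult)
  then show "weyl_free_rep (c *\<^sub>C a) f \<gamma> = c * weyl_free_rep a f \<gamma>"
    by (simp add: weyl_free_rep_mult weyl_free_rep_const)
qed

lemma weyl_rep_gen: "weyl_rep (weyl_gen_of g) = weyl_gen_rep g"
  by transfer (simp add: fun_eq_iff weyl_free_rep_gen)

lemma weyl_rep_pos_power:
  "weyl_rep (weyl_gen_of (Pos \<nu>) ^ n) f \<gamma> = (if n \<le> \<gamma> \<nu> then f (\<gamma>(\<nu> := \<gamma> \<nu> - n)) else 0)"
  by (induction n arbitrary: \<gamma>)
    (auto simp: weyl_rep_one weyl_rep_mult weyl_rep_gen Suc_le_eq)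

text \<open>The constant is (-i eta)^n (m+1)...(m+n). What matters is that it does not vanish and
  that it depends on the exponent in direction \<nu> alone, so that powers in different directions
  do not interfere.\<close>

lemma weyl_rep_mom_power:
  "\<exists>C. (\<forall>m. C m \<noteq> 0) \<and> (\<forall>f \<gamma>. weyl_rep (weyl_gen_of (Mom \<nu>) ^ n) f \<gamma> = C (\<gamma> \<nu>) * f (\<gamma>(\<nu> := \<gamma> \<nu> + n)))"
proof (induction n)
  case 0
  show ?case by (intro exI[of _ "\<lambda>_. 1"]) (simp add: weyl_rep_one)
next
  case (Suc n)
  then obtain C where C: "\<And>m. C m \<noteq> 0"
    "\<And>f \<gamma>. weyl_rep (weyl_gen_of (Mom \<nu>) ^ n) f \<gamma> = C (\<gamma> \<nu>) * f (\<gamma>(\<nu> := \<gamma> \<nu> + n))"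
    by blast
  show ?case
  proof (intro exI[of _ "\<lambda>m. - \<i> * eta \<nu> \<nu> * of_nat (m + 1) * C (m + 1)"] conjI allI)
    fix m show "- \<i> * eta \<nu> \<nu> * of_nat (m + 1) * C (m + 1) \<noteq> 0"
      using C(1) by (simp add: eta_def del: of_nat_Suc of_nat_add)
  next
    fix f \<gamma>
    show "weyl_rep (weyl_gen_of (Mom \<nu>) ^ Suc n) f \<gamma> =
      - \<i> * eta \<nu> \<nu> * of_nat (\<gamma> \<nu> + 1) * C (\<gamma> \<nu> + 1) * f (\<gamma>(\<nu> := \<gamma> \<nu> + Suc n))"
      by (simp add: weyl_rep_mult weyl_rep_gen C(2))
  qed
qed

lemma fun4_eqI:
  fixes \<gamma> \<delta> :: "4 \<Rightarrow> 'a"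
  assumes "\<gamma> 0 = \<delta> 0" "\<gamma> 1 = \<delta> 1" "\<gamma> 2 = \<delta> 2" "\<gamma> 3 = \<delta> 3"
  shows "\<gamma> = \<delta>"
proof
  fix \<mu> show "\<gamma> \<mu> = \<delta> \<mu>" using index_cases[of \<mu>] assms by auto
qed

lemma weyl_rep_pos_monomial:
  "weyl_rep (weyl_power Pos \<alpha>) f \<gamma> =
    (if \<forall>\<nu>. Poly_Mapping.lookup \<alpha> \<nu> \<le> \<gamma> \<nu> then f (\<lambda>\<nu>. \<gamma> \<nu> - Poly_Mapping.lookup \<alpha> \<nu>) else 0)"
proof -
  have all: "(\<forall>\<nu>. Q \<nu>) \<longleftrightarrow> Q 0 \<and> Q 1 \<and> Q 2 \<and> Q 3" for Q :: "4 \<Rightarrow> bool"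
    using index_cases by metis
  show ?thesis
    unfolding weyl_power_def weyl_rep_mult weyl_rep_pos_power all
    by (auto intro!: arg_cong[of _ _ f] fun4_eqI)
qed

lemma weyl_rep_mom_monomial:
  "\<exists>c. c \<noteq> 0 \<and> (\<forall>f. weyl_rep (weyl_power Mom \<beta>) f \<gamma> = c * f (\<lambda>\<nu>. \<gamma> \<nu> + Poly_Mapping.lookup \<beta> \<nu>))"
proof -
  obtain C where C: "\<And>\<nu> n m. C \<nu> n m \<noteq> 0"
    "\<And>\<nu> n f \<gamma>. weyl_rep (weyl_gen_of (Mom \<nu>) ^ n) f \<gamma> = C \<nu> n (\<gamma> \<nu>) * f (\<gamma>(\<nu> := \<gamma> \<nu> + n))"
    using weyl_rep_mom_power by metis
  let ?b = "Poly_Mapping.lookup \<beta>"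
  have upd: "\<gamma>(0 := \<gamma> 0 + ?b 0, 1 := \<gamma> 1 + ?b 1, 2 := \<gamma> 2 + ?b 2, 3 := \<gamma> 3 + ?b 3) =
      (\<lambda>\<nu>. \<gamma> \<nu> + ?b \<nu>)"
    by (rule fun4_eqI) simp_all
  show ?thesis
    by (intro exI[of _ "C 0 (?b 0) (\<gamma> 0) * C 1 (?b 1) (\<gamma> 1) * C 2 (?b 2) (\<gamma> 2) * C 3 (?b 3) (\<gamma> 3)"] conjI allI)
      (simp_all add: C weyl_power_def weyl_rep_mult flip: upd)
qed

text \<open>The coefficient of \<open>x\<^sup>\<alpha>\<close> in the value at \<open>x\<^sup>\<beta>\<close> of a normally ordered operator isolates the
  coefficient of \<open>x\<^sup>\<alpha> p\<^sup>\<beta>\<close>, provided that \<open>p\<^sup>\<beta>\<close> is of lowest order in the momenta.\<close>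

lemma weyl_rep_ordered_monomial:
  assumes "\<forall>\<nu>. Poly_Mapping.lookup \<beta>' \<nu> \<le> Poly_Mapping.lookup \<beta> \<nu> \<Longrightarrow> \<beta>' = \<beta>"
  shows "weyl_rep (weyl_power Pos \<alpha>' * weyl_power Mom \<beta>')
      (\<lambda>\<gamma>. if \<gamma> = Poly_Mapping.lookup \<beta> then 1 else 0) (Poly_Mapping.lookup \<alpha>) \<noteq> 0 \<longleftrightarrow> \<alpha>' = \<alpha> \<and> \<beta>' = \<beta>"
proof -
  let ?l = Poly_Mapping.lookup
  let ?\<gamma> = "\<lambda>\<nu>. ?l \<alpha> \<nu> - ?l \<alpha>' \<nu>"
  obtain c where c: "c \<noteq> 0" "\<And>f. weyl_rep (weyl_power Mom \<beta>') f ?\<gamma> = c * f (\<lambda>\<nu>. ?\<gamma> \<nu> + ?l \<beta>' \<nu>)"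
    using weyl_rep_mom_monomial[of \<beta>' ?\<gamma>] by blast
  have "weyl_rep (weyl_power Pos \<alpha>' * weyl_power Mom \<beta>') (\<lambda>\<gamma>. if \<gamma> = ?l \<beta> then 1 else 0) (?l \<alpha>) \<noteq> 0 \<longleftrightarrow>
      (\<forall>\<nu>. ?l \<alpha>' \<nu> \<le> ?l \<alpha> \<nu>) \<and> (\<forall>\<nu>. ?\<gamma> \<nu> + ?l \<beta>' \<nu> = ?l \<beta> \<nu>)"
    by (simp add: weyl_rep_mult weyl_rep_pos_monomial c fun_eq_iff)
  also have "\<dots> \<longleftrightarrow> \<alpha>' = \<alpha> \<and> \<beta>' = \<beta>"
  proof (intro iffI; elim conjE)
    assume le: "\<forall>\<nu>. ?l \<alpha>' \<nu> \<le> ?l \<alpha> \<nu>" and eq: "\<forall>\<nu>. ?\<gamma> \<nu> + ?l \<beta>' \<nu> = ?l \<beta> \<nu>"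
    from eq have "\<forall>\<nu>. ?l \<beta>' \<nu> \<le> ?l \<beta> \<nu>" by (metis le_add2)
    with assms have \<beta>: "\<beta>' = \<beta>" by blast
    with eq have "\<forall>\<nu>. ?\<gamma> \<nu> = 0" by simp
    then have "\<forall>\<nu>. ?l \<alpha>' \<nu> = ?l \<alpha> \<nu>" using le by (metis diff_is_0_eq le_antisym)
    then show "\<alpha>' = \<alpha> \<and> \<beta>' = \<beta>" using \<beta> by (simp add: poly_mapping_eqI)
  qed auto
  finally show ?thesis .
qed

text \<open>Among the pairs with nonzero coefficient one is chosen whose momentum exponent has least
  total degree. No other momentum exponent that occurs lies componentwise below it, so the matrix
  coefficient of \<open>weyl_rep_ordered_monomial\<close> detects this pair and no other.\<close>

lemma ordered_monomials_independent:
  assumes "finite K" and zero: "(\<Sum>k\<in>K. c k *\<^sub>C (weyl_power Pos (fst k) * weyl_power Mom (snd k))) = 0"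
    and "k \<in> K"
  shows "c k = 0"
proof (rule ccontr)
  assume "c k \<noteq> 0"
  define deg where "deg \<beta> = (\<Sum>\<nu>\<in>UNIV. Poly_Mapping.lookup \<beta> \<nu>)" for \<beta> :: "4 \<Rightarrow>\<^sub>0 nat"
  define K' where "K' = {k\<in>K. c k \<noteq> 0}"
  define l where "l = arg_min_on (\<lambda>k. deg (snd k)) K'"
  have "k \<in> K'" "finite K'" using assms(1,3) \<open>c k \<noteq> 0\<close> by (simp_all add: K'_def)
  then have K': "finite K'" "K' \<noteq> {}" by blast+
  have l: "l \<in> K'" unfolding l_def by (rule arg_min_if_finite(1)[OF K'])
  have min: "deg (snd l) \<le> deg (snd k)" if "k \<in> K'" for k
    unfolding l_def using arg_min_least[OF K' that] .
  define \<alpha> \<beta> where "\<alpha> = fst l" and "\<beta> = snd l"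
  let ?f = "\<lambda>\<gamma>. if \<gamma> = Poly_Mapping.lookup \<beta> then 1 else 0"
  let ?r = "\<lambda>k. weyl_rep (weyl_power Pos (fst k) * weyl_power Mom (snd k)) ?f (Poly_Mapping.lookup \<alpha>)"
  have r: "?r k \<noteq> 0 \<longleftrightarrow> k = l" if "k \<in> K'" for k
  proof -
    have "snd k = \<beta>" if "\<forall>\<nu>. Poly_Mapping.lookup (snd k) \<nu> \<le> Poly_Mapping.lookup \<beta> \<nu>"
    proof (rule ccontr)
      assume "snd k \<noteq> \<beta>"
      then obtain \<nu> where "Poly_Mapping.lookup (snd k) \<nu> \<noteq> Poly_Mapping.lookup \<beta> \<nu>"
        by (metis poly_mapping_eqI)
      then have "deg (snd k) < deg \<beta>"
        unfolding deg_def using \<open>\<forall>\<nu>. _\<close> by (intro sum_strict_mono_ex1) (auto intro!: exI[of _ \<nu>] simp: le_neq_implies_less)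
      with min[OF \<open>k \<in> K'\<close>] show False by (simp add: \<beta>_def)
    qed
    then show ?thesis
      using weyl_rep_ordered_monomial[of "snd k" \<beta> "fst k" \<alpha>] by (auto simp: \<alpha>_def \<beta>_def prod_eq_iff)
  qed
  have rep_sum: "weyl_rep (\<Sum>k\<in>A. c k *\<^sub>C (weyl_power Pos (fst k) * weyl_power Mom (snd k))) ?f (Poly_Mapping.lookup \<alpha>)
      = (\<Sum>k\<in>A. c k * ?r k)" if "finite A" for A
    using that
  proof (induction A rule: finite_induct)
    case empty
    show ?case using weyl_rep_scale[of 0 0] by (simp add: cscale_zero_left)
  next
    case (insert k A)
    then show ?case by (simp add: weyl_rep_add weyl_rep_scale)
  qed
  have "0 = (\<Sum>k\<in>K. c k * ?r k)"
    using rep_sum[OF assms(1)] weyl_rep_scale[of 0 0] by (simp add: zero cscale_zero_left)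
  also have "\<dots> = (\<Sum>k\<in>{l}. c k * ?r k)"
    using assms(1) l r by (intro sum.mono_neutral_right) (auto simp: K'_def)
  also have "\<dots> \<noteq> 0" using l r[OF l] by (simp add: K'_def)
  finally show False by simp
qed

section \<open>The realization\<close>

lemma hscale_minus_left: "(- c) *\<^sub>h x = - (c *\<^sub>h (x :: 'a::hadic_algebra))"
  using hscale_add_left[of c "- c" x] by (simp add: hscale_zero_left eq_neg_iff_add_eq_0 add.commute)

lemma hscale_const_minus: "fps_const (- c) *\<^sub>h x = - (fps_const c *\<^sub>h (x :: 'a::hadic_algebra))"
  by (simp flip: fps_const_neg add: hscale_minus_left)

definition pos :: "4 \<Rightarrow> weyl fps"
  where "pos \<mu> = fps_const (weyl_gen_of (Pos \<mu>))"

definition mom :: "4 \<Rightarrow> weyl fps"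
  where "mom \<mu> = fps_const (weyl_gen_of (Mom \<mu>))"

lemma mom_pos: "mom \<mu> * pos \<nu> = pos \<nu> * mom \<mu> + fps_const (- \<i> * eta \<mu> \<nu>) *\<^sub>h 1"
proof -
  have "fps_const (- \<i> * eta \<mu> \<nu>) *\<^sub>h (1 :: weyl fps) = fps_const ((- \<i> * eta \<mu> \<nu>) *\<^sub>C 1)"
    by (simp only: fps_const_cscale fps_const_1_eq_1)
  then show ?thesis
    by (simp only: mom_def pos_def fps_const_mult fps_const_add weyl_commutators(1))
qed

lemma pos_commute: "pos \<mu> * pos \<nu> = pos \<nu> * pos \<mu>"
  by (simp add: pos_def weyl_commutators(2))

lemma mom_commute: "mom \<mu> * mom \<nu> = mom \<nu> * mom \<mu>"
  by (simp add: mom_def weyl_commutators(3))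

lemma hadic_homD:
  assumes "hadic_hom F"
  shows "F (x + y) = F x + F y" "F (x - y) = F x - F y" "F (- x) = - F x" "F (x * y) = F x * F y"
    "F (c *\<^sub>h x) = c *\<^sub>h F x" "F 1 = 1" "F 0 = 0" "hlinear F"
  using assms by (auto simp: hadic_hom_def hlinear_add hlinear_diff hlinear_minus hlinear_hscale hlinear_zero)

definition mom_embed :: "momenta \<Rightarrow> weyl fps"
  where "mom_embed = momenta_hom mom"

lemma mom_embed_hom: "hadic_hom mom_embed" and mom_embed_P_low: "mom_embed (P_low \<mu>) = mom \<mu>"
  using theI'[OF momenta_hom_ex1[of mom, OF mom_commute]]
  unfolding mom_embed_def momenta_hom_def by blast+

lemmas mom_embed_simps = hadic_homD(1-7)[OF mom_embed_hom] mom_embed_P_low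

lemma mom_embed_mult: "mom_embed f * mom_embed g = mom_embed (f * g)"
  by (simp add: mom_embed_simps)

lemma mom_embed_commute: "mom_embed f * mom_embed g = mom_embed g * mom_embed f"
  by (simp add: mom_embed_mult mult.commute)

lemma momenta_hlinear_unique:
  fixes F G :: "momenta \<Rightarrow> 'a::hadic_algebra"
  assumes "hlinear F" "hlinear G" and "\<And>\<alpha>. F (mono_val P_low \<alpha>) = G (mono_val P_low \<alpha>)"
  shows "F f = G f"
  by (rule fun_cong[OF hlinear_unique[OF assms(1,2)]]) (simp add: momenta_mono assms(3))

text \<open>Applied below to the commutator of the square root S with a coordinate: that it commutes
  with the generators can be seen directly, but it has to commute with S itself.\<close>

lemma commute_mom_embed:
  assumes "\<And>\<nu>. a * mom \<nu> = mom \<nu> * a"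
  shows "a * mom_embed f = mom_embed f * a"
proof (rule momenta_hlinear_unique)
  show "hlinear (\<lambda>f. a * mom_embed f)" "hlinear (\<lambda>f. mom_embed f * a)"
    by (rule hlinear_right hlinear_left, rule hadic_homD(8)[OF mom_embed_hom])+
next
  fix \<alpha>
  have c: "a * mom \<nu> ^ n = mom \<nu> ^ n * a" for \<nu> n
    by (rule commute_power_left) (rule assms)
  have c': "a * (mom \<nu> ^ n * z) = mom \<nu> ^ n * (a * z)" for \<nu> n z
    by (simp only: c flip: mult.assoc)
  show "a * mom_embed (mono_val P_low \<alpha>) = mom_embed (mono_val P_low \<alpha>) * a"
    by (simp add: mono_val_def mom_embed_simps hom_power[OF mom_embed_hom] mult.assoc c c')
qed

text \<open>This says [f, x_\<mu>] = f', where f' is -i times the derivative of f with respect to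
  P^\<mu>. A relation in place of a function avoids constructing that derivation on all power
  series; the values are found for the few elements that occur.\<close>

definition pos_deriv :: "4 \<Rightarrow> momenta \<Rightarrow> momenta \<Rightarrow> bool"
  where "pos_deriv \<mu> f f' \<longleftrightarrow> mom_embed f * pos \<mu> = pos \<mu> * mom_embed f + mom_embed f'"

lemma pos_deriv_P_low: "pos_deriv \<mu> (P_low \<nu>) (fps_const (- \<i> * eta \<nu> \<mu>) *\<^sub>h 1)"
  unfolding pos_deriv_def mom_embed_simps by (rule mom_pos)

lemma pos_deriv_one: "pos_deriv \<mu> 1 0"
  by (simp add: pos_deriv_def mom_embed_simps)

lemma pos_deriv_add: "pos_deriv \<mu> f f' \<Longrightarrow> pos_deriv \<mu> g g' \<Longrightarrow> pos_deriv \<mu> (f + g) (f' + g')"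
  by (simp add: pos_deriv_def mom_embed_simps algebra_simps)

lemma pos_deriv_diff: "pos_deriv \<mu> f f' \<Longrightarrow> pos_deriv \<mu> g g' \<Longrightarrow> pos_deriv \<mu> (f - g) (f' - g')"
  by (simp add: pos_deriv_def mom_embed_simps algebra_simps)

lemma pos_deriv_hscale: "pos_deriv \<mu> f f' \<Longrightarrow> pos_deriv \<mu> (c *\<^sub>h f) (c *\<^sub>h f')"
  by (simp add: pos_deriv_def mom_embed_simps hscale_mult_left hscale_mult_right hscale_add_right)

lemma pos_deriv_mult:
  assumes "pos_deriv \<mu> f f'" "pos_deriv \<mu> g g'"
  shows "pos_deriv \<mu> (f * g) (f' * g + f * g')"
proof -
  have "mom_embed f * mom_embed g * pos \<mu> = mom_embed f * pos \<mu> * mom_embed g + mom_embed f * mom_embed g'"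
    using assms(2) by (simp add: pos_deriv_def mult.assoc distrib_left)
  also have "\<dots> = pos \<mu> * (mom_embed f * mom_embed g) + mom_embed (f' * g + f * g')"
    using assms(1) by (simp only: pos_deriv_def mom_embed_simps distrib_right mult.assoc add.assoc)
  finally show ?thesis by (simp add: pos_deriv_def mom_embed_simps)
qed

text \<open>The derivative -2i P_\<mu> is written as a sum of two equal terms, the form that
  \<open>hscale_double_cancel\<close> halves.\<close>

lemma pos_deriv_P_squared:
  "pos_deriv \<mu> (fps_const P_squared) (- (fps_const \<i> *\<^sub>h P_low \<mu> + fps_const \<i> *\<^sub>h P_low \<mu>))"
proof -
  have sq: "fps_const P_squared =
      P_low 1 * P_low 1 + (P_low 2 * P_low 2 + P_low 3 * P_low 3) - P_low 0 * P_low 0"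
    by (simp add: P_squared_def P_low_def power2_eq_square)
  let ?d = "\<lambda>\<nu>. fps_const (- \<i> * eta \<nu> \<mu>) *\<^sub>h 1 :: momenta"
  have "pos_deriv \<mu> (fps_const P_squared)
     ((?d 1 * P_low 1 + P_low 1 * ?d 1) + ((?d 2 * P_low 2 + P_low 2 * ?d 2) + (?d 3 * P_low 3 + P_low 3 * ?d 3))
       - (?d 0 * P_low 0 + P_low 0 * ?d 0))"
    unfolding sq by (intro pos_deriv_add pos_deriv_diff pos_deriv_mult pos_deriv_P_low)
  also have "(?d 1 * P_low 1 + P_low 1 * ?d 1) + ((?d 2 * P_low 2 + P_low 2 * ?d 2) + (?d 3 * P_low 3 + P_low 3 * ?d 3))
       - (?d 0 * P_low 0 + P_low 0 * ?d 0) = - (fps_const \<i> *\<^sub>h P_low \<mu> + fps_const \<i> *\<^sub>h P_low \<mu>)"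
  proof -
    consider "\<mu> = 0" | "\<mu> = 1" | "\<mu> = 2" | "\<mu> = 3" using index_cases by blast
    then show ?thesis
      by cases (simp_all add: eta_def hscale_mult_left hscale_mult_right hscale_zero_left hscale_const_minus hscale_minus_right)
  qed
  finally show ?thesis .
qed

section \<open>The square root S and Xi under commutation with the coordinates\<close>

definition P_root_inv :: momenta
  where "P_root_inv = fps_right_inverse P_root 1"

lemma P_root_inverse: "P_root * P_root_inv = 1" "P_root_inv * P_root = 1"
proof -
  show "P_root * P_root_inv = 1"
    unfolding P_root_inv_def by (rule fps_right_inverse) (simp add: P_root_def cscale_one)
  then show "P_root_inv * P_root = 1" by (simp add: mult.commute)
qed

lemma hscale_double_cancel:
  fixes a b :: "'a::hadic_algebra"
  assumes "a + a = b + b"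
  shows "a = b"
proof -
  have "(2 :: complex fps) *\<^sub>h a = 2 *\<^sub>h b"
    using assms by (simp only: one_add_one[symmetric] hscale_add_left hscale_one)
  then have "(fps_const (1 / 2) * 2) *\<^sub>h a = (fps_const (1 / 2) * 2) *\<^sub>h b"
    by (simp only: hscale_hscale[symmetric])
  moreover have "fps_const (1 / 2) * 2 = (1 :: complex fps)"
    by (simp add: fps_numeral_fps_const)
  ultimately show ?thesis by (simp add: hscale_one)
qed

text \<open>The equation S^2 = 1 - h^2 P^2 is differentiated, not the binomial series. By the Jacobi
  identity D = [S, x_\<mu>] commutes with every momentum, because [p, S] = 0 and [p, x_\<mu>] is a
  scalar. Hence D commutes with S, the derivative of S^2 is 2 S D = 2 i h^2 P_\<mu>, and S is
  invertible.\<close>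

lemma pos_deriv_P_root:
  "pos_deriv \<mu> P_root ((fps_const \<i> * fps_X ^ 2) *\<^sub>h (P_low \<mu> * P_root_inv))"
proof -
  let ?S = "mom_embed P_root" and ?c = "fps_const \<i> * fps_X ^ 2 :: complex fps"
  define D where "D = ?S * pos \<mu> - pos \<mu> * ?S"
  have "D * mom \<nu> = mom \<nu> * D" for \<nu>
  proof -
    have S: "?S * mom \<nu> = mom \<nu> * ?S"
      using mom_embed_commute[of P_root "P_low \<nu>"] by (simp add: mom_embed_P_low)
    have "mom \<nu> * D = ?S * (mom \<nu> * pos \<mu>) - (mom \<nu> * pos \<mu>) * ?S"
      by (simp add: D_def right_diff_distrib S flip: mult.assoc)
    also have "\<dots> = D * mom \<nu>"
      by (simp add: mom_pos D_def algebra_simps hscale_mult_left hscale_mult_right S)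
    finally show ?thesis ..
  qed
  then have comm: "D * ?S = ?S * D" by (rule commute_mom_embed)
  have "pos_deriv \<mu> (P_root * P_root) (0 - fps_X ^ 2 *\<^sub>h (- (fps_const \<i> *\<^sub>h P_low \<mu> + fps_const \<i> *\<^sub>h P_low \<mu>)))"
    unfolding P_root_square by (intro pos_deriv_diff pos_deriv_one pos_deriv_hscale pos_deriv_P_squared)
  also have "0 - fps_X ^ 2 *\<^sub>h (- (fps_const \<i> *\<^sub>h P_low \<mu> + fps_const \<i> *\<^sub>h P_low \<mu>)) =
      ?c *\<^sub>h P_low \<mu> + ?c *\<^sub>h P_low \<mu>"
    by (simp only: hscale_minus_right hscale_add_right hscale_hscale mult.commute[of "fps_X ^ 2"]) simp
  finally have "?S * ?S * pos \<mu> - pos \<mu> * (?S * ?S) = ?c *\<^sub>h mom \<mu> + ?c *\<^sub>h mom \<mu>"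
    unfolding pos_deriv_def mom_embed_simps by simp
  moreover have "?S * ?S * pos \<mu> - pos \<mu> * (?S * ?S) = ?S * D + D * ?S"
    by (simp add: D_def algebra_simps)
  ultimately have SD: "?S * D = ?c *\<^sub>h mom_embed (P_low \<mu>)"
    by (metis (no_types, lifting) hscale_double_cancel comm mom_embed_P_low)
  have "D = mom_embed (P_root_inv * P_root) * D"
    by (simp add: P_root_inverse mom_embed_simps(6))
  also have "\<dots> = mom_embed P_root_inv * (?S * D)"
    by (simp only: mult.assoc flip: mom_embed_mult)
  also have "\<dots> = mom_embed (?c *\<^sub>h (P_low \<mu> * P_root_inv))"
    unfolding SD by (simp only: hscale_mult_right mom_embed_mult mom_embed_simps(5) mult.commute[of _ P_root_inv])
  finally have "D = mom_embed (?c *\<^sub>h (P_low \<mu> * P_root_inv))" .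
  then show ?thesis by (simp add: pos_deriv_def D_def algebra_simps)
qed

lemma pos_deriv_P_low_space: "k \<noteq> 0 \<Longrightarrow> pos_deriv 0 (P_low k) 0"
  using pos_deriv_P_low[of 0 k] by (simp add: eta_def hscale_zero_left)

text \<open>The contributions i h of h P_0 and i h^2 P_0 / S of S have the common form i h (S + h
  P_0) / S = i h Xi / S.\<close>

lemma pos_deriv_Xi_time: "pos_deriv 0 Xi ((fps_const \<i> * fps_X) *\<^sub>h (Xi * P_root_inv))"
proof -
  have "pos_deriv 0 Xi (fps_X *\<^sub>h fps_const (- \<i> * eta 0 0) *\<^sub>h 1 + (fps_const \<i> * fps_X ^ 2) *\<^sub>h (P_low 0 * P_root_inv))"
    unfolding Xi_def by (intro pos_deriv_add pos_deriv_hscale pos_deriv_P_low pos_deriv_P_root)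
  also have "fps_X *\<^sub>h fps_const (- \<i> * eta 0 0) *\<^sub>h 1 + (fps_const \<i> * fps_X ^ 2) *\<^sub>h (P_low 0 * P_root_inv) =
      (fps_const \<i> * fps_X) *\<^sub>h (Xi * P_root_inv)"
    by (simp add: Xi_def eta_def algebra_simps P_root_inverse hscale_add_right hscale_hscale hscale_mult_left
        hscale_mult_right power2_eq_square)
  finally show ?thesis .
qed

lemma pos_deriv_Xi_space:
  assumes "j \<noteq> 0"
  shows "pos_deriv j Xi ((fps_const \<i> * fps_X ^ 2) *\<^sub>h (P_low j * P_root_inv))"
proof -
  have "pos_deriv j Xi (fps_X *\<^sub>h fps_const (- \<i> * eta 0 j) *\<^sub>h 1 + (fps_const \<i> * fps_X ^ 2) *\<^sub>h (P_low j * P_root_inv))"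
    unfolding Xi_def by (intro pos_deriv_add pos_deriv_hscale pos_deriv_P_low pos_deriv_P_root)
  then show ?thesis using assms by (simp add: eta_def hscale_zero_left hscale_zero_right)
qed

text \<open>The shape is dictated by the cross relations. The factor S turns [p_0, x_0] = i into i
  S, the factor Xi turns [p_k, x_j] = -i \<delta>_jk into -i \<delta>_jk Xi, and the correction -h
  x_0 p_j produces [p_0, X_j] = -i h p_j without affecting the commutators with spatial
  momenta.\<close>

definition X_real :: "4 \<Rightarrow> weyl fps"
  where "X_real \<mu> = (if \<mu> = 0 then pos 0 * mom_embed P_root
    else pos \<mu> * mom_embed Xi - fps_X *\<^sub>h (pos 0 * mom_embed (P_low \<mu>)))"

section \<open>Normal ordering of products and the kappa-Minkowski relations\<close>

lemma pos_mom_mult: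
  assumes "pos_deriv \<nu> f f'"
  shows "(pos \<mu> * mom_embed f) * (pos \<nu> * mom_embed g) =
    pos \<mu> * pos \<nu> * mom_embed (f * g) + pos \<mu> * mom_embed (f' * g)"
proof -
  have "(pos \<mu> * mom_embed f) * (pos \<nu> * mom_embed g) = pos \<mu> * (mom_embed f * pos \<nu>) * mom_embed g"
    by (simp add: mult.assoc)
  also have "\<dots> = pos \<mu> * pos \<nu> * mom_embed (f * g) + pos \<mu> * mom_embed (f' * g)"
    unfolding assms[unfolded pos_deriv_def] by (simp only: distrib_left distrib_right mult.assoc mom_embed_mult)
  finally show ?thesis .
qed

lemma mom_pos_mult:
  assumes "pos_deriv \<nu> f f'"
  shows "mom_embed f * (pos \<nu> * mom_embed g) = pos \<nu> * mom_embed g * mom_embed f + mom_embed (f' * g)"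
proof -
  have "mom_embed f * (pos \<nu> * mom_embed g) = (mom_embed f * pos \<nu>) * mom_embed g"
    by (simp add: mult.assoc)
  also have "\<dots> = pos \<nu> * mom_embed g * mom_embed f + mom_embed (f' * g)"
    unfolding assms[unfolded pos_deriv_def] by (simp only: distrib_right mult.assoc mom_embed_mult mult.commute)
  finally show ?thesis .
qed

text \<open>After normal ordering the terms quadratic in the coordinates cancel. The x_j terms give
  -i h x_j Xi, and the x_0 terms have to add up to i h^2 x_0 p_j.\<close>

lemma X_real_time_space:
  assumes j: "j \<noteq> 0"
  shows "X_real 0 * X_real j - X_real j * X_real 0 = (- (fps_const \<i> * fps_X)) *\<^sub>h X_real j"
proof -
  let ?R = P_root_inv and ?ih = "fps_const \<i> * fps_X :: complex fps" and ?ih2 = "fps_const \<i> * fps_X ^ 2 :: complex fps"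
  have 1: "X_real 0 * X_real j = pos 0 * pos j * mom_embed (P_root * Xi) + pos 0 * mom_embed (?ih2 *\<^sub>h (P_low j * ?R) * Xi)
      - fps_X *\<^sub>h (pos 0 * pos 0 * mom_embed (P_root * P_low j) + pos 0 * mom_embed (?ih2 *\<^sub>h (P_low 0 * ?R) * P_low j))"
    using j by (simp add: X_real_def right_diff_distrib hscale_mult_right pos_mom_mult[OF pos_deriv_P_root])
  have 2: "X_real j * X_real 0 = pos 0 * pos j * mom_embed (P_root * Xi) + pos j * mom_embed (?ih *\<^sub>h (Xi * ?R) * P_root)
      - fps_X *\<^sub>h (pos 0 * pos 0 * mom_embed (P_root * P_low j))"
    using j by (simp add: X_real_def left_diff_distrib hscale_mult_left pos_mom_mult[OF pos_deriv_Xi_time]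
      pos_mom_mult[OF pos_deriv_P_low_space] mom_embed_simps(7) mult.commute[of P_root] pos_commute[of j])
  have 3: "?ih *\<^sub>h (Xi * ?R) * P_root = ?ih *\<^sub>h Xi"
    by (simp add: hscale_mult_left mult.assoc P_root_inverse)
  \<comment> \<open>This is Xi - h P_0 = S, multiplied by i h^2 P_j / S.\<close>
  have 4: "?ih2 *\<^sub>h (P_low j * ?R) * Xi - fps_X *\<^sub>h (?ih2 *\<^sub>h (P_low 0 * ?R) * P_low j) = ?ih2 *\<^sub>h P_low j"
  proof -
    have "?ih2 *\<^sub>h (P_low j * ?R) * Xi = fps_X *\<^sub>h (?ih2 *\<^sub>h (P_low 0 * ?R) * P_low j) + ?ih2 *\<^sub>h (P_low j * (?R * P_root))"
      by (simp add: Xi_def distrib_left hscale_add_right hscale_mult_left hscale_mult_right hscale_hscale mult_ac)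
    then show ?thesis by (simp add: P_root_inverse)
  qed
  have "X_real 0 * X_real j - X_real j * X_real 0 =
     pos 0 * mom_embed (?ih2 *\<^sub>h (P_low j * ?R) * Xi - fps_X *\<^sub>h (?ih2 *\<^sub>h (P_low 0 * ?R) * P_low j))
     - pos j * mom_embed (?ih *\<^sub>h (Xi * ?R) * P_root)"
    unfolding 1 2 by (simp add: mom_embed_simps(2,5) hscale_add_right hscale_mult_right right_diff_distrib algebra_simps)
  also have "\<dots> = - (?ih *\<^sub>h X_real j)"
    unfolding 3 4 using j by (simp add: X_real_def mom_embed_simps(5) hscale_mult_right hscale_diff_right hscale_hscale power2_eq_square mult_ac)
  finally show ?thesis by (simp only: hscale_minus_left)
qed

text \<open>It is enough to bring one product into a form symmetric in j and k.\<close>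

lemma X_real_space_space:
  assumes j: "j \<noteq> 0" and k: "k \<noteq> 0"
  shows "X_real j * X_real k = X_real k * X_real j"
proof -
  let ?R = P_root_inv and ?ih = "fps_const \<i> * fps_X :: complex fps" and ?ih2 = "fps_const \<i> * fps_X ^ 2 :: complex fps"
  have prod: "X_real j * X_real k = pos j * pos k * mom_embed (Xi * Xi)
      - fps_X *\<^sub>h (pos j * pos 0 * mom_embed (Xi * P_low k) + pos k * pos 0 * mom_embed (Xi * P_low j))
      - fps_X *\<^sub>h (pos 0 * mom_embed ((fps_const (- \<i> * eta j k) *\<^sub>h 1) * Xi))
      + fps_X *\<^sub>h fps_X *\<^sub>h (pos 0 * pos 0 * mom_embed (P_low j * P_low k))"
    if j: "j \<noteq> 0" and k: "k \<noteq> 0" for j k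
  proof -
    have "X_real j * X_real k = (pos j * mom_embed Xi) * (pos k * mom_embed Xi)
      - fps_X *\<^sub>h ((pos j * mom_embed Xi) * (pos 0 * mom_embed (P_low k)))
      - fps_X *\<^sub>h ((pos 0 * mom_embed (P_low j)) * (pos k * mom_embed Xi))
      + fps_X *\<^sub>h fps_X *\<^sub>h ((pos 0 * mom_embed (P_low j)) * (pos 0 * mom_embed (P_low k)))"
      using j k by (simp add: X_real_def left_diff_distrib right_diff_distrib hscale_mult_left hscale_mult_right hscale_diff_right)
    also have "\<dots> = pos j * pos k * mom_embed (Xi * Xi)
      + pos j * mom_embed (?ih2 *\<^sub>h (P_low k * ?R) * Xi)
      - fps_X *\<^sub>h (pos j * pos 0 * mom_embed (Xi * P_low k) + pos j * mom_embed (?ih *\<^sub>h (Xi * ?R) * P_low k))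
      - fps_X *\<^sub>h (pos 0 * pos k * mom_embed (P_low j * Xi) + pos 0 * mom_embed ((fps_const (- \<i> * eta j k) *\<^sub>h 1) * Xi))
      + fps_X *\<^sub>h fps_X *\<^sub>h (pos 0 * pos 0 * mom_embed (P_low j * P_low k))"
      using j k
      by (simp only: pos_mom_mult[OF pos_deriv_Xi_space[OF k]] pos_mom_mult[OF pos_deriv_Xi_time] pos_mom_mult[OF pos_deriv_P_low[of k j]]
          pos_mom_mult[OF pos_deriv_P_low_space[OF j]]) (simp add: mom_embed_simps(7))
    \<comment> \<open>The two terms of first order in \<open>pos j\<close> are equal up to sign, so
      they cancel; the remaining first order term involves \<open>eta j k\<close> and is
      symmetric.\<close>
    also have "?ih2 *\<^sub>h (P_low k * ?R) * Xi = fps_X *\<^sub>h (?ih *\<^sub>h (Xi * ?R) * P_low k)"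
      by (simp add: hscale_mult_left hscale_mult_right hscale_hscale power2_eq_square mult_ac)
    finally show ?thesis
      by (simp add: mom_embed_simps(5) hscale_mult_left hscale_mult_right hscale_add_right pos_commute[of 0 k] mult.commute[of "P_low j" Xi] algebra_simps)
  qed
  have "eta j k = eta k j" by (auto simp: eta_def)
  then show ?thesis
    unfolding prod[OF j k] prod[OF k j]
    by (simp add: pos_commute[of k j] mult.commute[of "P_low k" "P_low j"] add.commute)
qed

lemma mom_X_real:
  shows "k \<noteq> 0 \<Longrightarrow> mom k * X_real 0 = X_real 0 * mom k"
    and "mom 0 * X_real 0 = X_real 0 * mom 0 + fps_const \<i> *\<^sub>h mom_embed P_root"
    and "j \<noteq> 0 \<Longrightarrow> k \<noteq> 0 \<Longrightarrow> mom k * X_real j = X_real j * mom k + fps_const (- \<i> * eta k j) *\<^sub>h mom_embed Xi"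
    and "j \<noteq> 0 \<Longrightarrow> mom 0 * X_real j = X_real j * mom 0 - (fps_const \<i> * fps_X) *\<^sub>h mom j"
proof -
  note [simp] = X_real_def mom_embed_simps(7)
  show "mom k * X_real 0 = X_real 0 * mom k" if "k \<noteq> 0"
    using mom_pos_mult[OF pos_deriv_P_low_space[OF that], of P_root] by (simp add: mom_embed_P_low)
  show "mom 0 * X_real 0 = X_real 0 * mom 0 + fps_const \<i> *\<^sub>h mom_embed P_root"
    using mom_pos_mult[OF pos_deriv_P_low[of 0 0], of P_root]
    by (simp add: mom_embed_P_low eta_def hscale_mult_left mom_embed_simps(5))
  show "mom k * X_real j = X_real j * mom k + fps_const (- \<i> * eta k j) *\<^sub>h mom_embed Xi" if "j \<noteq> 0" "k \<noteq> 0"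
    using that mom_pos_mult[OF pos_deriv_P_low[of j k], of Xi] mom_pos_mult[OF pos_deriv_P_low_space[OF that(2)], of "P_low j"]
    by (simp add: mom_embed_P_low hscale_mult_left hscale_mult_right mom_embed_simps(5) algebra_simps)
  show "mom 0 * X_real j = X_real j * mom 0 - (fps_const \<i> * fps_X) *\<^sub>h mom j" if "j \<noteq> 0"
    using that mom_pos_mult[OF pos_deriv_P_low[of j 0], of Xi] mom_pos_mult[OF pos_deriv_P_low[of 0 0], of "P_low j"]
    by (simp add: mom_embed_P_low hscale_mult_left hscale_mult_right mom_embed_simps(5) eta_def hscale_zero_left
        hscale_add_right hscale_hscale algebra_simps)
qed

text \<open>For X_0 the factor S cancels the denominator in [Xi, x_0] = i h Xi / S. For X_j the
  contributions of x_j Xi and of h x_0 p_j are both i h^2 P_j Xi / S and enter with opposite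
  signs.\<close>

lemma Xi_X_real:
  shows "mom_embed Xi * X_real 0 = X_real 0 * mom_embed Xi + (fps_const \<i> * fps_X) *\<^sub>h mom_embed Xi"
    and "j \<noteq> 0 \<Longrightarrow> mom_embed Xi * X_real j = X_real j * mom_embed Xi"
proof -
  show "mom_embed Xi * X_real 0 = X_real 0 * mom_embed Xi + (fps_const \<i> * fps_X) *\<^sub>h mom_embed Xi"
    using mom_pos_mult[OF pos_deriv_Xi_time, of P_root]
    by (simp add: X_real_def hscale_mult_left mult.assoc P_root_inverse mom_embed_simps(5))
  assume j: "j \<noteq> 0"
  have "(fps_const \<i> * fps_X ^ 2) *\<^sub>h (P_low j * P_root_inv) * Xi =
      fps_X *\<^sub>h ((fps_const \<i> * fps_X) *\<^sub>h (Xi * P_root_inv) * P_low j)"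
    by (simp add: hscale_mult_left hscale_mult_right hscale_hscale power2_eq_square mult_ac)
  then show "mom_embed Xi * X_real j = X_real j * mom_embed Xi"
    using mom_pos_mult[OF pos_deriv_Xi_space[OF j], of Xi] mom_pos_mult[OF pos_deriv_Xi_time, of "P_low j"] j
    by (simp add: X_real_def right_diff_distrib left_diff_distrib hscale_mult_left hscale_mult_right
        hscale_add_right mom_embed_simps(5))
qed

lemma Xi_inv_X_real:
  shows "mom_embed Xi_inv * X_real 0 = X_real 0 * mom_embed Xi_inv - (fps_const \<i> * fps_X) *\<^sub>h mom_embed Xi_inv"
    and "j \<noteq> 0 \<Longrightarrow> mom_embed Xi_inv * X_real j = X_real j * mom_embed Xi_inv"
proof -
  let ?K = "mom_embed Xi" and ?L = "mom_embed Xi_inv"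
  have inv: "?K * ?L = 1" "?L * ?K = 1"
    by (simp_all add: mom_embed_mult Xi_inverse mult.commute[of Xi_inv] mom_embed_simps(6))
  \<comment> \<open>Multiplying the relation for Xi by its inverse from both sides yields the
    relation for the inverse.\<close>
  have *: "?L * (?K * a) * ?L = a * ?L" "?L * (a * ?K) * ?L = ?L * a" for a
    by (simp_all add: mult.assoc inv flip: mult.assoc[of ?L ?K])
  have "X_real 0 * ?L = ?L * X_real 0 + (fps_const \<i> * fps_X) *\<^sub>h ?L"
    using arg_cong[OF Xi_X_real(1), of "\<lambda>a. ?L * a * ?L"]
    by (simp only: * distrib_left distrib_right hscale_mult_left hscale_mult_right inv mult_1)
  then show "?L * X_real 0 = X_real 0 * ?L - (fps_const \<i> * fps_X) *\<^sub>h ?L" by simp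
  assume "j \<noteq> 0"
  then show "?L * X_real j = X_real j * ?L"
    using arg_cong[OF Xi_X_real(2), of j "\<lambda>a. ?L * a * ?L"] by (simp add: *)
qed

section \<open>The realization is bijective\<close>

definition X_embed :: "uh \<Rightarrow> weyl fps"
  where "X_embed = (SOME F. hadic_hom F \<and> (\<forall>\<mu>. F (X_low \<mu>) = X_real \<mu>))"

lemma X_embed_hom: "hadic_hom X_embed" and X_embed_X_low: "X_embed (X_low \<mu>) = X_real \<mu>"
  using someI_ex[OF uh_hom_exists[of X_real, OF X_real_time_space X_real_space_space]]
  unfolding X_embed_def by blast+

lemmas X_embed_simps = hadic_homD(1-7)[OF X_embed_hom] X_embed_X_low

definition realize :: "deformed_weyl \<Rightarrow> weyl fps"
  where "realize = ctensor_lift (\<lambda>f L. X_embed f * mom_embed L)"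

lemma hbilinear_realize: "hbilinear (\<lambda>f L. X_embed f * mom_embed L)"
  unfolding hbilinear_def
  by (auto intro!: hlinear_left hlinear_right hadic_homD(8)[OF X_embed_hom] hadic_homD(8)[OF mom_embed_hom])

lemma hlinear_realize: "hlinear realize"
  and realize_tens: "realize (f \<otimes>\<^sub>h L) = X_embed f * mom_embed L"
  unfolding realize_def by (rule ctensor_lift[OF hbilinear_realize])+

lemma tens_simps:
  fixes a a' :: "'a::hadic_algebra" and b b' :: "'b::hadic_algebra"
  shows "(a + a') \<otimes>\<^sub>h b = a \<otimes>\<^sub>h b + a' \<otimes>\<^sub>h b" "(c *\<^sub>h a) \<otimes>\<^sub>h b = c *\<^sub>h (a \<otimes>\<^sub>h b)"
    "a \<otimes>\<^sub>h (b + b') = a \<otimes>\<^sub>h b + a \<otimes>\<^sub>h b'" "a \<otimes>\<^sub>h (c *\<^sub>h b) = c *\<^sub>h (a \<otimes>\<^sub>h b)"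
  using hbilinear_tens[where 'a = 'a and 'b = 'b] by (simp_all add: hbilinear_def hlinear_def)

lemma mom_embed_nth_0:
  assumes "f $ 0 = 1"
  shows "mom_embed f $ 0 = 1"
proof -
  have "f = 1 + fps_X *\<^sub>h fps_shift 1 f" using fps_split_const[of f] by (simp add: assms)
  then have "mom_embed f = 1 + fps_X *\<^sub>h mom_embed (fps_shift 1 f)"
    by (metis mom_embed_simps(1,5,6))
  then show ?thesis by simp
qed

lemma X_real_nth_0: "X_real \<mu> $ 0 = weyl_gen_of (Pos \<mu>)"
proof -
  have "P_root $ 0 = 1" by (simp add: P_root_def cscale_one)
  then have "mom_embed P_root $ 0 = 1" "mom_embed Xi $ 0 = 1"
    by (auto simp: Xi_def intro!: mom_embed_nth_0)
  then show ?thesis by (simp add: X_real_def pos_def)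
qed

lemma realize_monomial_nth_0:
  "realize (mono_val X_low \<alpha> \<otimes>\<^sub>h mono_val P_low \<beta>) $ 0 = weyl_power Pos \<alpha> * weyl_power Mom \<beta>"
  by (simp add: realize_tens mono_val_def weyl_power_def X_embed_simps mom_embed_simps
      hom_power[OF X_embed_hom] hom_power[OF mom_embed_hom] fps_power_zeroth X_real_nth_0 mom_def)

section \<open>Ordering words modulo h\<close>

definition hcong :: "'a::hadic_algebra \<Rightarrow> 'a \<Rightarrow> bool"
  where "hcong a b \<longleftrightarrow> (\<exists>d. a = b + fps_X *\<^sub>h d)"

lemma hcong_refl: "hcong a a"
  unfolding hcong_def by (intro exI[of _ 0]) (simp add: hscale_zero_right)

lemma hcong_trans [trans]: "hcong a b \<Longrightarrow> hcong b c \<Longrightarrow> hcong a c"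
  unfolding hcong_def by (metis add.assoc hscale_add_right)

lemma hcong_mult_left: "hcong a b \<Longrightarrow> hcong (c * a) (c * b)"
  unfolding hcong_def by (metis distrib_left hscale_mult_right)

lemma hcong_mult_right: "hcong a b \<Longrightarrow> hcong (a * c) (b * c)"
  unfolding hcong_def by (metis distrib_right hscale_mult_left)

text \<open>The only noncommuting generators have a commutator divisible by h. Words can thus be
  sorted modulo h, which is as much as successive approximation asks for.\<close>

lemma X_low_hcong: "hcong (X_low \<mu> * X_low \<nu>) (X_low \<nu> * X_low \<mu>)"
proof -
  have c: "(- (fps_const \<i> * fps_X)) *\<^sub>h a = fps_X *\<^sub>h fps_const (- \<i>) *\<^sub>h a"
    "- ((- (fps_const \<i> * fps_X)) *\<^sub>h a) = fps_X *\<^sub>h fps_const \<i> *\<^sub>h a" for a :: uh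
    by (simp_all add: hscale_minus_left hscale_const_minus hscale_minus_right hscale_hscale mult.commute)
  consider "\<mu> = \<nu>" | "\<mu> \<noteq> 0" "\<nu> \<noteq> 0" | "\<mu> = 0" "\<nu> \<noteq> 0" | "\<mu> \<noteq> 0" "\<nu> = 0" by blast
  then show ?thesis
  proof cases
    case 2
    then show ?thesis by (simp add: X_low_commutator(2) hcong_refl)
  next
    case 3
    then have "X_low \<mu> * X_low \<nu> = X_low \<nu> * X_low \<mu> + fps_X *\<^sub>h fps_const (- \<i>) *\<^sub>h X_low \<nu>"
      using X_low_commutator(1)[of \<nu>] unfolding c by (simp add: algebra_simps)
    then show ?thesis unfolding hcong_def by blast
  next
    case 4
    then have "X_low \<mu> * X_low \<nu> = X_low \<nu> * X_low \<mu> + fps_X *\<^sub>h fps_const \<i> *\<^sub>h X_low \<mu>"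
      using X_low_commutator(1)[of \<mu>] unfolding c(2)[symmetric] by (simp add: algebra_simps)
    then show ?thesis unfolding hcong_def by blast
  qed (simp add: hcong_refl)
qed

lemma X_low_power_hcong: "hcong (X_low \<mu> * X_low \<nu> ^ n) (X_low \<nu> ^ n * X_low \<mu>)"
proof (induction n)
  case (Suc n)
  have "hcong (X_low \<mu> * X_low \<nu> ^ Suc n) (X_low \<nu> * (X_low \<mu> * X_low \<nu> ^ n))"
    using hcong_mult_right[OF X_low_hcong, of \<mu> \<nu> "X_low \<nu> ^ n"] by (simp add: mult.assoc)
  also have "hcong \<dots> (X_low \<nu> ^ Suc n * X_low \<mu>)"
    using hcong_mult_left[OF Suc, of "X_low \<nu>"] by (simp add: mult.assoc)
  finally show ?case .
qed (simp add: hcong_refl)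

lemma X_low_mono_hcong:
  "hcong (X_low \<mu> * mono_val X_low \<alpha>) (mono_val X_low (Poly_Mapping.single \<mu> 1 + \<alpha>))"
proof -
  have c: "hcong (X_low \<mu> * (X_low \<nu> ^ n * z)) (X_low \<nu> ^ n * (X_low \<mu> * z))" for \<nu> n z
    using hcong_mult_right[OF X_low_power_hcong, of \<mu> \<nu> n z] by (simp add: mult.assoc)
  have m: "mono_val X_low \<alpha> = X_low 0 ^ a * (X_low 1 ^ b * (X_low 2 ^ c * X_low 3 ^ d))"
    if "Poly_Mapping.lookup \<alpha> 0 = a" "Poly_Mapping.lookup \<alpha> 1 = b" "Poly_Mapping.lookup \<alpha> 2 = c"
      "Poly_Mapping.lookup \<alpha> 3 = d" for \<alpha> a b c d
    using that by (simp add: mono_val_def mult.assoc)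
  define a0 a1 a2 a3 where a: "a0 = Poly_Mapping.lookup \<alpha> 0" "a1 = Poly_Mapping.lookup \<alpha> 1"
    "a2 = Poly_Mapping.lookup \<alpha> 2" "a3 = Poly_Mapping.lookup \<alpha> 3"
  note m' = m[OF a[symmetric]]
  note c1 = hcong_mult_left[OF c, of "X_low 0 ^ a0"]
  note c2 = hcong_mult_left[OF hcong_mult_left[OF c, of "X_low 1 ^ a1"], of "X_low 0 ^ a0"]
  consider "\<mu> = 0" | "\<mu> = 1" | "\<mu> = 2" | "\<mu> = 3" using index_cases by blast
  then show ?thesis
  proof cases
    case 1
    have "mono_val X_low (Poly_Mapping.single 0 1 + \<alpha>) = X_low 0 ^ Suc a0 * (X_low 1 ^ a1 * (X_low 2 ^ a2 * X_low 3 ^ a3))"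
      by (rule m) (simp_all add: lookup_add lookup_single a)
    then show ?thesis by (simp add: 1 m' mult.assoc hcong_refl)
  next
    case 2
    have "mono_val X_low (Poly_Mapping.single 1 1 + \<alpha>) = X_low 0 ^ a0 * (X_low 1 ^ Suc a1 * (X_low 2 ^ a2 * X_low 3 ^ a3))"
      by (rule m) (simp_all add: lookup_add lookup_single a)
    then show ?thesis using c[of 0 a0] by (simp add: 2 m' mult.assoc)
  next
    case 3
    have "mono_val X_low (Poly_Mapping.single 2 1 + \<alpha>) = X_low 0 ^ a0 * (X_low 1 ^ a1 * (X_low 2 ^ Suc a2 * X_low 3 ^ a3))"
      by (rule m) (simp_all add: lookup_add lookup_single a)
    then show ?thesis using hcong_trans[OF c[of 0 a0] c1[of 1 a1]] by (simp add: 3 m' mult.assoc)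
  next
    case 4
    have "mono_val X_low (Poly_Mapping.single 3 1 + \<alpha>) = X_low 0 ^ a0 * (X_low 1 ^ a1 * (X_low 2 ^ a2 * X_low 3 ^ Suc a3))"
      by (rule m) (simp_all add: lookup_add lookup_single a)
    then show ?thesis using hcong_trans[OF hcong_trans[OF c[of 0 a0] c1[of 1 a1]] c2[of 2 a2 "X_low 3 ^ a3"]]
      by (simp add: 4 m' mult.assoc)
  qed
qed

lemma word_hcong_mono: "\<exists>\<alpha>. hcong (prod_list (map X_low w)) (mono_val X_low \<alpha>)"
proof (induction w)
  case Nil
  have "prod_list (map X_low []) = mono_val X_low 0" by (simp add: mono_val_def)
  then show ?case by (metis hcong_refl)
next
  case (Cons \<mu> w)
  then obtain \<alpha> where "hcong (prod_list (map X_low w)) (mono_val X_low \<alpha>)" by blast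
  from hcong_trans[OF hcong_mult_left[OF this, of "X_low \<mu>"] X_low_mono_hcong]
  show ?case by auto
qed

text \<open>Up to a multiple of h, a power series is its constant coefficient, a finite combination
  of basis symbols. A property that ignores multiples of h is therefore decided on these
  symbols.\<close>

lemma hlinear_image_induct:
  fixes G :: "('k::monoid_add \<Rightarrow>\<^sub>0 complex) fps \<Rightarrow> 'c::hadic_algebra"
  assumes G: "hlinear G" and gen: "\<And>k. Q (G (fps_const (Poly_Mapping.single k 1)))"
    and add: "\<And>a b. Q a \<Longrightarrow> Q b \<Longrightarrow> Q (a + b)" and scale: "\<And>c a. Q a \<Longrightarrow> Q (c *\<^sub>h a)"
    and small: "\<And>d. Q (fps_X *\<^sub>h d)"
  shows "Q (G f)"
proof -
  have const: "Q (G (fps_const v))" for v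
  proof (induction v rule: poly_mapping_induct_add)
    case (1 k c)
    have "Poly_Mapping.single k c = c *\<^sub>C Poly_Mapping.single k 1"
      by (simp add: cscale_poly_mapping_def mult_single cscale_complex_def)
    then show ?case by (simp add: fps_const_cscale hlinear_hscale[OF G] scale gen)
  next
    case (2 u v)
    then show ?case by (simp add: hlinear_add[OF G] add flip: fps_const_add)
  qed
  have "G f = G (fps_const (f $ 0)) + fps_X *\<^sub>h G (fps_shift 1 f)"
    by (subst fps_split_const[of f]) (simp add: hlinear_add[OF G] hlinear_hscale[OF G])
  then show ?thesis by (simp add: add const small)
qed

text \<open>Being a value of \<open>F\<close> modulo h is propagated through three layers: from
  momentum monomials to all momenta, from ordered to arbitrary elements of \<open>uh\<close>, and
  from pure to arbitrary tensors.\<close>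

lemma ordered_tensor_surj:
  fixes F :: "((4 \<Rightarrow>\<^sub>0 nat) \<times> (4 \<Rightarrow>\<^sub>0 nat) \<Rightarrow>\<^sub>0 complex) fps \<Rightarrow> deformed_weyl"
  assumes F: "hlinear F"
    and F_mono: "\<And>\<alpha> \<beta>. F (fps_const (Poly_Mapping.single (\<alpha>, \<beta>) 1)) = mono_val X_low \<alpha> \<otimes>\<^sub>h mono_val P_low \<beta>"
  shows "surj F"
proof (rule hadic_surjI[OF F])
  define Q where "Q s \<longleftrightarrow> (\<exists>v d. s = F v + fps_X *\<^sub>h d)" for s
  have small: "Q (fps_X *\<^sub>h d)" for d
    unfolding Q_def by (intro exI[of _ 0] exI[of _ d]) (simp add: hlinear_zero[OF F])
  have add: "Q (a + b)" if "Q a" "Q b" for a b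
  proof -
    from that obtain v d v' d' where "a = F v + fps_X *\<^sub>h d" "b = F v' + fps_X *\<^sub>h d'"
      unfolding Q_def by blast
    then have "a + b = F (v + v') + fps_X *\<^sub>h (d + d')"
      by (simp add: hlinear_add[OF F] hscale_add_right)
    then show ?thesis unfolding Q_def by blast
  qed
  have scale: "Q (c *\<^sub>h a)" if "Q a" for c a
  proof -
    from that obtain v d where "a = F v + fps_X *\<^sub>h d" unfolding Q_def by blast
    then have "c *\<^sub>h a = F (c *\<^sub>h v) + fps_X *\<^sub>h (c *\<^sub>h d)"
      by (simp add: hlinear_hscale[OF F] hscale_add_right hscale_hscale mult.commute)
    then show ?thesis unfolding Q_def by blast
  qed
  note induct = hlinear_image_induct[where Q = Q, OF _ _ add scale small]
  have mono: "Q (mono_val X_low \<alpha> \<otimes>\<^sub>h L)" for \<alpha> L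
  proof (rule induct[where G = "\<lambda>L. mono_val X_low \<alpha> \<otimes>\<^sub>h L"])
    show "hlinear (\<lambda>L::momenta. mono_val X_low \<alpha> \<otimes>\<^sub>h L)" by (simp add: hlinear_def tens_simps)
    show "Q (mono_val X_low \<alpha> \<otimes>\<^sub>h fps_const (Poly_Mapping.single \<beta> 1))" for \<beta>
      unfolding momenta_mono F_mono[symmetric] Q_def
      by (intro exI[of _ "fps_const (Poly_Mapping.single (\<alpha>, \<beta>) 1)"] exI[of _ 0]) (simp add: hscale_zero_right)
  qed
  have tens: "Q (f \<otimes>\<^sub>h L)" for f L
  proof -
    obtain q where f: "f = abs_uh q" using abs_uh_surj by blast
    show ?thesis unfolding f
    proof (rule induct[where G = "\<lambda>q. abs_uh q \<otimes>\<^sub>h L"])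
      show "hlinear (\<lambda>q. abs_uh q \<otimes>\<^sub>h L)"
        by (simp add: hlinear_def tens_simps flip: plus_uh.abs_eq hscale_uh.abs_eq)
      fix k :: "4 free_monoid"
      obtain w where k: "k = Word w" by (cases k)
      obtain \<alpha> d where "prod_list (map X_low w) = mono_val X_low \<alpha> + fps_X *\<^sub>h d"
        using word_hcong_mono unfolding hcong_def by blast
      then have "abs_uh (fps_const (Poly_Mapping.single k 1)) \<otimes>\<^sub>h L =
          mono_val X_low \<alpha> \<otimes>\<^sub>h L + fps_X *\<^sub>h (d \<otimes>\<^sub>h L)"
        by (simp add: k uh_word tens_simps)
      then show "Q (abs_uh (fps_const (Poly_Mapping.single k 1)) \<otimes>\<^sub>h L)"
        by (simp add: add mono small)
    qed
  qed
  fix s :: deformed_weyl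
  obtain q where s: "s = abs_ctensor q" by (metis Quotient3_abs_rep Quotient3_ctensor)
  have "Q s" unfolding s
  proof (rule induct[where G = abs_ctensor])
    show "hlinear (abs_ctensor :: _ \<Rightarrow> deformed_weyl)"
      by (simp add: hlinear_def plus_ctensor.abs_eq hscale_ctensor.abs_eq)
    show "Q (abs_ctensor (fps_const (Poly_Mapping.single k 1)))" for k
      using tens by (cases k) (simp add: tens.abs_eq pre_tens_def)
  qed
  then show "\<exists>v d. s = F v + fps_X *\<^sub>h d" by (simp add: Q_def)
qed

text \<open>The composite \<open>T\<close> acts between power series modules, and its constant
  coefficient sends basis symbols to the ordered Weyl monomials, which are independent and spanning;
  so \<open>T\<close> is bijective. As \<open>F\<close> is onto, both properties descend to
  \<open>realize\<close>.\<close>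

lemma bij_realize: "bij realize"
proof -
  obtain F :: "((4 \<Rightarrow>\<^sub>0 nat) \<times> (4 \<Rightarrow>\<^sub>0 nat) \<Rightarrow>\<^sub>0 complex) fps \<Rightarrow> deformed_weyl" where F: "hlinear F"
    and F_mono: "\<And>k. F (fps_const (Poly_Mapping.single k 1)) = mono_val X_low (fst k) \<otimes>\<^sub>h mono_val P_low (snd k)"
    using hlinear_extension[of "\<lambda>k. mono_val X_low (fst k) \<otimes>\<^sub>h mono_val P_low (snd k)"] by blast
  have surj_F: "surj F" by (rule ordered_tensor_surj[OF F]) (simp add: F_mono)
  define T where "T f = realize (F f)" for f
  have T: "hlinear T"
    using F hlinear_realize by (simp add: hlinear_def T_def)
  have T_single: "T (fps_const (Poly_Mapping.single k c)) $ 0 = c *\<^sub>C (weyl_power Pos (fst k) * weyl_power Mom (snd k))" for k c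
  proof -
    have single: "Poly_Mapping.single k c = c *\<^sub>C Poly_Mapping.single k 1"
      by (simp add: cscale_poly_mapping_def mult_single cscale_complex_def)
    have nth: "(fps_const c *\<^sub>h f) $ 0 = c *\<^sub>C (f $ 0)" for f :: "weyl fps"
      by (simp add: hscale_fps_def cscale_mult_left)
    show ?thesis
      unfolding single fps_const_cscale hlinear_hscale[OF T] nth
      by (simp add: T_def F_mono realize_monomial_nth_0)
  qed
  have "inj T"
  proof (rule hadic_fps_injI[OF T])
    fix v :: "(4 \<Rightarrow>\<^sub>0 nat) \<times> (4 \<Rightarrow>\<^sub>0 nat) \<Rightarrow>\<^sub>0 complex"
    assume zero: "T (fps_const v) $ 0 = 0"
    let ?K = "Poly_Mapping.keys v"
    have const_sum: "fps_const (\<Sum>k\<in>A. g k) = (\<Sum>k\<in>A. fps_const (g k))" for g :: "_ \<Rightarrow> (4 \<Rightarrow>\<^sub>0 nat) \<times> (4 \<Rightarrow>\<^sub>0 nat) \<Rightarrow>\<^sub>0 complex" and A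
      by (induction A rule: infinite_finite_induct) (simp_all flip: fps_const_add)
    have v: "v = (\<Sum>k\<in>?K. Poly_Mapping.single k (Poly_Mapping.lookup v k))"
      by (rule poly_mapping_eqI) (simp add: lookup_sum lookup_single when_def in_keys_iff)
    have "T (fps_const v) $ 0 =
        (\<Sum>k\<in>?K. Poly_Mapping.lookup v k *\<^sub>C (weyl_power Pos (fst k) * weyl_power Mom (snd k)))"
      by (subst v) (simp add: const_sum hlinear_sum[OF T] fps_sum_nth T_single)
    with zero have "Poly_Mapping.lookup v k = 0" if "k \<in> ?K" for k
      using ordered_monomials_independent[OF finite_keys _ that, of "Poly_Mapping.lookup v"] by simp
    then show "v = 0" by (metis in_keys_iff lookup_zero poly_mapping_eqI)
  qed
  have "surj T"
  proof (rule hadic_surjI[OF T])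
    fix c :: "weyl fps"
    have "\<exists>v. T (fps_const v) $ 0 = z" if "z \<in> weyl_span ordered_monomials" for z
      using that
    proof (induction rule: weyl_span.induct)
      case zero
      have "T (fps_const 0) $ 0 = 0" by (simp add: hlinear_zero[OF T])
      then show ?case by blast
    next
      case (step b x c)
      then obtain k v where "b = weyl_power Pos (fst k) * weyl_power Mom (snd k)" "T (fps_const v) $ 0 = x"
        by (auto simp: case_prod_beta)
      then have "T (fps_const (Poly_Mapping.single k c + v)) $ 0 = c *\<^sub>C b + x"
        by (simp add: hlinear_add[OF T] T_single flip: fps_const_add)
      then show ?case by blast
    qed
    from this[OF ordered_monomials_span] obtain v where v: "T (fps_const v) $ 0 = c $ 0" by blast
    have "c = T (fps_const v) + fps_X *\<^sub>h fps_shift 1 (c - T (fps_const v))"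
      using fps_split_const[of "c - T (fps_const v)"] v by (simp add: algebra_simps)
    then show "\<exists>v d. c = T v + fps_X *\<^sub>h d" by blast
  qed
  have "inj realize"
  proof (rule injI)
    fix s t assume eq: "realize s = realize t"
    obtain f g where st: "s = F f" "t = F g" using surj_F by (metis surjE)
    with eq have "T f = T g" by (simp add: T_def)
    with \<open>inj T\<close> have "f = g" by (rule injD)
    then show "s = t" by (simp add: st)
  qed
  moreover have "surj realize"
    using \<open>surj T\<close> unfolding surj_def T_def by blast
  ultimately show ?thesis by (simp add: bij_def)
qed

section \<open>The vacuum projection\<close>

text \<open>Surjectivity of \<open>realize\<close> lets identities of linear maps on the Weyl series
  be checked on normally ordered products.\<close>

lemma realize_hlinear_unique:
  fixes G H :: "weyl fps \<Rightarrow> 'c::hadic_algebra"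
  assumes G: "hlinear G" and H: "hlinear H"
    and eq: "\<And>f L. G (X_embed f * mom_embed L) = H (X_embed f * mom_embed L)"
  shows "G a = H a"
proof -
  have "(\<lambda>s. G (realize s)) = (\<lambda>s. H (realize s))"
    by (rule ctensor_hlinear_unique) (use G H hlinear_realize eq in \<open>auto simp: hlinear_def realize_tens\<close>)
  then have "G (realize s) = H (realize s)" for s by (rule fun_cong)
  then show ?thesis using bij_realize by (metis bij_pointE)
qed

text \<open>Normal ordering identifies the Weyl algebra with \<open>uh \<otimes> momenta\<close>; applying the counit to the
  momenta is the action on the vacuum.\<close>

definition vacuum :: "weyl fps \<Rightarrow> uh"
  where "vacuum a = ctensor_lift (\<lambda>f L. counit L *\<^sub>h f) (inv realize a)"

lemma hscale_complex_fps: "c *\<^sub>h (d :: complex fps) = c * d"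
  by (simp add: hscale_fps_def cscale_complex_def fps_nth_inverse)

lemmas counit_simps = hadic_homD(1-7)[OF counit(1)] counit(2)

lemma vacuum_hbilinear: "hbilinear (\<lambda>f L. counit L *\<^sub>h (f :: uh))"
  by (auto simp: hbilinear_def hlinear_def counit_simps hscale_add_right hscale_add_left hscale_hscale
      hscale_complex_fps mult.commute)

lemma vacuum_tens: "vacuum (X_embed f * mom_embed L) = counit L *\<^sub>h f"
  by (simp add: vacuum_def ctensor_lift_tens[OF vacuum_hbilinear] bij_is_inj[OF bij_realize]
      flip: realize_tens)

lemma hlinear_vacuum: "hlinear vacuum"
proof -
  have inv: "inv realize (realize s) = s" for s by (simp add: bij_is_inj[OF bij_realize])
  have surj: "\<exists>s. a = realize s" for a using bij_realize by (metis bij_pointE)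
  have "inv realize (a + b) = inv realize a + inv realize b" for a b
  proof -
    obtain s t where "a = realize s" "b = realize t" using surj by blast
    then show ?thesis by (simp add: inv flip: hlinear_add[OF hlinear_realize])
  qed
  moreover have "inv realize (c *\<^sub>h a) = c *\<^sub>h inv realize a" for a c
  proof -
    obtain s where "a = realize s" using surj by blast
    then show ?thesis by (simp add: inv flip: hlinear_hscale[OF hlinear_realize])
  qed
  ultimately show ?thesis
    using hlinear_ctensor_lift[OF vacuum_hbilinear] by (simp add: hlinear_def vacuum_def)
qed

lemmas vacuum_simps = hlinear_add[OF hlinear_vacuum] hlinear_diff[OF hlinear_vacuum]
  hlinear_hscale[OF hlinear_vacuum] hlinear_sum[OF hlinear_vacuum]

lemma vacuum_X_embed: "vacuum (X_embed f) = f"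
  using vacuum_tens[of f 1] by (simp add: mom_embed_simps counit_simps hscale_one)

lemma vacuum_mult_X_embed: "vacuum (X_embed f * a) = f * vacuum a"
  by (rule realize_hlinear_unique[where a = a])
    (use hlinear_vacuum in \<open>auto intro: hlinear_comp_right hlinear_right
      simp: vacuum_tens hscale_mult_right simp flip: mult.assoc X_embed_simps(4)\<close>)

lemma vacuum_mult_mom_embed: "vacuum (a * mom_embed L) = counit L *\<^sub>h vacuum a"
  by (rule realize_hlinear_unique[where a = a])
    (use hlinear_vacuum in \<open>auto intro: hlinear_comp_left
      simp: hlinear_def hscale_add_right vacuum_tens hscale_hscale mult.assoc mom_embed_mult counit_simps distrib_right
        hscale_mult_left mult.commute\<close>)

text \<open>Up to h-adic limits, \<open>a\<close> and \<open>X_embed (vacuum a)\<close> differ by a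
  sum of terms that end in a momentum of counit zero. Such terms stay in the kernel of
  \<open>vacuum\<close> after multiplication from the left. This is what makes \<open>act\<close>
  compatible with products of momenta.\<close>

lemma vacuum_mult: "vacuum (b * X_embed (vacuum a)) = vacuum (b * a)"
proof (rule realize_hlinear_unique[where a = a])
  show "hlinear (\<lambda>a. vacuum (b * X_embed (vacuum a)))"
    by (simp add: hlinear_def vacuum_simps X_embed_simps distrib_left hscale_mult_right)
  show "hlinear (\<lambda>a. vacuum (b * a))" by (rule hlinear_comp_right[OF hlinear_vacuum])
  show "vacuum (b * X_embed (vacuum (X_embed f * mom_embed L))) = vacuum (b * (X_embed f * mom_embed L))" for f L
    by (simp add: vacuum_tens vacuum_X_embed X_embed_simps vacuum_simps hscale_mult_right vacuum_mult_mom_embed flip: mult.assoc)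
qed

section \<open>The action of the momenta\<close>

definition act :: "momenta \<Rightarrow> uh \<Rightarrow> uh"
  where "act L g = vacuum (mom_embed L * X_embed g)"

lemma hbilinear_act: "hbilinear act"
  by (simp add: hbilinear_def hlinear_def act_def X_embed_simps mom_embed_simps vacuum_simps distrib_left
      distrib_right hscale_mult_left hscale_mult_right)

lemma act_simps:
  "act (L + M) f = act L f + act M f" "act (c *\<^sub>h L) f = c *\<^sub>h act L f"
  "act L (f + g) = act L f + act L g" "act L (c *\<^sub>h f) = c *\<^sub>h act L f"
  using hbilinear_act by (simp_all add: hbilinear_def hlinear_def)

lemma act_diff: "act L (f - g) = act L f - act L g"
  using hbilinear_act by (simp add: hbilinear_def hlinear_diff)

lemma act_one: "act 1 f = f"
  by (simp add: act_def mom_embed_simps vacuum_X_embed)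

lemma act_mult: "act (L * M) f = act L (act M f)"
  by (simp add: act_def mom_embed_simps mult.assoc vacuum_mult)

lemma act_counit: "act L 1 = counit L *\<^sub>h 1"
  using vacuum_tens[of 1 L] by (simp add: act_def X_embed_simps)

text \<open>The counit of S squares to the counit of 1 - h^2 P^2, which is 1. In an integral domain
  this leaves 1 and -1, and the constant coefficient excludes -1.\<close>

lemma counit_Xi: "counit Xi = 1"
proof -
  have P2: "counit (fps_const P_squared) = 0"
  proof -
    have "fps_const P_squared = P_low 1 * P_low 1 + (P_low 2 * P_low 2 + P_low 3 * P_low 3) - P_low 0 * P_low 0"
      by (simp add: P_squared_def P_low_def power2_eq_square)
    then show ?thesis by (simp add: counit_simps)
  qed
  have "counit P_root * counit P_root = counit (1 - fps_X ^ 2 *\<^sub>h fps_const P_squared)"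
    by (simp only: P_root_square flip: counit_simps)
  also have "\<dots> = 1" by (simp add: counit_simps P2 hscale_zero_right)
  finally have "(counit P_root - 1) * (counit P_root + 1) = 0" by (simp add: algebra_simps)
  moreover have "counit P_root + 1 \<noteq> 0"
  proof -
    have "P_root = 1 + fps_X *\<^sub>h fps_shift 1 P_root"
      using fps_split_const[of P_root] by (simp add: P_root_def cscale_one)
    then have "counit P_root = 1 + fps_X *\<^sub>h counit (fps_shift 1 P_root)"
      by (metis counit_simps(1,5,6))
    then have "(counit P_root + 1) $ 0 = 2" by simp
    then show ?thesis by (metis fps_zero_nth zero_neq_numeral)
  qed
  ultimately have "counit P_root = 1" by simp
  then show ?thesis by (simp add: Xi_def counit_simps hscale_zero_right)
qed

lemma counit_Xi_inv: "counit Xi_inv = 1"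
  using arg_cong[OF Xi_inverse, of counit] by (simp add: counit_simps counit_Xi)

text \<open>Once the momentum has been moved to the right, the vacuum sees only the commutator,
  where S and Xi count as 1 and the momenta as 0.\<close>

lemma act_X_low: "act (P_low \<mu>) (X_low \<nu>) = fps_const (- \<i> * eta \<mu> \<nu>) *\<^sub>h 1"
proof -
  have scalar: "vacuum (mom_embed L) = counit L *\<^sub>h 1" for L
    using vacuum_tens[of 1 L] by (simp add: X_embed_simps)
  have root: "counit P_root = 1"
    using counit_Xi by (simp add: Xi_def counit_simps hscale_zero_right)
  have right: "vacuum (X_real \<nu> * mom \<mu>) = 0" for \<mu> \<nu>
    using vacuum_tens[of "X_low \<nu>" "P_low \<mu>"] by (simp add: X_embed_simps mom_embed_simps counit_simps hscale_zero_left)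
  have mom: "vacuum (mom \<mu>) = 0" for \<mu>
    using scalar[of "P_low \<mu>"] by (simp add: mom_embed_simps counit_simps hscale_zero_left)
  note [simp] = act_def mom_embed_P_low X_embed_X_low right scalar vacuum_simps root mom counit_Xi
    eta_def hscale_zero_left hscale_zero_right hscale_one
  show ?thesis
  proof (cases "\<nu> = 0"; cases "\<mu> = 0")
    assume "\<nu> = 0" "\<mu> = 0"
    then show ?thesis using mom_X_real(2) by simp
  next
    assume "\<nu> = 0" "\<mu> \<noteq> 0"
    then show ?thesis using mom_X_real(1)[of \<mu>] by simp
  next
    assume "\<nu> \<noteq> 0" "\<mu> = 0"
    then show ?thesis using mom_X_real(4)[of \<nu>] by simp
  next
    assume "\<nu> \<noteq> 0" "\<mu> \<noteq> 0"
    then show ?thesis using mom_X_real(3)[of \<nu> \<mu>] by simp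
  qed
qed

lemma X_up_eq: "X_up \<nu> = fps_const (eta \<nu> \<nu>) *\<^sub>h X_low \<nu>"
proof -
  have "X_up \<nu> = (\<Sum>\<rho>\<in>{\<nu>}. fps_const (eta \<nu> \<rho>) *\<^sub>h X_low \<rho>)"
    unfolding X_up_def by (rule sum.mono_neutral_right) (auto simp: eta_def hscale_zero_left)
  then show ?thesis by simp
qed

lemma act_X_up: "act (P_low \<mu>) (X_up \<nu>) = (if \<mu> = \<nu> then fps_const (- \<i>) else 0) *\<^sub>h 1"
  unfolding X_up_eq act_simps act_X_low hscale_hscale by (simp add: eta_def hscale_zero_left)

section \<open>Cross relations\<close>

text \<open>A relation that moves \<open>L\<close> to the right with some coefficient
  \<open>u\<close> identifies that coefficient as the action. The inductions over words below can
  therefore carry mere existence of \<open>u\<close>.\<close>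

lemma act_unique:
  assumes "mom_embed L * X_embed g = X_embed u * mom_embed M + R" "counit M = 1" "vacuum R = 0"
  shows "act L g = u"
  by (simp add: act_def assms vacuum_simps vacuum_tens hscale_one)

text \<open>Passing a group-like element through a word passes it through each letter, so the
  coefficients multiply. Linearity extends the result from words to \<open>uh\<close>.\<close>

lemma cross_grouplike:
  assumes counit: "counit L = 1"
    and gen: "\<And>\<mu>. \<exists>u. mom_embed L * X_embed (X_low \<mu>) = X_embed u * mom_embed L"
  shows "mom_embed L * X_embed g = X_embed (act L g) * mom_embed L"
proof -
  have "\<exists>u. mom_embed L * X_embed (prod_list (map X_low w)) = X_embed u * mom_embed L" for w
  proof (induction w)
    case Nil
    show ?case by (intro exI[of _ 1]) (simp add: X_embed_simps)
  next
    case (Cons \<mu> w)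
    let ?w = "prod_list (map X_low w)"
    obtain u where u: "mom_embed L * X_embed (X_low \<mu>) = X_embed u * mom_embed L" using gen by blast
    obtain v where v: "mom_embed L * X_embed ?w = X_embed v * mom_embed L" using Cons by blast
    have "mom_embed L * X_embed (X_low \<mu> * ?w) = (mom_embed L * X_embed (X_low \<mu>)) * X_embed ?w"
      by (simp add: X_embed_simps(4) mult.assoc)
    also have "\<dots> = X_embed u * (mom_embed L * X_embed ?w)" by (simp only: u mult.assoc)
    also have "\<dots> = X_embed (u * v) * mom_embed L" by (simp only: v X_embed_simps(4) mult.assoc)
    finally show ?case by auto
  qed
  then have word: "mom_embed L * X_embed (prod_list (map X_low w)) = X_embed (act L (prod_list (map X_low w))) * mom_embed L" for w
    using act_unique[of L _ _ L 0] counit by (metis add.right_neutral hlinear_zero[OF hlinear_vacuum])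
  show ?thesis
    by (rule fun_cong[where x = g], rule uh_hlinear_unique)
      (simp_all add: word hlinear_def X_embed_simps act_simps distrib_left distrib_right hscale_mult_left hscale_mult_right)
qed

section \<open>The group-like elements Xi and its inverse\<close>

lemma Xi_X_low_cross: "mom_embed Xi * X_embed (X_low \<mu>) =
    X_embed (if \<mu> = 0 then X_low 0 + (fps_const \<i> * fps_X) *\<^sub>h 1 else X_low \<mu>) * mom_embed Xi"
  by (simp add: X_embed_simps Xi_X_real distrib_right hscale_mult_left)

lemma Xi_inv_X_low_cross: "mom_embed Xi_inv * X_embed (X_low \<mu>) =
    X_embed (if \<mu> = 0 then X_low 0 - (fps_const \<i> * fps_X) *\<^sub>h 1 else X_low \<mu>) * mom_embed Xi_inv"
  by (simp add: X_embed_simps Xi_inv_X_real left_diff_distrib hscale_mult_left)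

lemma cross_Xi: "mom_embed Xi * X_embed g = X_embed (act Xi g) * mom_embed Xi"
  by (rule cross_grouplike[OF counit_Xi]) (use Xi_X_low_cross in blast)

lemma cross_Xi_inv: "mom_embed Xi_inv * X_embed g = X_embed (act Xi_inv g) * mom_embed Xi_inv"
  by (rule cross_grouplike[OF counit_Xi_inv]) (use Xi_inv_X_low_cross in blast)

lemma act_Xi_inv_X_low:
  "act Xi_inv (X_low \<mu>) = (if \<mu> = 0 then X_low 0 - (fps_const \<i> * fps_X) *\<^sub>h 1 else X_low \<mu>)"
  by (rule act_unique[where R = 0, OF _ counit_Xi_inv])
    (simp_all add: Xi_inv_X_low_cross hlinear_zero[OF hlinear_vacuum])

lemma act_Xi_inv_mult: "act Xi_inv (f * g) = act Xi_inv f * act Xi_inv g"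
proof (rule act_unique[where R = 0, OF _ counit_Xi_inv])
  have "mom_embed Xi_inv * X_embed (f * g) = (mom_embed Xi_inv * X_embed f) * X_embed g"
    by (simp add: X_embed_simps(4) mult.assoc)
  also have "\<dots> = X_embed (act Xi_inv f) * (mom_embed Xi_inv * X_embed g)"
    by (simp only: cross_Xi_inv[of f] mult.assoc)
  also have "\<dots> = X_embed (act Xi_inv f * act Xi_inv g) * mom_embed Xi_inv + 0"
    by (simp only: cross_Xi_inv[of g] X_embed_simps(4) mult.assoc add_0_right)
  finally show "mom_embed Xi_inv * X_embed (f * g) = X_embed (act Xi_inv f * act Xi_inv g) * mom_embed Xi_inv + 0" .
qed (simp add: hlinear_zero[OF hlinear_vacuum])

section \<open>The momenta P_i and P_0 as twisted derivations\<close>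

lemma vacuum_mult_mom: "vacuum (a * mom \<mu>) = 0"
  using vacuum_mult_mom_embed[of a "P_low \<mu>"] by (simp add: mom_embed_P_low counit_simps hscale_zero_left)

lemma cross_P_space_mult:
  assumes "mom i * X_embed f = X_embed u * mom_embed Xi + X_embed f * mom i"
    and "mom i * X_embed g = X_embed v * mom_embed Xi + X_embed g * mom i"
  shows "mom i * X_embed (f * g) = X_embed (u * act Xi g + f * v) * mom_embed Xi + X_embed (f * g) * mom i"
proof -
  have "mom i * X_embed (f * g) = (mom i * X_embed f) * X_embed g"
    by (simp add: X_embed_simps(4) mult.assoc)
  also have "\<dots> = X_embed u * (mom_embed Xi * X_embed g) + X_embed f * (mom i * X_embed g)"
    by (simp only: assms(1) distrib_right mult.assoc)
  also have "\<dots> = X_embed (u * act Xi g + f * v) * mom_embed Xi + X_embed (f * g) * mom i"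
    by (simp only: cross_Xi assms(2) X_embed_simps(1,4) distrib_left distrib_right mult.assoc add.assoc)
  finally show ?thesis .
qed

lemma cross_P_space:
  assumes i: "i \<noteq> 0"
  shows "mom i * X_embed g = X_embed (act (P_low i) g) * mom_embed Xi + X_embed g * mom i"
proof -
  have gen: "mom i * X_embed (X_low \<mu>) = X_embed (fps_const (- \<i> * eta i \<mu>) *\<^sub>h 1) * mom_embed Xi + X_embed (X_low \<mu>) * mom i" for \<mu>
    using i mom_X_real(1)[of i] mom_X_real(3)[of \<mu> i]
    by (cases "\<mu> = 0") (simp_all add: X_embed_simps hscale_mult_left eta_def hscale_zero_left)
  have "\<exists>u. mom i * X_embed (prod_list (map X_low w)) = X_embed u * mom_embed Xi + X_embed (prod_list (map X_low w)) * mom i" for w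
  proof (induction w)
    case Nil
    show ?case by (intro exI[of _ 0]) (simp add: X_embed_simps)
  next
    case (Cons \<mu> w)
    then obtain v where "mom i * X_embed (prod_list (map X_low w)) = X_embed v * mom_embed Xi + X_embed (prod_list (map X_low w)) * mom i"
      by blast
    from cross_P_space_mult[OF gen[of \<mu>] this] show ?case by auto
  qed
  then have word: "mom i * X_embed (prod_list (map X_low w)) =
      X_embed (act (P_low i) (prod_list (map X_low w))) * mom_embed Xi + X_embed (prod_list (map X_low w)) * mom i" for w
    using act_unique[of "P_low i", unfolded mom_embed_P_low, OF _ counit_Xi vacuum_mult_mom] by metis
  show ?thesis
    by (rule fun_cong[where x = g], rule uh_hlinear_unique)
      (simp_all add: word hlinear_def X_embed_simps act_simps distrib_left distrib_right hscale_mult_left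
        hscale_mult_right hscale_add_right algebra_simps)
qed

text \<open>The Leibniz rule is the coefficient of Xi in the cross relation for a product, read off
  by \<open>act_unique\<close>.\<close>

lemma act_P_space_mult:
  assumes i: "i \<noteq> 0"
  shows "act (P_low i) (f * g) = act (P_low i) f * act Xi g + f * act (P_low i) g"
  using cross_P_space_mult[OF cross_P_space[OF i] cross_P_space[OF i], of f g]
  by (intro act_unique[OF _ counit_Xi vacuum_mult_mom]) (simp add: mom_embed_P_low)

text \<open>The part of (L_1 acting on g) L_2 for L = P_0 that comes from the coproduct terms other
  than P_0 \<otimes> Xi. Each summand ends in a momentum, so the vacuum kills it.\<close>

definition P_time_rest :: "uh \<Rightarrow> weyl fps"
  where "P_time_rest g = X_embed (act Xi_inv g) * mom 0 +
    (\<Sum>m\<in>{1, 2, 3}. fps_X *\<^sub>h (X_embed (act (P_low m * Xi_inv) g) * mom m))"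

lemma vacuum_P_time_rest: "vacuum (P_time_rest g) = 0"
  by (simp add: P_time_rest_def vacuum_simps vacuum_mult_mom hscale_zero_right)

lemma cross_P_time_X_low: "\<exists>u. mom 0 * X_embed (X_low \<mu>) = X_embed u * mom_embed Xi + P_time_rest (X_low \<mu>)"
proof (cases "\<mu> = 0")
  case True
  have "act (P_low m) ((fps_const \<i> * fps_X) *\<^sub>h 1) = 0" for m
    by (simp add: act_simps act_counit counit_simps hscale_zero_left hscale_zero_right)
  then have "act (P_low m * Xi_inv) (X_low 0) = 0" if "m \<noteq> 0" for m
    using that by (simp add: act_mult act_Xi_inv_X_low act_diff act_X_low eta_def hscale_zero_left)
  then have rest: "P_time_rest (X_low 0) = X_real 0 * mom 0 - (fps_const \<i> * fps_X) *\<^sub>h mom 0"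
    by (simp add: P_time_rest_def act_Xi_inv_X_low X_embed_simps left_diff_distrib hscale_mult_left hscale_zero_right)
  \<comment> \<open>The witness i comes from i S + i h P_0 = i Xi: the first term is [P_0, X_0], the
    second compensates the shift of X_0 by the inverse of Xi.\<close>
  show ?thesis
    by (intro exI[of _ "fps_const \<i> *\<^sub>h 1"])
      (simp add: True rest X_embed_simps mom_X_real(2) hscale_mult_left Xi_def mom_embed_simps hscale_add_right hscale_hscale)
next
  case False
  have "act (P_low m * Xi_inv) (X_low \<mu>) = fps_const (- \<i> * eta m \<mu>) *\<^sub>h 1" for m
    using False by (simp add: act_mult act_Xi_inv_X_low act_X_low)
  then have "P_time_rest (X_low \<mu>) = X_real \<mu> * mom 0 +
      (\<Sum>m\<in>{1, 2, 3}. fps_X *\<^sub>h fps_const (- \<i> * eta m \<mu>) *\<^sub>h mom m)"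
    using False by (simp add: P_time_rest_def act_Xi_inv_X_low X_embed_simps hscale_mult_left)
  also have "(\<Sum>m\<in>{1, 2, 3}. fps_X *\<^sub>h fps_const (- \<i> * eta m \<mu>) *\<^sub>h mom m) = - ((fps_const \<i> * fps_X) *\<^sub>h mom \<mu>)"
    using False index_cases[of \<mu>]
    by (elim disjE) (simp_all add: eta_def hscale_zero_left hscale_zero_right hscale_const_minus hscale_minus_right
      hscale_hscale mult.commute)
  \<comment> \<open>The coefficient of Xi is 0, since the sum over m already accounts for the whole
    commutator -i h P_\<mu>.\<close>
  finally show ?thesis
    by (intro exI[of _ 0]) (simp add: X_embed_simps mom_X_real(4)[OF False])
qed

text \<open>The calculation reflects coassociativity of the coproduct of P_0: moving P_0 past f
  leaves Xi, P_0 and the P_m in front of g, and their cross relations are applied in turn.\<close>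

lemma cross_P_time_mult:
  assumes "mom 0 * X_embed f = X_embed u * mom_embed Xi + P_time_rest f"
    and "mom 0 * X_embed g = X_embed v * mom_embed Xi + P_time_rest g"
  shows "\<exists>w. mom 0 * X_embed (f * g) = X_embed w * mom_embed Xi + P_time_rest (f * g)"
proof -
  let ?V = "\<lambda>m f. act (P_low m * Xi_inv) f"
  \<comment> \<open>The terms that end in Xi, one for each of the three parts of the coproduct of
    P_0.\<close>
  let ?w = "u * act Xi g + act Xi_inv f * v + (\<Sum>m\<in>{1, 2, 3}. fps_X *\<^sub>h (?V m f * act (P_low m) g))"
  \<comment> \<open>In the Leibniz rule for P_m after the inverse of Xi, the Xi that acts on g
    cancels this inverse, leaving \<open>?V m f * g\<close>.\<close>
  have inv: "act Xi (act Xi_inv g) = g" by (simp add: Xi_inverse act_one flip: act_mult)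
  have V: "?V m (f * g) = ?V m f * g + act Xi_inv f * ?V m g" if "m \<noteq> 0" for m
    by (simp add: act_mult act_Xi_inv_mult act_P_space_mult[OF that] inv)
  have sum: "sum h {1, 2, 3 :: 4} = h 1 + (h 2 + h 3)" for h :: "4 \<Rightarrow> 'a::comm_monoid_add"
    by simp
  have rest: "P_time_rest f * X_embed g = X_embed (act Xi_inv f) * (mom 0 * X_embed g) +
    (\<Sum>m\<in>{1, 2, 3}. fps_X *\<^sub>h (X_embed (?V m f) * (mom m * X_embed g)))"
    by (simp only: P_time_rest_def distrib_right sum_distrib_right hscale_mult_left mult.assoc)
  have "mom 0 * X_embed (f * g) = (mom 0 * X_embed f) * X_embed g"
    by (simp add: X_embed_simps(4) mult.assoc)
  also have "\<dots> = X_embed u * (mom_embed Xi * X_embed g) + P_time_rest f * X_embed g"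
    by (simp only: assms(1) distrib_right mult.assoc)
  also have "\<dots> = X_embed u * (X_embed (act Xi g) * mom_embed Xi) +
      (X_embed (act Xi_inv f) * (X_embed v * mom_embed Xi + P_time_rest g) +
    (\<Sum>m\<in>{1, 2, 3}. fps_X *\<^sub>h (X_embed (?V m f) * (X_embed (act (P_low m) g) * mom_embed Xi + X_embed g * mom m))))"
    unfolding rest cross_Xi assms(2) by (intro arg_cong2[of _ _ _ _ "(+)"] refl sum.cong) (auto simp: cross_P_space)
  also have "\<dots> = X_embed ?w * mom_embed Xi + P_time_rest (f * g)"
    by (simp add: sum P_time_rest_def V act_Xi_inv_mult X_embed_simps distrib_left distrib_right hscale_add_right
        hscale_mult_left hscale_mult_right mult.assoc add_ac)
  finally show ?thesis by blast
qed

lemma cross_P_time: "mom 0 * X_embed g = X_embed (act (P_low 0) g) * mom_embed Xi + P_time_rest g"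
proof -
  have "\<exists>u. mom 0 * X_embed (prod_list (map X_low w)) = X_embed u * mom_embed Xi + P_time_rest (prod_list (map X_low w))" for w
  proof (induction w)
    case Nil
    show ?case
      by (intro exI[of _ 0])
        (simp add: X_embed_simps P_time_rest_def act_counit counit_simps counit_Xi_inv hscale_one hscale_zero_left hscale_zero_right)
  next
    case (Cons \<mu> w)
    then show ?case using cross_P_time_mult cross_P_time_X_low by fastforce
  qed
  then have word: "mom 0 * X_embed (prod_list (map X_low w)) =
      X_embed (act (P_low 0) (prod_list (map X_low w))) * mom_embed Xi + P_time_rest (prod_list (map X_low w))" for w
    using act_unique[of "P_low 0", unfolded mom_embed_P_low, OF _ counit_Xi vacuum_P_time_rest] by metis
  have rest: "hlinear P_time_rest"
    by (simp add: hlinear_def P_time_rest_def X_embed_simps act_simps distrib_right hscale_mult_left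
        hscale_add_right hscale_hscale mult.commute[of fps_X] algebra_simps)
  show ?thesis
    by (rule fun_cong[where x = g], rule uh_hlinear_unique)
      (simp_all add: word hlinear_def hlinear_add[OF rest] hlinear_hscale[OF rest] X_embed_simps act_simps distrib_left
        distrib_right hscale_mult_left hscale_mult_right hscale_add_right algebra_simps)
qed

section \<open>The smash product\<close>

lemma hbilinear_sweedler: "hbilinear (\<lambda>L1 L2. X_embed (act L1 g) * mom_embed L2)"
  by (simp add: hbilinear_def hlinear_def act_simps X_embed_simps mom_embed_simps distrib_left distrib_right
      hscale_mult_left hscale_mult_right)

definition sweedler :: "uh \<Rightarrow> (momenta, momenta) ctensor \<Rightarrow> weyl fps"
  where "sweedler g = ctensor_lift (\<lambda>L1 L2. X_embed (act L1 g) * mom_embed L2)"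

lemma hlinear_sweedler: "hlinear (sweedler g)"
  and sweedler_tens: "sweedler g (L1 \<otimes>\<^sub>h L2) = X_embed (act L1 g) * mom_embed L2"
  unfolding sweedler_def by (rule ctensor_lift[OF hbilinear_sweedler])+

lemmas sweedler_simps = hlinear_add[OF hlinear_sweedler] hlinear_hscale[OF hlinear_sweedler]
  hlinear_sum[OF hlinear_sweedler] sweedler_tens

text \<open>Acting with \<open>L1\<close> first and multiplying by \<open>L2\<close> at the end
  amounts to multiplying in the tensor square of the momenta; this brings in multiplicativity of the
  coproduct.\<close>

lemma sweedler_act: "sweedler (act L1 g) x * mom_embed L2 = sweedler g (x * (L1 \<otimes>\<^sub>h L2))"
proof -
  have "(\<lambda>x. sweedler (act L1 g) x * mom_embed L2) = (\<lambda>x. sweedler g (x * (L1 \<otimes>\<^sub>h L2)))"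
    by (rule ctensor_hlinear_unique)
      (simp_all add: hlinear_left hlinear_comp_left hlinear_sweedler sweedler_tens tens_mult act_mult mom_embed_mult mult.assoc)
  then show ?thesis by (rule fun_cong)
qed

lemma tens_one: "1 \<otimes>\<^sub>h 1 = 1"
  by (simp add: tens.abs_eq one_ctensor.abs_eq pre_tens_def flip: zero_tensor_symbol_def)

lemmas coproduct_simps = hadic_homD(1-7)[OF coproduct(1)] coproduct(2)

text \<open>The relation is stable under products of momenta: L M g = L (M_1 acting on g) M_2, and
  moving L through the middle factor gives the coproduct of L times that of M. Only the generators
  remain, where it is \<open>cross_P_time\<close> or \<open>cross_P_space\<close>.\<close>

lemma cross_relation: "mom_embed L * X_embed g = sweedler g (coproduct L)"
proof -
  define Q where "Q L \<longleftrightarrow> (\<forall>g. mom_embed L * X_embed g = sweedler g (coproduct L))" for L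
  have one: "Q 1"
    by (simp add: Q_def coproduct_simps mom_embed_simps sweedler_tens act_one flip: tens_one)
  have gen: "Q (P_low \<mu>)" for \<mu>
  proof (cases "\<mu> = 0")
    case True
    then show ?thesis
      by (simp add: Q_def coproduct_simps mom_embed_P_low coproduct_gen_def sweedler_simps cross_P_time P_time_rest_def)
  next
    case False
    then show ?thesis
      by (simp add: Q_def coproduct_simps mom_embed_P_low coproduct_gen_def sweedler_simps cross_P_space act_one)
  qed
  have mult: "Q (L * M)" if L: "Q L" and M: "Q M" for L M
    unfolding Q_def
  proof
    fix g
    have *: "(\<lambda>y. mom_embed L * sweedler g y) = (\<lambda>y. sweedler g (coproduct L * y))"
    proof (rule ctensor_hlinear_unique)
      show "mom_embed L * sweedler g (a \<otimes>\<^sub>h b) = sweedler g (coproduct L * (a \<otimes>\<^sub>h b))" for a b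
        using L by (simp add: Q_def sweedler_tens flip: mult.assoc sweedler_act)
    qed (simp_all add: hlinear_right hlinear_comp_right hlinear_sweedler)
    have "mom_embed (L * M) * X_embed g = mom_embed L * sweedler g (coproduct M)"
      using M by (simp add: Q_def mom_embed_simps(4) mult.assoc)
    also have "\<dots> = sweedler g (coproduct (L * M))"
      using fun_cong[OF *] by (simp add: coproduct_simps)
    finally show "mom_embed (L * M) * X_embed g = sweedler g (coproduct (L * M))" .
  qed
  have power: "Q (P_low \<mu> ^ n)" for \<mu> n
    by (induction n) (simp_all add: one mult gen)
  show ?thesis
  proof (rule momenta_hlinear_unique[where f = L])
    show "hlinear (\<lambda>L. mom_embed L * X_embed g)"
      by (rule hlinear_left[OF hadic_homD(8)[OF mom_embed_hom]])
    show "hlinear (\<lambda>L. sweedler g (coproduct L))"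
      using hlinear_sweedler by (simp add: hlinear_def coproduct_simps)
    show "mom_embed (mono_val P_low \<alpha>) * X_embed g = sweedler g (coproduct (mono_val P_low \<alpha>))" for \<alpha>
      using mult[OF mult[OF mult[OF power power] power] power] unfolding Q_def mono_val_def by blast
  qed
qed

section \<open>The module algebra structure and its uniqueness\<close>

lemma hbilinear_leibniz: "hbilinear (\<lambda>L1 L2. act L1 f * act L2 g)"
  by (simp add: hbilinear_def hlinear_def act_simps distrib_left distrib_right
      hscale_mult_left hscale_mult_right)

text \<open>The Leibniz rule is associativity L (f g) = (L f) g in the Weyl algebra: the cross
  relation rewrites L f, and projecting to the vacuum leaves the action on g in the second
  factor.\<close>

lemma module_algebra_act: "module_algebra act"
proof -
  have "act L (f * g) = ctensor_lift (\<lambda>L1 L2. act L1 f * act L2 g) (coproduct L)" for L f g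
  proof -
    have "(\<lambda>x. vacuum (sweedler f x * X_embed g)) = ctensor_lift (\<lambda>L1 L2. act L1 f * act L2 g)"
    proof (rule ctensor_hlinear_unique)
      show "hlinear (\<lambda>x. vacuum (sweedler f x * X_embed g))"
        using hlinear_vacuum hlinear_sweedler by (simp add: hlinear_def distrib_right hscale_mult_left)
      show "vacuum (sweedler f (a \<otimes>\<^sub>h b) * X_embed g) = ctensor_lift (\<lambda>L1 L2. act L1 f * act L2 g) (a \<otimes>\<^sub>h b)" for a b
        by (simp add: sweedler_tens ctensor_lift_tens[OF hbilinear_leibniz] mult.assoc vacuum_mult_X_embed
            flip: act_def)
    qed (rule hlinear_ctensor_lift[OF hbilinear_leibniz])
    from fun_cong[OF this, of "coproduct L"] show ?thesis
      by (simp add: act_def X_embed_simps cross_relation flip: mult.assoc)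
  qed
  then show ?thesis
    by (simp add: module_algebra_def hbilinear_act act_one act_mult act_counit)
qed

text \<open>One momentum takes a coordinate to a scalar, on which any further momentum acts by the
  counit; so the values on generators determine the action of all momenta on coordinates, and the
  coproduct carries it to words.\<close>

lemma module_algebra_unique:
  assumes A: "module_algebra A" and B: "module_algebra B"
    and eq: "\<And>\<mu> \<nu>. A (P_low \<mu>) (X_low \<nu>) = B (P_low \<mu>) (X_low \<nu>)"
    and scalar: "\<And>\<mu> \<nu>. \<exists>c. B (P_low \<mu>) (X_low \<nu>) = c *\<^sub>h 1"
  shows "A = B"
proof -
  have D: "hbilinear T" "T 1 f = f" "T (L * M) f = T L (T M f)" "T L 1 = counit L *\<^sub>h 1"
    "T L (f * g) = ctensor_lift (\<lambda>L1 L2. T L1 f * T L2 g) (coproduct L)"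
    if "module_algebra T" for T L M f g
    using that unfolding module_algebra_def by blast+
  have lin: "hlinear (T L)" "hlinear (\<lambda>L. T L f)" if "module_algebra T" for T L f
    using D(1)[OF that] by (auto simp: hbilinear_def)
  have gen: "A L (X_low \<nu>) = B L (X_low \<nu>)" for L \<nu>
  proof (rule fun_cong[where x = L], rule hlinear_unique[OF lin(2)[OF A] lin(2)[OF B]])
    fix \<alpha> :: "4 \<Rightarrow>\<^sub>0 nat"
    show "A (fps_const (Poly_Mapping.single \<alpha> 1)) (X_low \<nu>) = B (fps_const (Poly_Mapping.single \<alpha> 1)) (X_low \<nu>)"
    proof (induction \<alpha> rule: poly_mapping_nat_induct)
      case 1
      show ?case by (simp add: D(2)[OF A] D(2)[OF B])
    next
      case (2 \<mu> \<beta>)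
      \<comment> \<open>The factor \<open>P_low \<mu>\<close> is written last so that it acts first
        and leaves a scalar.\<close>
      have "fps_const (Poly_Mapping.single (Poly_Mapping.single \<mu> 1 + \<beta>) 1) =
          fps_const (Poly_Mapping.single \<beta> 1) * P_low \<mu>"
        by (simp add: P_low_def P_var_def mult_single add.commute)
      moreover obtain c where "B (P_low \<mu>) (X_low \<nu>) = c *\<^sub>h 1" using scalar by blast
      ultimately show ?case
        by (simp add: D(3)[OF A] D(3)[OF B] eq hlinear_hscale[OF lin(1)[OF A]] hlinear_hscale[OF lin(1)[OF B]]
            D(4)[OF A] D(4)[OF B])
    qed
  qed
  have "A L (prod_list (map X_low w)) = B L (prod_list (map X_low w))" for L w
    by (induction w arbitrary: L) (simp_all add: D(4)[OF A] D(4)[OF B] D(5)[OF A] D(5)[OF B] gen)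
  then have "A L = B L" for L
    by (rule uh_hlinear_unique[OF lin(1)[OF A] lin(1)[OF B]])
  then show ?thesis by (rule ext)
qed

lemma momentum_action_eq: "momentum_action = act"
  unfolding momentum_action_def
proof (rule the_equality)
  show "module_algebra act \<and>
      (\<forall>\<mu> \<nu>. act (P_low \<mu>) (X_up \<nu>) = (if \<mu> = \<nu> then fps_const (- \<i>) else 0) *\<^sub>h 1)"
    using module_algebra_act act_X_up by blast
  fix A assume A: "module_algebra A \<and>
      (\<forall>\<mu> \<nu>. A (P_low \<mu>) (X_up \<nu>) = (if \<mu> = \<nu> then fps_const (- \<i>) else 0) *\<^sub>h 1)"
  have low: "X_low \<nu> = fps_const (eta \<nu> \<nu>) *\<^sub>h X_up \<nu>" for \<nu>
    by (simp add: X_up_eq hscale_hscale eta_def hscale_one)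
  have "hlinear (A L)" for L using A by (simp add: module_algebra_def hbilinear_def)
  note scale = hlinear_hscale[OF this]
  show "A = act"
  proof (rule module_algebra_unique)
    show "A (P_low \<mu>) (X_low \<nu>) = act (P_low \<mu>) (X_low \<nu>)" for \<mu> \<nu>
      using A act_X_up[of \<mu> \<nu>] by (simp only: low[of \<nu>] scale act_simps(4))
    show "\<exists>c. act (P_low \<mu>) (X_low \<nu>) = c *\<^sub>h 1" for \<mu> \<nu>
      using act_X_low by blast
  qed (use A module_algebra_act in blast)+
qed

section \<open>Multiplicativity of the realization\<close>

lemma smash_mult:
  "hbilinear smash_mult"
  "smash_mult (f \<otimes>\<^sub>h L) (g \<otimes>\<^sub>h M) = ctensor_lift (\<lambda>L1 L2. (f * act L1 g) \<otimes>\<^sub>h (L2 * M)) (coproduct L)"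
  using theI'[OF smash_mult_ex1[OF hbilinear_act]]
  unfolding smash_mult_def momentum_action_eq by blast+

text \<open>On pure tensors this is f (L g) M with the cross relation applied to L g, which
  reproduces the formula of the smash product under normal ordering. Bilinearity and uniqueness of
  linear maps on the tensor product give the rest.\<close>

lemma realize_smash_mult: "realize (smash_mult s t) = realize s * realize t"
proof -
  have lin: "hlinear (smash_mult s)" "hlinear (\<lambda>s. smash_mult s t)" for s t
    using smash_mult(1) by (auto simp: hbilinear_def)
  have tens: "realize (smash_mult (f \<otimes>\<^sub>h L) (g \<otimes>\<^sub>h M)) = realize (f \<otimes>\<^sub>h L) * realize (g \<otimes>\<^sub>h M)" for f L g M
  proof -
    let ?B = "\<lambda>L1 L2. (f * act L1 g) \<otimes>\<^sub>h (L2 * M)"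
    have B: "hbilinear ?B"
      by (simp add: hbilinear_def hlinear_def act_simps tens_simps distrib_left distrib_right
          hscale_mult_left hscale_mult_right)
    have "(\<lambda>x. realize (ctensor_lift ?B x)) = (\<lambda>x. X_embed f * (sweedler g x * mom_embed M))"
    proof (rule ctensor_hlinear_unique)
      show "hlinear (\<lambda>x. realize (ctensor_lift ?B x))"
        using hlinear_realize hlinear_ctensor_lift[OF B] by (simp add: hlinear_def)
      show "hlinear (\<lambda>x. X_embed f * (sweedler g x * mom_embed M))"
        by (rule hlinear_right[OF hlinear_left[OF hlinear_sweedler]])
      show "realize (ctensor_lift ?B (a \<otimes>\<^sub>h b)) = X_embed f * (sweedler g (a \<otimes>\<^sub>h b) * mom_embed M)" for a b
        by (simp add: ctensor_lift_tens[OF B] realize_tens sweedler_tens X_embed_simps(4) mom_embed_simps(4) mult.assoc)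
    qed
    from fun_cong[OF this, of "coproduct L"] show ?thesis
      by (simp only: smash_mult(2) realize_tens cross_relation[symmetric] mult.assoc)
  qed
  have "(\<lambda>t. realize (smash_mult (f \<otimes>\<^sub>h L) t)) = (\<lambda>t. realize (f \<otimes>\<^sub>h L) * realize t)" for f L
    by (rule ctensor_hlinear_unique)
      (use hlinear_realize lin(1) in \<open>auto simp: hlinear_def tens distrib_left hscale_mult_right\<close>)
  then have "(\<lambda>s. realize (smash_mult s t)) = (\<lambda>s. realize s * realize t)"
    by (intro ctensor_hlinear_unique)
      (use hlinear_realize lin(2) in \<open>auto simp: hlinear_def distrib_right hscale_mult_left dest: fun_cong\<close>)
  then show ?thesis by (rule fun_cong)
qed

theorem mainTheorem2:
  shows "\<exists>\<phi> :: deformed_weyl \<Rightarrow> weyl fps.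
    bij \<phi> \<and> hlinear \<phi> \<and> (\<forall>a b. \<phi> (smash_mult a b) = \<phi> a * \<phi> b) \<and> \<phi> (1 \<otimes>\<^sub>h 1) = 1"
proof (intro exI conjI allI)
  show "realize (1 \<otimes>\<^sub>h 1) = 1"
    by (simp add: realize_tens X_embed_simps mom_embed_simps)
qed (rule bij_realize hlinear_realize realize_smash_mult)+

end
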